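(* Let $d\ge 2$, $\alpha\in(0,2)$, $m>0$, and let $D\subset\mathbb{R}^d$ be a domain of finite volume $|D|<\infty$ (in particular, any bounded domain). Let $\lambda_1<\lambda_2\le\lambda_3\le\cdots$ be the eigenvalues associated with the semigroup $P_t^D$ of the relativistic $\alpha$-stable process with mass $m$ killed upon exiting $D$, and let $N(\lambda)$ be the number of eigenvalues $\lambda_j$ (counted with multiplicity) which do not exceed $\lambda$. Then $$\lim_{\lambda\to\infty}\lambda^{-d/\alpha}e^{-m/\lambda}N(\lambda)=\frac{C_1|D|}{\Gamma(1+d/\alpha)},\qquad C_1=\frac{\omega_d\,\Gamma(d/\alpha)}{(2\pi)^d\alpha},\quad \omega_d=\frac{2\pi^{d/2}}{\Gamma(d/2)}.$$
   Context: The relativistic $\alpha$-stable process with mass $m$ is the $\mathbb{R}^d$-valued process $X_t$ with stationary independent increments, right-continuous sample paths with left limits, and (started at $0$) characteristic function $\mathbb{E}e^{i\xi\cdot X_t}=e^{-t\{(m^{2/\alpha}+|\xi|^2)^{\alpha/2}-m\}}$, $\xi\in\mathbb{R}^d$. $\mathbb{E}^x$ denotes expectation for the process started at $x$. For an open set $D$, $\tau_D=\inf\{t\ge0: X_t\notin D\}$ and $P_t^Df(x)=\mathbb{E}^x[f(X_t);\,t<\tau_D]$ is the semigroup of the killed process acting on $L^2(D)$. When $D$ has finite volume there is an orthonormal basis $\{\varphi_n\}_{n\ge1}$ of $L^2(D)$ and numbers $\lambda_1<\lambda_2\le\lambda_3\le\cdots$, $\lambda_n\to\infty$, with $P_t^D\varphi_n=e^{-\lambda_nt}\varphi_n$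 for all $t>0$; these $\lambda_n$ are the eigenvalues in question. $|D|$ is the $d$-dimensional Lebesgue measure of $D$. *)

theory Defs
  imports "HOL-Probability.Probability"
begin

text \<open>Euclidean space of dimension d is modelled by a type of class
  \<open>euclidean_space\<close> with \<open>DIM('a) = d\<close>. Only times \<open>t \<ge> 0\<close> are relevant.\<close>

locale levy_process = prob_space M
  for M :: "'w measure" +
  fixes X :: "real \<Rightarrow> 'w \<Rightarrow> 'a::euclidean_space"
  assumes measurable_X: "\<And>t. 0 \<le> t \<Longrightarrow> X t \<in> borel_measurable M"
    and start_zero: "AE \<omega> in M. X 0 \<omega> = 0"
    and indep_increments:
      "\<And>(t :: nat \<Rightarrow> real) n. 0 \<le> t 0 \<Longrightarrow> (\<And>i. i < n \<Longrightarrow> t i < t (Suc i)) \<Longrightarrow>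
        indep_vars (\<lambda>_. borel) (\<lambda>i \<omega>. X (t (Suc i)) \<omega> - X (t i) \<omega>) {..<n}"
    and stationary_increments:
      "\<And>s h. 0 \<le> s \<Longrightarrow> 0 \<le> h \<Longrightarrow>
        distr M borel (\<lambda>\<omega>. X (s + h) \<omega> - X s \<omega>) = distr M borel (\<lambda>\<omega>. X h \<omega> - X 0 \<omega>)"
    and right_continuous:
      "\<And>\<omega> t. \<omega> \<in> space M \<Longrightarrow> 0 \<le> t \<Longrightarrow> continuous (at_right t) (\<lambda>s. X s \<omega>)"
    and left_limits:
      "\<And>\<omega> t. \<omega> \<in> space M \<Longrightarrow> 0 < t \<Longrightarrow> \<exists>l. ((\<lambda>s. X s \<omega>) \<longlongrightarrow> l) (at_left t)"

locale relativistic_stable_process = levy_process M X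
  for M :: "'w measure" and X :: "real \<Rightarrow> 'w \<Rightarrow> 'a::euclidean_space" +
  fixes \<alpha> m :: real
  assumes char_X:
    "\<And>t \<xi>. 0 \<le> t \<Longrightarrow>
      (CLINT \<omega>|M. iexp (\<xi> \<bullet> X t \<omega>)) =
      complex_of_real (exp (- t * ((m powr (2 / \<alpha>) + (norm \<xi>)\<^sup>2) powr (\<alpha> / 2) - m)))"

text \<open>The exit time is \<open>\<infinity>\<close> (the infimum of the empty set) for a path that never leaves D.\<close>

definition exit_time :: "'a set \<Rightarrow> (real \<Rightarrow> 'a) \<Rightarrow> ereal" where
  "exit_time D p = Inf {ereal t | t. 0 \<le> t \<and> p t \<notin> D}"

text \<open>The process started at x is \<open>x + X\<close>, where X starts at 0. The event \<open>t < \<tau>\<^sub>D\<close> is in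
  general measurable only up to a null set, so the expectation is taken with respect to the
  completed probability measure.\<close>

definition killed_semigroup ::
  "'w measure \<Rightarrow> (real \<Rightarrow> 'w \<Rightarrow> 'a::euclidean_space) \<Rightarrow> 'a set \<Rightarrow> real \<Rightarrow> ('a \<Rightarrow> real) \<Rightarrow> 'a \<Rightarrow> real"
where
  "killed_semigroup M X D t f x =
    (LINT \<omega>:{\<omega> \<in> space M. ereal t < exit_time D (\<lambda>s. x + X s \<omega>)}|completion M. f (x + X t \<omega>))"

text \<open>Elements of \<open>L\<^sup>2(D)\<close> are represented by functions on the whole space whose values outside D
  are irrelevant; equality in \<open>L\<^sup>2(D)\<close> is equality almost everywhere on D. Every class has a Borel
  representative.\<close>

definition square_integrable_on :: "('a::euclidean_space \<Rightarrow> real) \<Rightarrow> 'a set \<Rightarrow> bool" where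
  "square_integrable_on f D \<longleftrightarrow>
    set_borel_measurable lborel D f \<and> set_integrable lborel D (\<lambda>x. (f x)\<^sup>2)"

definition L2_inner :: "'a::euclidean_space set \<Rightarrow> ('a \<Rightarrow> real) \<Rightarrow> ('a \<Rightarrow> real) \<Rightarrow> real" where
  "L2_inner D f g = (LINT x:D|lborel. f x * g x)"

definition L2_norm :: "'a::euclidean_space set \<Rightarrow> ('a \<Rightarrow> real) \<Rightarrow> real" where
  "L2_norm D f = sqrt (L2_inner D f f)"

text \<open>The basis is indexed by \<open>n \<ge> 1\<close>.\<close>

definition L2_orthonormal_basis :: "'a::euclidean_space set \<Rightarrow> (nat \<Rightarrow> 'a \<Rightarrow> real) \<Rightarrow> bool" where
  "L2_orthonormal_basis D \<phi> \<longleftrightarrow>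
    (\<forall>n\<ge>1. square_integrable_on (\<phi> n) D) \<and>
    (\<forall>i\<ge>1. \<forall>j\<ge>1. L2_inner D (\<phi> i) (\<phi> j) = (if i = j then 1 else 0)) \<and>
    (\<forall>f. square_integrable_on f D \<longrightarrow>
      (\<lambda>n. L2_norm D (\<lambda>x. f x - (\<Sum>k=1..n. L2_inner D f (\<phi> k) * \<phi> k x))) \<longlonglongrightarrow> 0)"

definition eigenvalue_count :: "(nat \<Rightarrow> real) \<Rightarrow> real \<Rightarrow> nat" where
  "eigenvalue_count lam r = card {j. 1 \<le> j \<and> lam j \<le> r}"

definition omega_const :: "nat \<Rightarrow> real" where
  "omega_const d = 2 * pi powr (real d / 2) / Gamma (real d / 2)"

definition C1_const :: "nat \<Rightarrow> real \<Rightarrow> real" where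
  "C1_const d \<alpha> = omega_const d * Gamma (real d / \<alpha>) / ((2 * pi) ^ d * \<alpha>)"

end

theory Submission
  imports Defs "HOL-Real_Asymp.Real_Asymp"
begin

text \<open>
  Write \<open>d\<close> for the dimension, \<open>N(r)\<close> for the number of eigenvalues up to \<open>r\<close>,
  \<open>\<psi>(\<xi>) = (m\<^bsup>2/\<alpha>\<^esup> + |\<xi>|\<^sup>2)\<^bsup>\<alpha>/2\<^esup> - m\<close>, and let
  \<open>w\<^sub>k(\<xi>)\<close> be the squared modulus of the Fourier transform of \<open>\<phi>\<^sub>k\<close>, extended by zero outside \<open>D\<close>.
  The function \<open>w\<^sub>k\<close> says where in frequency space the eigenvalue \<open>\<lambda>\<^sub>k\<close> sits, and three facts about
  it give the theorem without heat kernels and without a Tauberian theorem.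

  \<^item> By Plancherel (lemma \<open>plancherel\<close>) \<open>w\<^sub>k\<close> has total mass \<open>(2\<pi>)\<^sup>d\<close>. Hence
    \<open>(2\<pi>)\<^sup>d N(r)\<close> is the integral over \<open>\<xi>\<close> of the sum of all \<open>w\<^sub>k(\<xi>)\<close> with \<open>\<lambda>\<^sub>k \<le> r\<close>.
  \<^item> Expanding the plane wave \<open>exp(i\<xi>x)\<close>, restricted to \<open>D\<close>, in the basis shows that for fixed \<open>\<xi>\<close> the
    weights \<open>w\<^sub>k(\<xi>)\<close> add up to \<open>|D|\<close>, and that the sum of \<open>exp(-\<lambda>\<^sub>k t) w\<^sub>k(\<xi>)\<close> is
    \<open>L\<^sub>t(\<xi>) = \<integral>\<^sub>D E[cos(\<xi> X\<^sub>t); t < \<tau>\<^sub>D] dx\<close> (lemmas \<open>fourier_square_mass\<close> and \<open>fourier_square_trace\<close>).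
    Since \<open>D\<close> is open, paths started in \<open>D\<close> do not leave it at once, so that
    \<open>L\<^sub>t(\<xi>) = |D| exp(-t\<psi>(\<xi>)) + o(1)\<close> uniformly in \<open>\<xi>\<close> as \<open>t \<rightarrow> 0\<close>
    (\<open>killed_symbol_approx\<close>, \<open>exit_mass_tendsto\<close>).
  \<^item> The Fourier transform of a Gaussian is positive. Replacing \<open>[t < \<tau>\<^sub>D]\<close> by the whole space therefore
    only increases the Gaussian averages of \<open>L\<^sub>t\<close>, which yields
    \<open>\<integral> L\<^sub>t \<le> |D| \<integral> exp(-t\<psi>)\<close> (\<open>fourier_positivity\<close>).

  Put \<open>t = 1/r\<close> and \<open>\<xi> = r\<^bsup>1/\<alpha>\<^esup> \<eta>\<close>, so that \<open>t\<psi>(\<xi>) \<rightarrow> |\<eta>|\<^sup>\<alpha>\<close>. The second fact, used at the times \<open>1/r\<close> and \<open>2/r\<close>,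
  says that under the weights \<open>w\<^sub>k(\<xi>)\<close> the quantity \<open>exp(-\<lambda>\<^sub>k/r)\<close> has a variance tending to zero around
  \<open>exp(-|\<eta>|\<^sup>\<alpha>)\<close>; hence the weights with \<open>\<lambda>\<^sub>k \<le> r\<close> add up to \<open>|D|\<close> in the limit if \<open>|\<eta>| < 1\<close>, and to \<open>0\<close> if \<open>|\<eta>| > 1\<close>
  (\<open>spectral_concentration\<close>). The third fact prevents mass from escaping to infinity in \<open>\<eta>\<close>, and a
  dominated convergence argument (\<open>dominated_by_convergent_masses\<close>) allows the limit to be taken under the
  integral: \<open>(2\<pi>)\<^sup>d r\<^bsup>-d/\<alpha>\<^esup> N(r)\<close> tends to \<open>|D|\<close> times the volume of the unit ball. The factor
  \<open>exp(-m/r)\<close> tends to \<open>1\<close>.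

  One probabilistic point remains. The event \<open>t < \<tau>\<^sub>D\<close> involves uncountably many times. It agrees almost
  surely with the measurable event that the path stays in one of countably many closed sets exhausting
  \<open>D\<close> (\<open>AE_stays_in_inner_part\<close>); this is quasi-left-continuity: a path that approaches the
  complement of \<open>D\<close> without having left \<open>D\<close> would have to be saved by a jump at a predictable time,
  and a Levy process almost surely has no such jump.
\<close>

section \<open>Gaussian Fourier integrals and Plancherel's identity\<close>

lemma lborel_integral_prod_Basis:
  fixes f :: "'a::euclidean_space \<Rightarrow> real \<Rightarrow> 'b::{real_normed_field,banach,second_countable_topology}"
  assumes f: "\<And>b. b \<in> Basis \<Longrightarrow> integrable lborel (f b)"
  shows "integrable lborel (\<lambda>x::'a. \<Prod>b\<in>Basis. f b (x \<bullet> b))" (is ?I)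
    and "integral\<^sup>L lborel (\<lambda>x::'a. \<Prod>b\<in>Basis. f b (x \<bullet> b)) = (\<Prod>b\<in>Basis. integral\<^sup>L lborel (f b))"
proof -
  interpret product_sigma_finite "\<lambda>_::'a. lborel :: real measure" ..
  have [measurable]: "\<And>b. b \<in> Basis \<Longrightarrow> f b \<in> borel_measurable borel"
    using f by (auto dest: borel_measurable_integrable)
  have m: "(\<lambda>x::'a. \<Prod>b\<in>Basis. f b (x \<bullet> b)) \<in> borel_measurable borel"
    by measurable
  have c: "(\<Sum>b\<in>Basis. g b *\<^sub>R b) \<bullet> c = g c" if "c \<in> Basis" for g and c :: 'a
    using that by (simp add: inner_sum_left_Basis)
  show ?I
    apply (subst lborel_eq)
    apply (subst integrable_distr_eq)
      apply (simp_all add: m c cong: prod.cong)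
    apply (rule product_integrable_prod)
     apply (simp_all add: f)
    done
  show "integral\<^sup>L lborel (\<lambda>x::'a. \<Prod>b\<in>Basis. f b (x \<bullet> b)) = (\<Prod>b\<in>Basis. integral\<^sup>L lborel (f b))"
    apply (subst lborel_eq)
    apply (subst integral_distr)
      apply (simp_all add: m c cong: prod.cong)
    apply (rule product_integral_prod)
     apply (simp_all add: f)
    done
qed

lemma lborel_integral_scale:
  fixes f :: "'a::euclidean_space \<Rightarrow> real"
  assumes "c > 0" and [measurable]: "f \<in> borel_measurable borel"
  shows "(\<integral>x. f x \<partial>lborel) = c ^ DIM('a) * (\<integral>x. f (c *\<^sub>R x) \<partial>lborel)"
    and "integrable lborel f \<longleftrightarrow> integrable lborel (\<lambda>x. f (c *\<^sub>R x))"
proof -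
  have c: "c \<noteq> 0" using assms by auto
  show "(\<integral>x. f x \<partial>lborel) = c ^ DIM('a) * (\<integral>x. f (c *\<^sub>R x) \<partial>lborel)"
    apply (subst lborel_affine[OF c, of 0])
    apply (subst integral_density)
    using assms by (simp_all add: integral_distr)
  show "integrable lborel f \<longleftrightarrow> integrable lborel (\<lambda>x. f (c *\<^sub>R x))"
    apply (subst lborel_affine[OF c, of 0])
    apply (subst integrable_density)
    using assms by (simp_all add: integrable_distr_eq)
qed

lemma lborel_integral_translate:
  fixes f :: "'a::euclidean_space \<Rightarrow> real"
  assumes [measurable]: "f \<in> borel_measurable borel"
  shows "(\<integral>x. f (t + x) \<partial>lborel) = (\<integral>x. f x \<partial>lborel)"
    and "integrable lborel (\<lambda>x. f (t + x)) \<longleftrightarrow> integrable lborel f"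
proof -
  have *: "lborel = distr lborel borel (\<lambda>x. t + x)" for t :: 'a
    using lborel_affine[of 1 t] by (simp add: density_1)
  show "(\<integral>x. f (t + x) \<partial>lborel) = (\<integral>x. f x \<partial>lborel)"
    by (subst (2) *[of t]) (simp add: integral_distr)
  show "integrable lborel (\<lambda>x. f (t + x)) \<longleftrightarrow> integrable lborel f"
    by (subst (2) *[of t]) (simp add: integrable_distr_eq)
qed

definition gauss :: "'a::euclidean_space \<Rightarrow> real" where
  "gauss x = exp (- (norm x)\<^sup>2 / 2)"

lemma gauss_measurable [measurable]: "gauss \<in> borel_measurable borel"
  unfolding gauss_def by measurable

lemma gauss_nonneg [simp]: "0 \<le> gauss x"
  by (simp add: gauss_def)

lemma gauss_prod: "gauss (x::'a::euclidean_space) = (\<Prod>b\<in>Basis. exp (- (x \<bullet> b)\<^sup>2 / 2))"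
  by (simp add: gauss_def exp_sum[symmetric] norm_eq_sqrt_inner euclidean_inner[of x x] sum_negf
      sum_divide_distrib power2_eq_square sum_nonneg)

lemma std_normal_fourier:
  "integrable lborel (\<lambda>x. iexp (x * t) * complex_of_real (exp (- x\<^sup>2 / 2)))"
  "(CLBINT x. iexp (x * t) * complex_of_real (exp (- x\<^sup>2 / 2)))
     = complex_of_real (sqrt (2 * pi) * exp (- t\<^sup>2 / 2))"
proof -
  have i: "integrable lborel (\<lambda>x. std_normal_density x)"
    using integrable_normal_moment[of 1 0 0] by simp
  have "integrable lborel (\<lambda>x. sqrt (2*pi) * std_normal_density x)"
    using i by (intro integrable_mult_right)
  then have i2: "integrable lborel (\<lambda>x::real. exp (- x\<^sup>2 / 2))"
    by (simp add: std_normal_density_def)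
  show "integrable lborel (\<lambda>x. iexp (x * t) * complex_of_real (exp (- x\<^sup>2 / 2)))"
    by (rule Bochner_Integration.integrable_bound[OF i2]) (auto simp: norm_mult)
  have "(CLBINT x. std_normal_density x *\<^sub>R iexp (t * x)) = char std_normal_distribution t"
    unfolding char_def
    by (subst integral_density) (auto simp: normal_density_nonneg)
  also have "\<dots> = exp (- t\<^sup>2 / 2)"
    by (simp add: char_std_normal_distribution)
  finally have "(CLBINT x. std_normal_density x *\<^sub>R iexp (t * x)) = exp (- t\<^sup>2 / 2)" .
  then have "(CLBINT x. sqrt (2*pi) *\<^sub>R (std_normal_density x *\<^sub>R iexp (t * x))) = sqrt (2*pi) * exp (- t\<^sup>2 / 2)"
    by (subst integral_scaleR_right) (simp add: scaleR_conv_of_real)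
  moreover have "sqrt (2*pi) *\<^sub>R (std_normal_density x *\<^sub>R iexp (t * x)) = iexp (x * t) * complex_of_real (exp (- x\<^sup>2 / 2))" for x
    by (simp add: std_normal_density_def scaleR_conv_of_real mult_ac)
  ultimately show "(CLBINT x. iexp (x * t) * complex_of_real (exp (- x\<^sup>2 / 2)))
     = complex_of_real (sqrt (2 * pi) * exp (- t\<^sup>2 / 2))" by simp
qed

text \<open>With this normalisation a Gaussian is, up to a constant factor, its own Fourier transform; only the
  cosine part is needed because Gaussians are even.\<close>

lemma gauss_fourier:
  fixes z :: "'a::euclidean_space"
  shows "integrable lborel (gauss :: 'a \<Rightarrow> real)"
    and "(\<integral>x. cos (x \<bullet> z) * gauss x \<partial>lborel) = (2 * pi) powr (DIM('a) / 2) * gauss z"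
proof -
  have eq: "(\<Prod>b\<in>Basis. iexp ((x \<bullet> b) * (z \<bullet> b)) * complex_of_real (exp (- (x \<bullet> b)\<^sup>2 / 2)))
      = iexp (x \<bullet> z) * complex_of_real (gauss x)" for x z :: 'a
    unfolding gauss_prod euclidean_inner[of x z]
    by (simp add: prod.distrib exp_sum sum_distrib_left)
  have int: "integrable lborel (\<lambda>x. iexp (x \<bullet> z) * complex_of_real (gauss x))" for z :: 'a
    using lborel_integral_prod_Basis(1)[where f = "\<lambda>b x. iexp (x * (z \<bullet> b)) * complex_of_real (exp (- x\<^sup>2 / 2))"]
      std_normal_fourier(1) unfolding eq by blast
  have "(CLINT x|lborel. iexp (x \<bullet> z) * complex_of_real (gauss x))
     = (\<Prod>b\<in>Basis. complex_of_real (sqrt (2 * pi) * exp (- (z \<bullet> b)\<^sup>2 / 2)))"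
    using lborel_integral_prod_Basis(2)[where f = "\<lambda>b x. iexp (x * (z \<bullet> b)) * complex_of_real (exp (- x\<^sup>2 / 2))"]
      std_normal_fourier unfolding eq by (simp add: eq)
  also have "\<dots> = complex_of_real ((2 * pi) powr (DIM('a) / 2) * gauss z)"
    by (simp add: gauss_prod prod.distrib powr_half_sqrt[symmetric] powr_realpow[symmetric] powr_powr
        flip: of_real_power)
  finally have *: "(CLINT x|lborel. iexp (x \<bullet> z) * complex_of_real (gauss x)) = complex_of_real ((2 * pi) powr (DIM('a) / 2) * gauss z)" .
  have "(\<integral>x. cos (x \<bullet> z) * gauss x \<partial>lborel) = (\<integral>x. Re (iexp (x \<bullet> z) * complex_of_real (gauss x)) \<partial>lborel)"
    by (simp add: Re_exp)
  also have "\<dots> = Re (CLINT x|lborel. iexp (x \<bullet> z) * complex_of_real (gauss x))"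
    by (rule integral_Re[OF int])
  finally show "(\<integral>x. cos (x \<bullet> z) * gauss x \<partial>lborel) = (2 * pi) powr (DIM('a) / 2) * gauss z"
    using * by simp
  show "integrable lborel (gauss :: 'a \<Rightarrow> real)"
    using integrable_Re[OF int[of 0]] by simp
qed

lemma gauss_fourier_scaled:
  fixes z :: "'a::euclidean_space"
  assumes s: "s > 0"
  shows "(\<integral>x. cos (x \<bullet> z) * gauss (s *\<^sub>R x) \<partial>lborel) = (2 * pi) powr (DIM('a) / 2) / s ^ DIM('a) * gauss (z /\<^sub>R s)"
proof -
  have "(\<integral>x. cos (x \<bullet> (z /\<^sub>R s)) * gauss x \<partial>lborel) = s ^ DIM('a) * (\<integral>x. cos (x \<bullet> z) * gauss (s *\<^sub>R x) \<partial>lborel)"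
    using s by (subst lborel_integral_scale(1)[OF s]) (simp_all flip: mult.assoc)
  then have "s ^ DIM('a) * (\<integral>x. cos (x \<bullet> z) * gauss (s *\<^sub>R x) \<partial>lborel) = (2 * pi) powr (DIM('a) / 2) * gauss (z /\<^sub>R s)"
    unfolding gauss_fourier(2) by simp
  then show ?thesis
    using s by (simp add: eq_divide_eq mult.commute)
qed

lemma integrable_gauss_scaled:
  "s > 0 \<Longrightarrow> integrable lborel (\<lambda>x::'a::euclidean_space. gauss (s *\<^sub>R x))"
  by (subst lborel_integral_scale(2)[symmetric]) (simp_all add: gauss_fourier(1))

text \<open>Fubini moves a Gaussian cutoff in frequency onto the random variable \<open>Z\<close>, where it becomes a
  nonnegative Gaussian weight. Both the trace bound and Plancherel's identity are read off from this
  formula as the cutoff is removed.\<close>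

lemma gauss_average:
  fixes Z :: "'p \<Rightarrow> 'a::euclidean_space" and V :: "'p \<Rightarrow> real"
  assumes N: "sigma_finite_measure N" and V: "integrable N V" and Z [measurable]: "Z \<in> borel_measurable N"
    and s: "s > 0"
  shows "integrable lborel (\<lambda>\<xi>. (\<integral>p. V p * cos (\<xi> \<bullet> Z p) \<partial>N) * gauss (s *\<^sub>R \<xi>))" (is ?I)
    and "(\<integral>\<xi>. (\<integral>p. V p * cos (\<xi> \<bullet> Z p) \<partial>N) * gauss (s *\<^sub>R \<xi>) \<partial>lborel)
      = (\<integral>p. V p * ((2 * pi) powr (DIM('a) / 2) / s ^ DIM('a) * gauss (Z p /\<^sub>R s)) \<partial>N)"
proof -
  interpret N: sigma_finite_measure N by fact
  interpret P: pair_sigma_finite N "lborel :: 'a measure" ..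
  have [measurable]: "V \<in> borel_measurable N" using V by auto
  have i1: "integrable (N \<Otimes>\<^sub>M lborel) (\<lambda>(p, \<xi>::'a). V p * gauss (s *\<^sub>R \<xi>))"
    by (rule P.Fubini_integrable) (use V s in \<open>auto simp: abs_mult integrable_gauss_scaled\<close>)
  have i2: "integrable (N \<Otimes>\<^sub>M lborel) (\<lambda>(p, \<xi>::'a). V p * cos (\<xi> \<bullet> Z p) * gauss (s *\<^sub>R \<xi>))"
    by (rule Bochner_Integration.integrable_bound[OF i1])
       (auto simp: abs_mult intro!: AE_I2 mult_right_mono mult_left_le)
  show ?I using P.integrable_snd[OF i2] by simp
  have "(\<integral>\<xi>. (\<integral>p. V p * cos (\<xi> \<bullet> Z p) * gauss (s *\<^sub>R \<xi>) \<partial>N) \<partial>lborel)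
      = (\<integral>p. (\<integral>\<xi>. V p * cos (\<xi> \<bullet> Z p) * gauss (s *\<^sub>R \<xi>) \<partial>lborel) \<partial>N)"
    by (rule P.Fubini_integral[OF i2])
  moreover have "(\<integral>p. V p * cos (\<xi> \<bullet> Z p) * gauss (s *\<^sub>R \<xi>) \<partial>N) = (\<integral>p. V p * cos (\<xi> \<bullet> Z p) \<partial>N) * gauss (s *\<^sub>R \<xi>)" for \<xi>
    by simp
  moreover have "(\<integral>\<xi>. V p * cos (\<xi> \<bullet> Z p) * gauss (s *\<^sub>R \<xi>) \<partial>lborel)
      = V p * ((2 * pi) powr (DIM('a) / 2) / s ^ DIM('a) * gauss (Z p /\<^sub>R s))" for p
    by (simp only: mult.assoc integral_mult_right_zero gauss_fourier_scaled[OF s])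
  ultimately show "(\<integral>\<xi>. (\<integral>p. V p * cos (\<xi> \<bullet> Z p) \<partial>N) * gauss (s *\<^sub>R \<xi>) \<partial>lborel)
      = (\<integral>p. V p * ((2 * pi) powr (DIM('a) / 2) / s ^ DIM('a) * gauss (Z p /\<^sub>R s)) \<partial>N)"
    by simp
qed

lemma gauss_cutoff_mono_conv:
  fixes x :: "'a::euclidean_space"
  shows "mono (\<lambda>n. gauss (x /\<^sub>R real (Suc n)))" "(\<lambda>n. gauss (x /\<^sub>R real (Suc n))) \<longlonglongrightarrow> 1"
proof -
  have "norm (x /\<^sub>R real (Suc n)) \<le> norm (x /\<^sub>R real (Suc m))" if "m \<le> n" for m n
    using that by (simp add: divide_simps mult_left_mono)
  then show "mono (\<lambda>n. gauss (x /\<^sub>R real (Suc n)))"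
    unfolding mono_def gauss_def by (auto intro!: power_mono simp del: norm_scaleR)
  have "(\<lambda>n. x /\<^sub>R real (Suc n)) \<longlonglongrightarrow> 0 *\<^sub>R x"
    by (intro tendsto_intros LIMSEQ_inverse_real_of_nat)
  then have *: "(\<lambda>n. x /\<^sub>R real (Suc n)) \<longlonglongrightarrow> 0" by simp
  have "(\<lambda>n. exp (- (norm (x /\<^sub>R real (Suc n)))\<^sup>2 / 2)) \<longlonglongrightarrow> exp (- (norm (0::'a))\<^sup>2 / 2)"
    by (intro tendsto_exp tendsto_divide tendsto_minus tendsto_power tendsto_norm tendsto_const *) auto
  then show "(\<lambda>n. gauss (x /\<^sub>R real (Suc n))) \<longlonglongrightarrow> 1"
    by (simp add: gauss_def del: norm_scaleR)
qed

lemma integral_gauss_cutoff: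
  fixes f :: "'a::euclidean_space \<Rightarrow> real"
  assumes [measurable]: "f \<in> borel_measurable borel" and nn: "\<And>x. 0 \<le> f x"
    and int: "\<And>n. integrable lborel (\<lambda>x. f x * gauss (x /\<^sub>R real (Suc n)))"
    and lim: "(\<lambda>n. \<integral>x. f x * gauss (x /\<^sub>R real (Suc n)) \<partial>lborel) \<longlonglongrightarrow> C"
  shows "integrable lborel f" "integral\<^sup>L lborel f = C"
proof -
  have 1: "AE x in lborel. mono (\<lambda>n. f x * gauss (x /\<^sub>R real (Suc n)))"
    using gauss_cutoff_mono_conv(1) nn unfolding mono_def by (intro AE_I2 allI impI mult_left_mono) auto
  have 2: "AE x in lborel. (\<lambda>n. f x * gauss (x /\<^sub>R real (Suc n))) \<longlonglongrightarrow> f x"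
    using tendsto_mult[OF tendsto_const gauss_cutoff_mono_conv(2)] by (intro AE_I2) fastforce
  show "integrable lborel f" "integral\<^sup>L lborel f = C"
    using integrable_monotone_convergence[OF int 1 2 lim] integral_monotone_convergence[OF int 1 2 lim]
    by auto
qed

lemma integral_gauss_cutoff_le:
  fixes f :: "'a::euclidean_space \<Rightarrow> real"
  assumes [measurable]: "f \<in> borel_measurable borel" and nn: "\<And>x. 0 \<le> f x"
    and int: "\<And>n. integrable lborel (\<lambda>x. f x * gauss (x /\<^sub>R real (Suc n)))"
    and le: "\<And>n. (\<integral>x. f x * gauss (x /\<^sub>R real (Suc n)) \<partial>lborel) \<le> C"
  shows "integrable lborel f" "integral\<^sup>L lborel f \<le> C"
proof -
  let ?I = "\<lambda>n. \<integral>x. f x * gauss (x /\<^sub>R real (Suc n)) \<partial>lborel"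
  have "incseq ?I"
    unfolding incseq_def using gauss_cutoff_mono_conv(1) nn int unfolding mono_def
    by (intro allI impI integral_mono int mult_left_mono) auto
  then obtain c where c: "?I \<longlonglongrightarrow> c" "\<And>n. ?I n \<le> c"
    using le incseq_convergent[of ?I C] by blast
  then have "c \<le> C" using le by (intro LIMSEQ_le_const2[OF c(1)]) auto
  then show "integrable lborel f" "integral\<^sup>L lborel f \<le> C"
    using integral_gauss_cutoff[OF assms(1) nn int c(1)] by auto
qed

text \<open>Every Gaussian average of the left-hand transform is an integral of \<open>V\<close> against a nonnegative
  function of \<open>Z\<close>, hence monotone in \<open>V\<close>. Letting the cutoff tend to one preserves the inequality
  because both transforms are nonnegative.\<close>

lemma fourier_positivity:
  fixes Z :: "'p \<Rightarrow> 'a::euclidean_space" and V W :: "'p \<Rightarrow> real"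
  assumes N: "sigma_finite_measure N" and V: "integrable N V" and W: "integrable N W"
    and le: "\<And>p. p \<in> space N \<Longrightarrow> V p \<le> W p"
    and Z [measurable]: "Z \<in> borel_measurable N"
    and posV: "\<And>\<xi>. 0 \<le> (\<integral>p. V p * cos (\<xi> \<bullet> Z p) \<partial>N)"
    and posW: "\<And>\<xi>. 0 \<le> (\<integral>p. W p * cos (\<xi> \<bullet> Z p) \<partial>N)"
    and iW: "integrable lborel (\<lambda>\<xi>. \<integral>p. W p * cos (\<xi> \<bullet> Z p) \<partial>N)"
  shows "integrable lborel (\<lambda>\<xi>. \<integral>p. V p * cos (\<xi> \<bullet> Z p) \<partial>N)"
    and "(\<integral>\<xi>. (\<integral>p. V p * cos (\<xi> \<bullet> Z p) \<partial>N) \<partial>lborel) \<le> (\<integral>\<xi>. (\<integral>p. W p * cos (\<xi> \<bullet> Z p) \<partial>N) \<partial>lborel)"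
proof -
  interpret N: sigma_finite_measure N by fact
  let ?L = "\<lambda>V \<xi>. \<integral>p. V p * cos (\<xi> \<bullet> Z p) \<partial>N"
  have [measurable]: "V \<in> borel_measurable N" using V by auto
  have m: "?L V \<in> borel_measurable borel" by measurable
  have s: "inverse (real (Suc n)) > 0" for n by simp
  note av = gauss_average[OF N _ Z s]
  have bnd: "(\<integral>\<xi>. ?L V \<xi> * gauss (\<xi> /\<^sub>R real (Suc n)) \<partial>lborel) \<le> integral\<^sup>L lborel (?L W)" for n
  proof -
    let ?g = "\<lambda>p. (2 * pi) powr (DIM('a) / 2) / inverse (real (Suc n)) ^ DIM('a) * gauss (Z p /\<^sub>R inverse (real (Suc n)))"
    have ig: "integrable N (\<lambda>p. V p * ?g p)" if "integrable N V" for V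
    proof -
      have [measurable]: "V \<in> borel_measurable N" using that by auto
      show ?thesis
        by (rule Bochner_Integration.integrable_bound[OF integrable_mult_left[OF that, of "(2 * pi) powr (DIM('a) / 2) / inverse (real (Suc n)) ^ DIM('a)"]])
          (auto simp: abs_mult gauss_def intro!: AE_I2 mult_left_mono divide_right_mono mult_left_le)
    qed
    have "(\<integral>\<xi>. ?L V \<xi> * gauss (\<xi> /\<^sub>R real (Suc n)) \<partial>lborel) = (\<integral>p. V p * ?g p \<partial>N)"
      by (rule av(2)[OF V])
    also have "\<dots> \<le> (\<integral>p. W p * ?g p \<partial>N)"
      by (intro integral_mono ig V W mult_right_mono le) auto
    also have "\<dots> = (\<integral>\<xi>. ?L W \<xi> * gauss (\<xi> /\<^sub>R real (Suc n)) \<partial>lborel)"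
      by (rule av(2)[OF W, symmetric])
    also have "\<dots> \<le> integral\<^sup>L lborel (?L W)"
      by (intro integral_mono iW av(1)[OF W]) (auto simp: gauss_def intro!: mult_left_le posW)
    finally show ?thesis .
  qed
  show "integrable lborel (?L V)" "integral\<^sup>L lborel (?L V) \<le> integral\<^sup>L lborel (?L W)"
    using integral_gauss_cutoff_le[OF m posV av(1)[OF V] bnd] by auto
qed

text \<open>For an open set the overlap with its translate converges by dominated convergence; outer
  regularity reduces the general case to this one.\<close>

lemma indicator_translate_tendsto:
  fixes A :: "'a::euclidean_space set"
  assumes A [measurable]: "A \<in> sets borel" and fin: "emeasure lborel A < \<infinity>" and z: "z \<longlonglongrightarrow> 0"
  shows "(\<lambda>n. \<integral>x. \<bar>indicator A (z n + x) - indicator A x :: real\<bar> \<partial>lborel) \<longlonglongrightarrow> 0"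
proof (rule LIMSEQ_I)
  fix e :: real assume e: "e > 0"
  obtain U where U: "open U" "A \<subseteq> U" "emeasure lborel (U - A) < e / 4"
    using outer_regular_lborel[of A "e/4"] A e by auto
  have [measurable]: "U \<in> sets borel" using U by auto
  have UA: "emeasure lborel (U - A) < \<infinity>" using U(3) by (auto simp: less_top[symmetric])
  have "emeasure lborel U \<le> emeasure lborel A + emeasure lborel (U - A)"
    by (rule order_trans[OF _ emeasure_subadditive]) (auto intro!: emeasure_mono)
  then have finU: "emeasure lborel U < \<infinity>"
    using fin UA by (auto simp: less_top[symmetric] top_unique)
  have iU: "integrable lborel (indicator U :: 'a \<Rightarrow> real)" using finU by simp
  have iA: "integrable lborel (indicator A :: 'a \<Rightarrow> real)" using fin by simp
  have iUA: "integrable lborel (indicator (U - A) :: 'a \<Rightarrow> real)" using UA by simp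
  note tr = lborel_integral_translate
  let ?d = "\<lambda>n x. indicator U (z n + x) * indicator U x :: real"
  have id: "integrable lborel (?d n)" for n
    by (rule Bochner_Integration.integrable_bound[OF iU]) (auto simp: indicator_def)
  have "(\<lambda>n. \<integral>x. ?d n x \<partial>lborel) \<longlonglongrightarrow> (\<integral>x. indicator U x \<partial>lborel)"
  proof (rule integral_dominated_convergence[OF _ _ iU])
    show "AE x in lborel. (\<lambda>n. ?d n x) \<longlonglongrightarrow> indicator U x"
    proof (rule AE_I2)
      fix x
      show "(\<lambda>n. ?d n x) \<longlonglongrightarrow> indicator U x"
      proof (cases "x \<in> U")
        case True
        have "(\<lambda>n. z n + x) \<longlonglongrightarrow> 0 + x" by (intro tendsto_intros z)
        then have "eventually (\<lambda>n. z n + x \<in> U) sequentially"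
          using U(1) True by (auto dest: topological_tendstoD)
        then show ?thesis using True
          by (intro tendsto_eventually) (auto elim!: eventually_mono)
      qed auto
    qed
  qed (auto simp: indicator_def)
  then have "eventually (\<lambda>n. \<bar>(\<integral>x. ?d n x \<partial>lborel) - (\<integral>x. indicator U x \<partial>lborel)\<bar> < e / 8) sequentially"
    using e by (auto dest!: tendstoD[where e = "e/8"] simp: dist_real_def)
  then obtain n0 where n0: "\<And>n. n \<ge> n0 \<Longrightarrow> \<bar>(\<integral>x. ?d n x \<partial>lborel) - (\<integral>x. indicator U x \<partial>lborel)\<bar> < e / 8"
    by (auto simp: eventually_sequentially)
  have mU: "(\<integral>x. indicator (U - A) x \<partial>lborel) < e / 4"
  proof -
    have "measure lborel (U - A) < e / 4"
      using U(3) UA e by (metis measure_def enn2real_positive_iff ennreal_enn2real_if ennreal_less_iff infinity_ennreal_def order_less_irrefl enn2real_nonneg)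
    then show ?thesis by simp
  qed
  have "norm ((\<integral>x. \<bar>indicator A (z n + x) - indicator A x :: real\<bar> \<partial>lborel) - 0) < e" if "n \<ge> n0" for n
  proof -
    have i1: "integrable lborel (\<lambda>x. indicator U (z n + x) :: real)"
      "integrable lborel (\<lambda>x. indicator (U - A) (z n + x) :: real)"
      by (subst tr(2); use iU iUA in simp)+
    have "(\<integral>x. \<bar>indicator A (z n + x) - indicator A x :: real\<bar> \<partial>lborel)
      \<le> (\<integral>x. (indicator U (z n + x) + indicator U x - 2 * ?d n x) + (indicator (U - A) (z n + x) + indicator (U - A) x) \<partial>lborel)"
    proof (rule integral_mono')
      show "integrable lborel (\<lambda>x. (indicator U (z n + x) + indicator U x - 2 * ?d n x) + (indicator (U - A) (z n + x) + indicator (U - A) x))"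
        by (intro Bochner_Integration.integrable_add Bochner_Integration.integrable_diff integrable_mult_right i1 iU iUA id)
    qed (use U(2) in \<open>auto simp: indicator_def\<close>)
    also have "\<dots> = ((\<integral>x. indicator U (z n + x) \<partial>lborel) + (\<integral>x. indicator U x \<partial>lborel) - 2 * (\<integral>x. ?d n x \<partial>lborel))
       + ((\<integral>x. indicator (U - A) (z n + x) \<partial>lborel) + (\<integral>x. indicator (U - A) x \<partial>lborel))"
      using i1 iU iUA id by simp
    also have "\<dots> = 2 * ((\<integral>x. indicator U x \<partial>lborel) - (\<integral>x. ?d n x \<partial>lborel)) + 2 * (\<integral>x. indicator (U - A) x \<partial>lborel)"
      by (subst (1 2) tr(1)) simp_all
    also have "\<dots> < e" using conjunct2[OF n0[OF that, unfolded abs_less_iff]] mU e by argo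
    finally show ?thesis by simp
  qed
  then show "\<exists>n0. \<forall>n\<ge>n0. norm ((\<integral>x. \<bar>indicator A (z n + x) - indicator A x :: real\<bar> \<partial>lborel) - 0) < e"
    by blast
qed

lemma L1_translate_tendsto:
  fixes f :: "'a::euclidean_space \<Rightarrow> real"
  assumes "integrable lborel f" and z: "z \<longlonglongrightarrow> 0"
  shows "(\<lambda>n. \<integral>x. \<bar>f (z n + x) - f x\<bar> \<partial>lborel) \<longlonglongrightarrow> 0"
  using assms(1)
proof (induction f rule: integrable_induct)
  case (base A c)
  then have "(\<lambda>n. \<bar>c\<bar> * (\<integral>x. \<bar>indicator A (z n + x) - indicator A x :: real\<bar> \<partial>lborel)) \<longlonglongrightarrow> \<bar>c\<bar> * 0"
    using z by (intro tendsto_intros indicator_translate_tendsto) auto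
  then show ?case
    by (simp add: left_diff_distrib[symmetric] right_diff_distrib[symmetric] abs_mult mult.commute[of _ c] flip: integral_mult_right_zero)
next
  case (add f g)
  have tr: "integrable lborel (\<lambda>x. f (z n + x))" "integrable lborel (\<lambda>x. g (z n + x))" for n
    using add by (auto intro!: iffD2[OF lborel_integral_translate(2)])
  show ?case
  proof (rule real_tendsto_sandwich[OF _ _ tendsto_const])
    show "(\<lambda>n. (\<integral>x. \<bar>f (z n + x) - f x\<bar> \<partial>lborel) + (\<integral>x. \<bar>g (z n + x) - g x\<bar> \<partial>lborel)) \<longlonglongrightarrow> 0"
      using tendsto_add[OF add.IH] by simp
    have "(\<integral>x. \<bar>f (z n + x) + g (z n + x) - (f x + g x)\<bar> \<partial>lborel) \<le>
      (\<integral>x. \<bar>f (z n + x) - f x\<bar> \<partial>lborel) + (\<integral>x. \<bar>g (z n + x) - g x\<bar> \<partial>lborel)" for n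
    proof -
      have "(\<integral>x. \<bar>f (z n + x) + g (z n + x) - (f x + g x)\<bar> \<partial>lborel) \<le>
        (\<integral>x. \<bar>f (z n + x) - f x\<bar> + \<bar>g (z n + x) - g x\<bar> \<partial>lborel)"
        using add(1,2) tr[of n]
        by (intro integral_mono Bochner_Integration.integrable_diff Bochner_Integration.integrable_add integrable_abs) auto
      then show ?thesis using add(1,2) tr[of n] by simp
    qed
    then show "\<forall>\<^sub>F n in sequentially. (\<integral>x. \<bar>f (z n + x) + g (z n + x) - (f x + g x)\<bar> \<partial>lborel) \<le>
      (\<integral>x. \<bar>f (z n + x) - f x\<bar> \<partial>lborel) + (\<integral>x. \<bar>g (z n + x) - g x\<bar> \<partial>lborel)" by simp
  qed auto
next
  case (lim f s)
  have [measurable]: "f \<in> borel_measurable borel" "\<And>i. s i \<in> borel_measurable borel" using lim by auto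
  have if2: "integrable lborel (\<lambda>x. 3 * \<bar>f x\<bar>)" using lim by auto
  have "(\<lambda>i. \<integral>x. \<bar>s i x - f x\<bar> \<partial>lborel) \<longlonglongrightarrow> (\<integral>x. 0 \<partial>(lborel::'a measure))"
  proof (rule integral_dominated_convergence[OF _ _ if2])
    have "(\<lambda>i. \<bar>s i x - f x\<bar>) \<longlonglongrightarrow> 0" for x
      using lim.hyps(2)[of x] by (intro tendsto_rabs_zero) (simp add: LIM_zero_iff)
    then show "AE x in lborel. (\<lambda>i. \<bar>s i x - f x\<bar>) \<longlonglongrightarrow> 0" by simp
    show "AE x in lborel. norm \<bar>s i x - f x\<bar> \<le> 3 * \<bar>f x\<bar>" for i
    proof (rule AE_I2)
      fix x show "norm \<bar>s i x - f x\<bar> \<le> 3 * \<bar>f x\<bar>" using lim.hyps(3)[of x i] by (simp; linarith)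
    qed
  qed auto
  then have sf: "(\<lambda>i. \<integral>x. \<bar>s i x - f x\<bar> \<partial>lborel) \<longlonglongrightarrow> 0" by simp
  show ?case
  proof (rule LIMSEQ_I)
    fix e :: real assume e: "e > 0"
    obtain i where i: "(\<integral>x. \<bar>s i x - f x\<bar> \<partial>lborel) < e / 3"
      using LIMSEQ_D[OF sf, of "e/3"] e by (auto simp: abs_less_iff)
    obtain n0 where n0: "\<And>n. n \<ge> n0 \<Longrightarrow> (\<integral>x. \<bar>s i (z n + x) - s i x\<bar> \<partial>lborel) < e / 3"
      using LIMSEQ_D[OF lim.IH[of i], of "e/3"] e by (auto simp: abs_less_iff)
    have "norm ((\<integral>x. \<bar>f (z n + x) - f x\<bar> \<partial>lborel) - 0) < e" if "n \<ge> n0" for n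
    proof -
      have int: "integrable lborel (\<lambda>x. f (z n + x))" "integrable lborel (\<lambda>x. s i (z n + x))" "integrable lborel f" "integrable lborel (s i)"
        using lim by (auto intro!: iffD2[OF lborel_integral_translate(2)])
      have "(\<integral>x. \<bar>f (z n + x) - f x\<bar> \<partial>lborel) \<le> (\<integral>x. \<bar>s i (z n + x) - f (z n + x)\<bar> + (\<bar>s i (z n + x) - s i x\<bar> + \<bar>s i x - f x\<bar>) \<partial>lborel)"
        using int by (intro integral_mono Bochner_Integration.integrable_add Bochner_Integration.integrable_diff integrable_abs) auto
      also have "\<dots> = (\<integral>x. \<bar>s i (z n + x) - f (z n + x)\<bar> \<partial>lborel) + ((\<integral>x. \<bar>s i (z n + x) - s i x\<bar> \<partial>lborel) + (\<integral>x. \<bar>s i x - f x\<bar> \<partial>lborel))"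
        using int by simp
      also have "(\<integral>x. \<bar>s i (z n + x) - f (z n + x)\<bar> \<partial>lborel) = (\<integral>x. \<bar>s i x - f x\<bar> \<partial>lborel)"
        by (rule lborel_integral_translate(1)) simp
      also have "\<dots> + ((\<integral>x. \<bar>s i (z n + x) - s i x\<bar> \<partial>lborel) + (\<integral>x. \<bar>s i x - f x\<bar> \<partial>lborel)) < e"
        using i n0[OF that] by linarith
      finally show ?thesis by simp
    qed
    then show "\<exists>n0. \<forall>n\<ge>n0. norm ((\<integral>x. \<bar>f (z n + x) - f x\<bar> \<partial>lborel) - 0) < e" by blast
  qed
qed

lemma integrable_mult_of_squares:
  fixes f g :: "'p \<Rightarrow> real"
  assumes "f \<in> borel_measurable N" "g \<in> borel_measurable N"
    and "integrable N (\<lambda>x. (f x)\<^sup>2)" "integrable N (\<lambda>x. (g x)\<^sup>2)"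
  shows "integrable N (\<lambda>x. f x * g x)"
proof (rule Bochner_Integration.integrable_bound)
  show "integrable N (\<lambda>x. (f x)\<^sup>2 + (g x)\<^sup>2)" using assms by simp
  have "\<bar>a * b\<bar> \<le> a\<^sup>2 + b\<^sup>2" for a b :: real
    using sum_squares_bound[of "\<bar>a\<bar>" "\<bar>b\<bar>"] mult_nonneg_nonneg[of "\<bar>a\<bar>" "\<bar>b\<bar>"]
    unfolding abs_mult power2_abs by linarith
  then show "AE x in N. norm (f x * g x) \<le> norm ((f x)\<^sup>2 + (g x)\<^sup>2)" by (intro AE_I2) auto
qed (use assms in measurable)

text \<open>Continuity at zero follows from continuity of translation in \<open>L\<^sup>1\<close>, applied to \<open>f |f|\<close>: the map
  \<open>a \<mapsto> a |a|\<close> satisfies \<open>(a - b)\<^sup>2 \<le> 2 | a |a| - b |b| |\<close>.\<close>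

lemma autocorrelation:
  fixes f :: "'a::euclidean_space \<Rightarrow> real"
  assumes [measurable]: "f \<in> borel_measurable borel" and f2: "integrable lborel (\<lambda>x. (f x)\<^sup>2)"
  shows "integrable lborel (\<lambda>x. f x * f (z + x))"
    and "\<bar>\<integral>x. f x * f (z + x) \<partial>lborel\<bar> \<le> (\<integral>x. (f x)\<^sup>2 \<partial>lborel)"
    and "y \<longlonglongrightarrow> 0 \<Longrightarrow> (\<lambda>n. \<integral>x. f x * f (y n + x) \<partial>lborel) \<longlonglongrightarrow> (\<integral>x. (f x)\<^sup>2 \<partial>lborel)"
proof -
  have t2: "integrable lborel (\<lambda>x. (f (z + x))\<^sup>2)" for z
    using f2 lborel_integral_translate(2)[of "\<lambda>x. (f x)\<^sup>2" z] by simp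
  have e2: "(\<integral>x. (f (z + x))\<^sup>2 \<partial>lborel) = (\<integral>x. (f x)\<^sup>2 \<partial>lborel)" for z
    by (rule lborel_integral_translate(1)) simp
  show i: "integrable lborel (\<lambda>x. f x * f (z + x))" for z
    using integrable_mult_of_squares[OF _ _ f2 t2[of z]] by simp
  have "\<bar>a * b\<bar> \<le> (a\<^sup>2 + b\<^sup>2) / 2" for a b :: real
    using sum_squares_bound[of "\<bar>a\<bar>" "\<bar>b\<bar>"] by (simp add: abs_mult)
  then have "(\<integral>x. \<bar>f x * f (z + x)\<bar> \<partial>lborel) \<le> (\<integral>x. ((f x)\<^sup>2 + (f (z + x))\<^sup>2) / 2 \<partial>lborel)"
    using f2 t2 i by (intro integral_mono) auto
  also have "\<dots> = (\<integral>x. (f x)\<^sup>2 \<partial>lborel)"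
    using f2 t2 e2[of z] by simp
  finally show "\<bar>\<integral>x. f x * f (z + x) \<partial>lborel\<bar> \<le> (\<integral>x. (f x)\<^sup>2 \<partial>lborel)"
    using integral_abs_bound[of lborel "\<lambda>x. f x * f (z + x)"] by linarith
  \<comment> \<open>signed square, integrable because \<open>f\<close> is square integrable\<close>
  define \<psi> where "\<psi> x = f x * \<bar>f x\<bar>" for x
  have [measurable]: "\<psi> \<in> borel_measurable borel" unfolding \<psi>_def by simp
  have i\<psi>: "integrable lborel \<psi>"
    by (rule Bochner_Integration.integrable_bound[OF f2]) (auto simp: \<psi>_def power2_eq_square abs_mult)
  have i\<psi>': "integrable lborel (\<lambda>x. \<psi> (z + x))" for z
    using i\<psi> by (simp add: lborel_integral_translate(2))
  have alg: "(a - b)\<^sup>2 \<le> 2 * \<bar>a * \<bar>a\<bar> - b * \<bar>b\<bar>\<bar>" for a b :: real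
  proof -
    have 1: "(a - b)\<^sup>2 \<le> 2 * \<bar>a\<^sup>2 - b\<^sup>2\<bar>" if "0 \<le> a" "0 \<le> b" for a b :: real
    proof -
      have "\<bar>a - b\<bar> * \<bar>a - b\<bar> \<le> \<bar>a - b\<bar> * (a + b)" using that by (intro mult_left_mono) auto
      also have "\<dots> = \<bar>a\<^sup>2 - b\<^sup>2\<bar>" using that by (simp add: power2_eq_square square_diff_square_factored abs_mult mult.commute)
      finally have "(a - b)\<^sup>2 \<le> \<bar>a\<^sup>2 - b\<^sup>2\<bar>" by (simp add: power2_eq_square)
      also have "\<dots> \<le> 2 * \<bar>a\<^sup>2 - b\<^sup>2\<bar>" by simp
      finally show ?thesis .
    qed
    have 2: "(a - b)\<^sup>2 \<le> 2 * (a\<^sup>2 + b\<^sup>2)" for a b :: real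
      using zero_le_power2[of "a + b"] by (simp add: power2_eq_square algebra_simps)
    show ?thesis
    proof (cases "0 \<le> a"; cases "0 \<le> b")
      assume "0 \<le> a" "0 \<le> b" then show ?thesis using 1[of a b] by (simp add: power2_eq_square)
    next
      assume "\<not> 0 \<le> a" "\<not> 0 \<le> b" then show ?thesis using 1[of "-a" "-b"]
        by (simp add: power2_eq_square power2_commute[of b a] algebra_simps abs_minus_commute)
    next
      assume "0 \<le> a" "\<not> 0 \<le> b" then show ?thesis using 2[of a b] by (simp add: power2_eq_square)
    next
      assume "\<not> 0 \<le> a" "0 \<le> b" then show ?thesis using 2[of a b]
        by (simp add: power2_eq_square abs_if algebra_simps)
    qed
  qed
  have bound: "\<bar>(\<integral>x. f x * f (z + x) \<partial>lborel) - (\<integral>x. (f x)\<^sup>2 \<partial>lborel)\<bar> \<le> (\<integral>x. \<bar>\<psi> (z + x) - \<psi> x\<bar> \<partial>lborel)" for z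
  proof -
    have "(\<integral>x. (f (z + x) - f x)\<^sup>2 \<partial>lborel) = (\<integral>x. (f (z + x))\<^sup>2 + (f x)\<^sup>2 - 2 * (f x * f (z + x)) \<partial>lborel)"
      by (intro Bochner_Integration.integral_cong) (auto simp: power2_eq_square algebra_simps)
    also have "\<dots> = 2 * ((\<integral>x. (f x)\<^sup>2 \<partial>lborel) - (\<integral>x. f x * f (z + x) \<partial>lborel))"
      using f2 t2 i e2[of z] by simp
    finally have *: "(\<integral>x. (f (z + x) - f x)\<^sup>2 \<partial>lborel) = 2 * ((\<integral>x. (f x)\<^sup>2 \<partial>lborel) - (\<integral>x. f x * f (z + x) \<partial>lborel))" .
    have "(\<integral>x. (f (z + x) - f x)\<^sup>2 \<partial>lborel) \<le> (\<integral>x. 2 * \<bar>\<psi> (z + x) - \<psi> x\<bar> \<partial>lborel)"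
    proof (rule integral_mono')
      show "integrable lborel (\<lambda>x. 2 * \<bar>\<psi> (z + x) - \<psi> x\<bar>)" using i\<psi> i\<psi>' by simp
      show "(f (z + x) - f x)\<^sup>2 \<le> 2 * \<bar>\<psi> (z + x) - \<psi> x\<bar>" for x
        unfolding \<psi>_def by (rule alg)
    qed simp
    moreover have "0 \<le> (\<integral>x. (f (z + x) - f x)\<^sup>2 \<partial>lborel)" by simp
    ultimately show ?thesis using * by simp
  qed
  assume y: "y \<longlonglongrightarrow> 0"
  have "(\<lambda>n. (\<integral>x. f x * f (y n + x) \<partial>lborel) - (\<integral>x. (f x)\<^sup>2 \<partial>lborel)) \<longlonglongrightarrow> 0"
    by (rule Lim_null_comparison[OF _ L1_translate_tendsto[OF i\<psi> y]]) (use bound in auto)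
  then show "(\<lambda>n. \<integral>x. f x * f (y n + x) \<partial>lborel) \<longlonglongrightarrow> (\<integral>x. (f x)\<^sup>2 \<partial>lborel)"
    by (simp add: LIM_zero_iff)
qed

text \<open>The squared modulus of the Fourier transform of \<open>f\<close>, with the real and imaginary parts of the
  transform written out.\<close>

definition fourier_square :: "('a::euclidean_space \<Rightarrow> real) \<Rightarrow> 'a \<Rightarrow> real" where
  "fourier_square f \<xi> = (\<integral>x. f x * cos (\<xi> \<bullet> x) \<partial>lborel)\<^sup>2 + (\<integral>x. f x * sin (\<xi> \<bullet> x) \<partial>lborel)\<^sup>2"

text \<open>The function \<open>fourier_square f\<close> is the Fourier transform of the autocorrelation of \<open>f\<close>. Its Gaussian
  averages are averages of the autocorrelation concentrating at zero, where its value is the square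
  integral of \<open>f\<close>.\<close>

lemma plancherel:
  fixes f :: "'a::euclidean_space \<Rightarrow> real"
  assumes f1: "integrable lborel f" and f2: "integrable lborel (\<lambda>x. (f x)\<^sup>2)"
  shows "integrable lborel (fourier_square f)"
    and "integral\<^sup>L lborel (fourier_square f) = (2 * pi) ^ DIM('a) * (\<integral>x. (f x)\<^sup>2 \<partial>lborel)"
proof -
  have [measurable]: "f \<in> borel_measurable borel" using f1 by auto
  define F where "F y = (\<integral>x. f x * f (y + x) \<partial>lborel)" for y
  have if1: "integrable lborel (\<lambda>x. f (z + x))" "integrable lborel (\<lambda>x. f (x + z))" for z
    using f1 lborel_integral_translate(2)[of f z] by (simp_all add: add.commute)
  have iV: "integrable (lborel \<Otimes>\<^sub>M lborel) (\<lambda>(x, y). f x * f (y + x))"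
  proof (rule lborel_pair.Fubini_integrable)
    have "(\<integral>y. norm (f (y + x)) \<partial>lborel) = (\<integral>y. norm (f y) \<partial>lborel)" for x
      using lborel_integral_translate(1)[of "\<lambda>x. norm (f x)" x] by (simp add: add.commute)
    then show "integrable lborel (\<lambda>x. \<integral>y. norm (case (x, y) of (x, y) \<Rightarrow> f x * f (y + x)) \<partial>lborel)"
      using f1 by (simp add: abs_mult)
  qed (use if1 in auto)
  have iF: "integrable lborel F"
    using lborel_pair.integrable_snd[OF iV] by (simp add: F_def[abs_def])
  have [measurable]: "F \<in> borel_measurable borel" using iF by auto
  have ic: "integrable lborel (\<lambda>x. f x * cos (\<xi> \<bullet> x))" "integrable lborel (\<lambda>x. f x * sin (\<xi> \<bullet> x))" for \<xi>
    by (rule Bochner_Integration.integrable_bound[OF f1]; auto simp: abs_mult intro!: AE_I2 mult_left_le)+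
  have W: "fourier_square f \<xi> = (\<integral>y. F y * cos (\<xi> \<bullet> y) \<partial>lborel)" for \<xi>
  proof -
    have iVc: "integrable (lborel \<Otimes>\<^sub>M lborel) (\<lambda>(x, y). f x * f (y + x) * cos (\<xi> \<bullet> y))"
      by (rule Bochner_Integration.integrable_bound[OF iV]) (auto simp: abs_mult intro!: AE_I2 mult_left_le)
    have "(\<integral>y. F y * cos (\<xi> \<bullet> y) \<partial>lborel) = (\<integral>y. (\<integral>x. f x * f (y + x) * cos (\<xi> \<bullet> y) \<partial>lborel) \<partial>lborel)"
      by (simp add: F_def)
    also have "\<dots> = (\<integral>x. (\<integral>y. f x * f (y + x) * cos (\<xi> \<bullet> y) \<partial>lborel) \<partial>lborel)"
      by (rule lborel_pair.Fubini_integral[OF iVc])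
    also have "(\<lambda>x. \<integral>y. f x * f (y + x) * cos (\<xi> \<bullet> y) \<partial>lborel)
      = (\<lambda>x. f x * cos (\<xi> \<bullet> x) * (\<integral>x. f x * cos (\<xi> \<bullet> x) \<partial>lborel) + f x * sin (\<xi> \<bullet> x) * (\<integral>x. f x * sin (\<xi> \<bullet> x) \<partial>lborel))"
    proof
      fix x
      have "(\<integral>y. f x * f (y + x) * cos (\<xi> \<bullet> y) \<partial>lborel) = (\<integral>y. f x * f (x + y) * cos (\<xi> \<bullet> (x + y) - \<xi> \<bullet> x) \<partial>lborel)"
        by (simp add: inner_add_right add.commute)
      also have "\<dots> = (\<integral>y. f x * f y * cos (\<xi> \<bullet> y - \<xi> \<bullet> x) \<partial>lborel)"
        using lborel_integral_translate(1)[of "\<lambda>y. f x * f y * cos (\<xi> \<bullet> y - \<xi> \<bullet> x)" x] by simp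
      also have "\<dots> = (\<integral>y. f x * cos (\<xi> \<bullet> x) * (f y * cos (\<xi> \<bullet> y)) + f x * sin (\<xi> \<bullet> x) * (f y * sin (\<xi> \<bullet> y)) \<partial>lborel)"
        by (simp add: cos_diff algebra_simps)
      also have "\<dots> = f x * cos (\<xi> \<bullet> x) * (\<integral>x. f x * cos (\<xi> \<bullet> x) \<partial>lborel) + f x * sin (\<xi> \<bullet> x) * (\<integral>x. f x * sin (\<xi> \<bullet> x) \<partial>lborel)"
        using ic by simp
      finally show "(\<integral>y. f x * f (y + x) * cos (\<xi> \<bullet> y) \<partial>lborel) = f x * cos (\<xi> \<bullet> x) * (\<integral>x. f x * cos (\<xi> \<bullet> x) \<partial>lborel) + f x * sin (\<xi> \<bullet> x) * (\<integral>x. f x * sin (\<xi> \<bullet> x) \<partial>lborel)" .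
    qed
    also have "integral\<^sup>L lborel \<dots> = fourier_square f \<xi>"
      using ic by (simp add: fourier_square_def power2_eq_square)
    finally show ?thesis by simp
  qed
  have nn: "0 \<le> fourier_square f \<xi>" for \<xi> by (simp add: fourier_square_def)
  have m: "fourier_square f \<in> borel_measurable borel" unfolding fourier_square_def by measurable
  have s: "inverse (real (Suc n)) > 0" for n by simp
  have sF: "sigma_finite_measure (lborel :: 'a measure)" ..
  note av = gauss_average[OF sF iF measurable_ident_sets[OF sets_lborel] s]
  let ?c = "(2 * pi) powr (DIM('a) / 2)"
  have val: "(\<integral>\<xi>. fourier_square f \<xi> * gauss (\<xi> /\<^sub>R real (Suc n)) \<partial>lborel)
    = ?c * (\<integral>y. F (y /\<^sub>R real (Suc n)) * gauss y \<partial>lborel)" for n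
  proof -
    have "(\<integral>\<xi>. fourier_square f \<xi> * gauss (\<xi> /\<^sub>R real (Suc n)) \<partial>lborel)
      = (\<integral>y. F y * (?c / inverse (real (Suc n)) ^ DIM('a) * gauss (y /\<^sub>R inverse (real (Suc n)))) \<partial>lborel)"
      unfolding W by (rule av(2))
    also have "\<dots> = inverse (real (Suc n)) ^ DIM('a) * (\<integral>y. F (y /\<^sub>R real (Suc n)) * (?c / inverse (real (Suc n)) ^ DIM('a) * gauss y) \<partial>lborel)"
      by (subst lborel_integral_scale(1)[OF s[of n]]) (simp_all del: of_nat_Suc)
    also have "\<dots> = ?c * (\<integral>y. F (y /\<^sub>R real (Suc n)) * gauss y \<partial>lborel)"
    proof -
      have "(\<lambda>y. F (y /\<^sub>R real (Suc n)) * (?c / inverse (real (Suc n)) ^ DIM('a) * gauss y))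
        = (\<lambda>y. ?c / inverse (real (Suc n)) ^ DIM('a) * (F (y /\<^sub>R real (Suc n)) * gauss y))" by (simp add: fun_eq_iff)
      then show ?thesis by (simp del: of_nat_Suc)
    qed
    finally show ?thesis .
  qed
  have "(\<lambda>n. \<integral>y. F (y /\<^sub>R real (Suc n)) * gauss y \<partial>lborel) \<longlonglongrightarrow> (\<integral>y. (\<integral>x. (f x)\<^sup>2 \<partial>lborel) * gauss y \<partial>(lborel::'a measure))"
  proof (rule integral_dominated_convergence)
    show "integrable lborel (\<lambda>y::'a. (\<integral>x. (f x)\<^sup>2 \<partial>lborel) * gauss y)" by (simp add: gauss_fourier(1))
    show "AE y in lborel. norm (F (y /\<^sub>R real (Suc n)) * gauss y) \<le> (\<integral>x. (f x)\<^sup>2 \<partial>lborel) * gauss y" for n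
      using autocorrelation(2)[OF _ f2] by (intro AE_I2) (auto simp: abs_mult F_def intro!: mult_right_mono)
    show "AE y in lborel. (\<lambda>n. F (y /\<^sub>R real (Suc n)) * gauss y) \<longlonglongrightarrow> (\<integral>x. (f x)\<^sup>2 \<partial>lborel) * gauss y"
    proof (rule AE_I2)
      fix y :: 'a
      have "(\<lambda>n. y /\<^sub>R real (Suc n)) \<longlonglongrightarrow> 0 *\<^sub>R y"
        by (intro tendsto_intros LIMSEQ_inverse_real_of_nat)
      then show "(\<lambda>n. F (y /\<^sub>R real (Suc n)) * gauss y) \<longlonglongrightarrow> (\<integral>x. (f x)\<^sup>2 \<partial>lborel) * gauss y"
        unfolding F_def by (intro tendsto_mult tendsto_const autocorrelation(3)[OF _ f2]) simp_all
    qed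
  qed (simp_all)
  then have "(\<lambda>n. ?c * (\<integral>y. F (y /\<^sub>R real (Suc n)) * gauss y \<partial>lborel)) \<longlonglongrightarrow> ?c * ((\<integral>x. (f x)\<^sup>2 \<partial>lborel) * ?c)"
    using gauss_fourier(2)[of "0::'a"] by (intro tendsto_mult tendsto_const) (simp add: gauss_def)
  also have "?c * ((\<integral>x. (f x)\<^sup>2 \<partial>lborel) * ?c) = (2 * pi) ^ DIM('a) * (\<integral>x. (f x)\<^sup>2 \<partial>lborel)"
  proof -
    have "?c * ?c = (2 * pi) powr real DIM('a)" by (subst powr_add[symmetric]) simp
    also have "\<dots> = (2 * pi) ^ DIM('a)" by (rule powr_realpow) simp
    finally show ?thesis by (simp only: mult_ac)
  qed
  finally have lim: "(\<lambda>n. \<integral>\<xi>. fourier_square f \<xi> * gauss (\<xi> /\<^sub>R real (Suc n)) \<partial>lborel) \<longlonglongrightarrow> (2 * pi) ^ DIM('a) * (\<integral>x. (f x)\<^sup>2 \<partial>lborel)"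
    unfolding val .
  have ii: "integrable lborel (\<lambda>x. fourier_square f x * gauss (x /\<^sub>R real (Suc n)))" for n
    unfolding W by (rule av(1))
  show "integrable lborel (fourier_square f)"
    "integral\<^sup>L lborel (fourier_square f) = (2 * pi) ^ DIM('a) * (\<integral>x. (f x)\<^sup>2 \<partial>lborel)"
    using integral_gauss_cutoff[OF m nn ii lim] by auto
qed

section \<open>Quasi-left-continuity and the exit event\<close>

lemma at_right_ballD:
  fixes p :: "real \<Rightarrow> 'a::metric_space"
  assumes "continuous (at_right s) p" "e > 0"
  obtains r where "r > 0" "\<And>u. s \<le> u \<Longrightarrow> u < s + r \<Longrightarrow> dist (p u) (p s) < e"
proof -
  have "eventually (\<lambda>u. dist (p u) (p s) < e) (at_right s)"
    using assms by (auto simp: continuous_within dest: tendstoD)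
  then obtain b where b: "b > s" "\<And>u. s < u \<Longrightarrow> u < b \<Longrightarrow> dist (p u) (p s) < e"
    by (auto simp: eventually_at_right_field)
  show thesis
  proof (rule that[of "b - s"])
    fix u assume "s \<le> u" "u < s + (b - s)"
    then show "dist (p u) (p s) < e" using b(2)[of u] assms(2) by (cases "u = s") auto
  qed (use b in auto)
qed

lemma at_right_openD:
  fixes p :: "real \<Rightarrow> 'a::metric_space"
  assumes "continuous (at_right s) p" "open U" "p s \<in> U"
  obtains r where "r > 0" "\<And>u. s \<le> u \<Longrightarrow> u < s + r \<Longrightarrow> p u \<in> U"
proof -
  obtain e where e: "e > 0" "ball (p s) e \<subseteq> U" using assms by (auto elim: openE)
  obtain r where "r > 0" "\<And>u. s \<le> u \<Longrightarrow> u < s + r \<Longrightarrow> dist (p u) (p s) < e"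
    using at_right_ballD[OF assms(1) e(1)] by blast
  then show thesis using e(2) that[of r] by (auto simp: dist_commute subset_eq)
qed

lemma dyadic_ceiling:
  fixes T :: real
  assumes "0 \<le> T"
  obtains i :: nat where "T \<le> real i / 2 ^ j" "real i / 2 ^ j < T + 1 / 2 ^ j"
proof (rule that[of "nat \<lceil>T * 2 ^ j\<rceil>"])
  have 0: "0 \<le> \<lceil>T * 2 ^ j\<rceil>" using assms by (simp add: le_ceiling_iff; smt (verit) mult_nonneg_nonneg zero_le_power)
  then have r: "real (nat \<lceil>T * 2 ^ j\<rceil>) = of_int \<lceil>T * 2 ^ j\<rceil>" by simp
  show "T \<le> real (nat \<lceil>T * 2 ^ j\<rceil>) / 2 ^ j" unfolding r by (simp add: pos_le_divide_eq)
  have "of_int \<lceil>T * 2 ^ j\<rceil> < T * 2 ^ j + 1" by linarith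
  then show "real (nat \<lceil>T * 2 ^ j\<rceil>) / 2 ^ j < T + 1 / 2 ^ j" unfolding r by (simp add: pos_divide_less_eq distrib_right)
qed

lemma dyadic_mesh_small:
  fixes e :: real
  assumes "e > 0"
  obtains j0 where "\<And>j. j \<ge> j0 \<Longrightarrow> 1 / 2 ^ j < e"
proof -
  have "(\<lambda>j. (1/2::real) ^ j) \<longlonglongrightarrow> 0" by (rule LIMSEQ_realpow_zero) auto
  then have "eventually (\<lambda>j. (1/2::real) ^ j < e) sequentially" using assms by (rule order_tendstoD)
  then show thesis using that by (auto simp: eventually_sequentially power_one_over)
qed

text \<open>The deterministic half of quasi-left-continuity. Let \<open>T\<^sub>k\<close> be the first exit time from \<open>C\<^sub>k\<close>. As the path
  leaves every \<open>C\<^sub>k\<close> but never \<open>G\<close>, the times \<open>T\<^sub>k\<close> increase to a time \<open>T\<close> that none of them reaches, and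
  the left limit at \<open>T\<close> lies outside \<open>G\<close>; the path therefore jumps at \<open>T\<close> by some positive amount. Seen on a fine dyadic grid, the
  first exit from \<open>C\<^sub>k\<close> is followed within time \<open>2\<^bsup>-q\<^esup>\<close> by an oscillation of fixed size \<open>1/(P+1)\<close>, for
  arbitrarily large \<open>q\<close>. That is improbable for a process whose increments after the exit are independent of the past.\<close>

lemma path_exit_oscillation:
  fixes p :: "real \<Rightarrow> 'a::real_normed_vector" and C :: "nat \<Rightarrow> 'a set"
  assumes rc: "\<And>s. 0 \<le> s \<Longrightarrow> continuous (at_right s) p"
    and ll: "\<And>s. 0 < s \<Longrightarrow> \<exists>l. (p \<longlongrightarrow> l) (at_left s)"
    and C: "\<And>k. closed (C k)" "\<And>k. C k \<subseteq> C (Suc k)"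
    and G: "\<And>y. y \<in> G \<Longrightarrow> \<exists>k. \<exists>e>0. ball y e \<subseteq> C k"
    and inG: "\<And>s. 0 \<le> s \<Longrightarrow> s \<le> 1 \<Longrightarrow> p s \<in> G"
    and exit: "\<And>k. \<exists>s\<in>{0..1}. p s \<notin> C k"
  shows "\<exists>P. \<forall>q. \<exists>k0. \<forall>k\<ge>k0. \<exists>j0. \<forall>j\<ge>j0. \<exists>i\<le>2^j.
    (\<forall>i'<i. p (real i' / 2^j) \<in> C k) \<and> p (real i / 2^j) \<notin> C k \<and>
    (\<exists>l\<le>2^(j-q). norm (p (real (i + l) / 2^j) - p (real i / 2^j)) > inverse (real (Suc P)))"
proof -
  have Cmono: "C k \<subseteq> C k'" if "k \<le> k'" for k k'
    using that C(2) by (rule lift_Suc_mono_le[rotated])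
  define S where "S k = {s\<in>{0..1}. p s \<notin> C k}" for k
  define T where "T k = Inf (S k)" for k
  have S: "S k \<noteq> {}" "bdd_below (S k)" "S k \<subseteq> {0..1}" for k
    using exit[of k] by (auto simp: S_def intro!: bdd_belowI[of _ 0])
  have Tle: "T k \<le> s" if "s \<in> S k" for s k
    unfolding T_def using that S by (intro cInf_lower) auto
  have T01: "0 \<le> T k" "T k \<le> 1" for k
  proof -
    show "0 \<le> T k" unfolding T_def using S by (intro cInf_greatest) fastforce+
    obtain s where "s \<in> S k" using S by blast
    then show "T k \<le> 1" using Tle[of s k] S(3)[of k] by fastforce
  qed
  have Tapp: "\<exists>s\<in>S k. s < T k + r" if "r > 0" for r k
    using cInf_lessD[of "S k" "T k + r"] S that by (auto simp: T_def)
  have Tmono: "T k \<le> T k'" if "k \<le> k'" for k k'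
  proof -
    have "S k' \<subseteq> S k" using Cmono[OF that] by (auto simp: S_def)
    then show ?thesis unfolding T_def using S by (intro cInf_superset_mono) auto
  qed
  define TT where "TT = (SUP k. T k)"
  have bdd: "bdd_above (range T)" using T01 by (intro bdd_aboveI[of _ 1]) auto
  have TTge: "T k \<le> TT" for k unfolding TT_def by (intro cSUP_upper bdd) auto
  have TT1: "TT \<le> 1" unfolding TT_def using T01 by (intro cSUP_least) auto
  have TTapp: "\<exists>k0. \<forall>k\<ge>k0. TT - r < T k" if r: "r > 0" for r
  proof -
    have "TT - r < (SUP k. T k)" using r by (simp add: TT_def)
    then obtain k0 where k0: "TT - r < T k0" using less_cSUP_iff[OF _ bdd, of "TT - r"] by auto
    show ?thesis
    proof (intro exI allI impI)
      fix k assume "k0 \<le> k"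
      then show "TT - r < T k" using k0 Tmono[of k0 k] by linarith
    qed
  qed
  have TTpos: "0 \<le> TT" using T01(1)[of 0] TTge[of 0] by linarith
  have lt: "T k < TT" for k
  proof (rule ccontr)
    assume "\<not> T k < TT"
    then have Tk: "T k = TT" using TTge[of k] by simp
    obtain k1 e where ke: "e > 0" "ball (p TT) e \<subseteq> C k1" using G[OF inG[OF TTpos TT1]] by blast
    define k' where "k' = max k k1"
    have b: "ball (p TT) e \<subseteq> C k'" using ke(2) Cmono[of k1 k'] by (auto simp: k'_def)
    have Tk': "T k' = TT" using Tmono[of k k'] TTge[of k'] Tk by (auto simp: k'_def)
    obtain r where r: "r > 0" "\<And>u. TT \<le> u \<Longrightarrow> u < TT + r \<Longrightarrow> dist (p u) (p TT) < e"
      using at_right_ballD[OF rc[OF TTpos] ke(1)] by blast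
    obtain s where s: "s \<in> S k'" "s < T k' + r" using Tapp[OF r(1)] by blast
    have "dist (p s) (p TT) < e" using r(2)[of s] s Tle[OF s(1)] Tk' by auto
    then have "p s \<in> C k'" using b by (auto simp: dist_commute)
    then show False using s by (auto simp: S_def)
  qed
  have TT0: "0 < TT" using lt[of 0] T01(1)[of 0] by linarith
  obtain L where L: "(p \<longlongrightarrow> L) (at_left TT)" using ll[OF TT0] by blast
  have Lnear: "\<exists>r>0. \<forall>s. TT - r < s \<and> s < TT \<longrightarrow> dist (p s) L < e" if e: "e > 0" for e
  proof -
    have "eventually (\<lambda>s. dist (p s) L < e) (at_left TT)" using L e by (rule tendstoD)
    then obtain b where b: "b < TT" "\<And>s. b < s \<Longrightarrow> s < TT \<Longrightarrow> dist (p s) L < e"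
      by (auto simp: eventually_at_left_field)
    then show ?thesis by (intro exI[of _ "TT - b"]) auto
  qed
  have LG: "L \<notin> G"
  proof
    assume "L \<in> G"
    then obtain k1 e where ke: "e > 0" "ball L e \<subseteq> C k1" using G by blast
    obtain r where r: "r > 0" "\<And>s. TT - r < s \<Longrightarrow> s < TT \<Longrightarrow> dist (p s) L < e" using Lnear[OF ke(1)] by blast
    obtain k0 where k0: "\<And>k. k \<ge> k0 \<Longrightarrow> TT - r < T k" using TTapp[OF r(1)] by blast
    define k where "k = max k0 k1"
    obtain s where s: "s \<in> S k" "s < T k + (TT - T k)" using Tapp[of "TT - T k" k] lt[of k] by auto
    have "dist (p s) L < e" using r(2)[of s] k0[of k] s Tle[OF s(1)] by (auto simp: k_def)
    then have "p s \<in> C k" using ke(2) Cmono[of k1 k] by (auto simp: dist_commute k_def)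
    then show False using s by (auto simp: S_def)
  qed
  have jump: "0 < dist (p TT) L" using LG inG[OF TTpos TT1] by auto
  then obtain P where P: "inverse (real (Suc P)) < dist (p TT) L / 4" using reals_Archimedean[of "dist (p TT) L / 4"] by auto
  define d where "d = inverse (real (Suc P))"
  have d: "d > 0" "4 * d < dist (p TT) L" using P by (auto simp: d_def)
  show ?thesis
  proof (rule exI[of _ P], rule allI)
    fix q :: nat
    obtain r1 where r1: "r1 > 0" "\<And>s. TT - r1 < s \<Longrightarrow> s < TT \<Longrightarrow> dist (p s) L < d" using Lnear[OF d(1)] by blast
    obtain r2 where r2: "r2 > 0" "\<And>u. TT \<le> u \<Longrightarrow> u < TT + r2 \<Longrightarrow> dist (p u) (p TT) < d"
      using at_right_ballD[OF rc[OF TTpos] d(1)] by blast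
    obtain k0 where k0: "\<And>k. k \<ge> k0 \<Longrightarrow> TT - 1 / 2 ^ (Suc q) < T k" using TTapp[of "1 / 2 ^ (Suc q)"] by auto
    have "\<exists>j0. \<forall>j\<ge>j0. \<exists>i\<le>2^j.
      (\<forall>i'<i. p (real i' / 2^j) \<in> C k) \<and> p (real i / 2^j) \<notin> C k \<and>
      (\<exists>l\<le>2^(j-q). norm (p (real (i + l) / 2^j) - p (real i / 2^j)) > inverse (real (Suc P)))" if k: "k \<ge> k0" for k
    proof -
      obtain s where s: "s \<in> S k" "s < TT" using Tapp[of "TT - T k" k] lt[of k] by auto
      have s0: "0 \<le> s" using s S(3)[of k] by auto
      obtain r3 where r3: "r3 > 0" "\<And>u. s \<le> u \<Longrightarrow> u < s + r3 \<Longrightarrow> p u \<in> - C k"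
        using at_right_openD[OF rc[OF s0], of "- C k"] C(1)[of k] s(1) by (auto simp: S_def)
      \<comment> \<open>finer than every scale in play: the two one-sided continuity windows at the jump, the stretch after \<open>s\<close> that is spent outside \<open>C k\<close>, and half of the oscillation window\<close>
      define e where "e = Min {r1, r2, r3, TT - s, 1 / 2 ^ Suc q}"
      have "e > 0" using r1(1) r2(1) r3(1) s(2) by (simp add: e_def)
      then obtain j0 where j0: "\<And>j. j \<ge> j0 \<Longrightarrow> 1 / 2 ^ j < e" using dyadic_mesh_small by blast
      show ?thesis
      proof (rule exI[of _ "max j0 q"], intro allI impI)
        fix j assume "max j0 q \<le> j"
        then have j: "1 / 2 ^ j < e" and jq: "q \<le> j" using j0 by auto
        have mesh: "1 / 2 ^ j < r1" "1 / 2 ^ j < r2" "1 / 2 ^ j < r3" "1 / 2 ^ j < TT - s" "1 / 2 ^ j < (1::real) / 2 ^ Suc q"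
          using j by (simp_all add: e_def)
        obtain i0 where i0: "s \<le> real i0 / 2 ^ j" "real i0 / 2 ^ j < s + 1 / 2 ^ j" using dyadic_ceiling[OF s0] by blast
        have pi0: "p (real i0 / 2 ^ j) \<notin> C k" using r3(2)[of "real i0 / 2 ^ j"] i0 mesh by auto
        define i where "i = (LEAST i. p (real i / 2 ^ j) \<notin> C k)"
        have i1: "p (real i / 2 ^ j) \<notin> C k" unfolding i_def using pi0 by (rule LeastI)
        have i2: "p (real i' / 2 ^ j) \<in> C k" if "i' < i" for i' using not_less_Least[OF that[unfolded i_def]] by auto
        have "i \<le> i0" unfolding i_def using pi0 by (rule Least_le)
        then have "real i / 2 ^ j \<le> real i0 / 2 ^ j" by (simp add: divide_right_mono)
        then have iTT: "real i / 2 ^ j < TT" using i0 mesh by linarith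
        have "real i / 2 ^ j < 1" using iTT TT1 by linarith
        then have "real i < 2 ^ j" by simp
        then have ij: "i \<le> 2 ^ j" using of_nat_less_iff[of i "2^j", where ?'a = real] by simp
        have "real i / 2 ^ j \<in> S k" using \<open>real i / 2 ^ j < 1\<close> i1 unfolding S_def by simp
        then have iTk: "T k \<le> real i / 2 ^ j" by (rule Tle)
        obtain iv where iv: "TT \<le> real iv / 2 ^ j" "real iv / 2 ^ j < TT + 1 / 2 ^ j" using dyadic_ceiling[OF TTpos] by blast
        have "real i / 2 ^ j < real iv / 2 ^ j" using iTT iv by linarith
        then have iiv: "i < iv" by (simp add: divide_less_cancel)
        define iu where "iu = iv - 1"
        have iu: "iv = Suc iu" "i \<le> iu" using iiv by (auto simp: iu_def)
        have iuv: "real iv / 2 ^ j = real iu / 2 ^ j + 1 / 2 ^ j" using iu by (simp add: add_divide_distrib)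
        have pu: "dist (p (real iu / 2 ^ j)) L < d" using iv iuv mesh by (intro r1(2)) linarith+
        have pv: "dist (p (real iv / 2 ^ j)) (p TT) < d" using iv mesh by (intro r2(2)) linarith+
        have "real iv / 2 ^ j - real i / 2 ^ j < 1 / 2 ^ Suc q + 1 / 2 ^ Suc q"
          using iv iTk k0[OF k] mesh by linarith
        then have "real iv / 2 ^ j - real i / 2 ^ j < 1 / 2 ^ q" by simp
        then have "real (iv - i) / 2 ^ j < 1 / 2 ^ q" using iiv by (simp add: of_nat_diff diff_divide_distrib)
        then have "real (iv - i) < 2 ^ j / 2 ^ q" by (simp add: field_simps)
        also have "\<dots> = 2 ^ (j - q)" using jq by (simp add: power_diff)
        finally have ivi: "iv - i \<le> 2 ^ (j - q)" using of_nat_less_iff[of "iv - i" "2^(j-q)", where ?'a = real] by simp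
        have "dist (p TT) L \<le> dist (p (real iv / 2 ^ j)) (p TT) + dist (p (real iv / 2 ^ j)) (p (real i / 2 ^ j))
            + dist (p (real iu / 2 ^ j)) (p (real i / 2 ^ j)) + dist (p (real iu / 2 ^ j)) L"
          using dist_triangle[of "p TT" L "p (real iv / 2 ^ j)"] dist_triangle[of "p (real iv / 2 ^ j)" L "p (real i / 2 ^ j)"]
            dist_triangle[of "p (real i / 2 ^ j)" L "p (real iu / 2 ^ j)"]
          by (simp add: dist_commute)
        then have "dist (p (real iv / 2 ^ j)) (p (real i / 2 ^ j)) > d \<or> dist (p (real iu / 2 ^ j)) (p (real i / 2 ^ j)) > d"
          using pu pv d by linarith
        then have "\<exists>l\<le>2^(j-q). norm (p (real (i + l) / 2^j) - p (real i / 2^j)) > d"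
        proof
          assume "dist (p (real iv / 2 ^ j)) (p (real i / 2 ^ j)) > d"
          then show ?thesis using ivi iiv by (intro exI[of _ "iv - i"]) (auto simp: dist_norm)
        next
          assume "dist (p (real iu / 2 ^ j)) (p (real i / 2 ^ j)) > d"
          then show ?thesis using ivi iu by (intro exI[of _ "iu - i"]) (auto simp: dist_norm)
        qed
        then show "\<exists>i\<le>2^j.
          (\<forall>i'<i. p (real i' / 2^j) \<in> C k) \<and> p (real i / 2^j) \<notin> C k \<and>
          (\<exists>l\<le>2^(j-q). norm (p (real (i + l) / 2^j) - p (real i / 2^j)) > inverse (real (Suc P)))"
          using ij i1 i2 unfolding d_def by blast
      qed
    qed
    then show "\<exists>k0. \<forall>k\<ge>k0. \<exists>j0. \<forall>j\<ge>j0. \<exists>i\<le>2^j.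
      (\<forall>i'<i. p (real i' / 2^j) \<in> C k) \<and> p (real i / 2^j) \<notin> C k \<and>
      (\<exists>l\<le>2^(j-q). norm (p (real (i + l) / 2^j) - p (real i / 2^j)) > inverse (real (Suc P)))" by blast
  qed
qed

text \<open>Closed sets that increase to \<open>D\<close> when \<open>D\<close> is open. Unlike the distance to the complement, this
  needs no special case for \<open>D = UNIV\<close>.\<close>

definition inner_part :: "'a::metric_space set \<Rightarrow> nat \<Rightarrow> 'a set" where
  "inner_part D k = {y. ball y (inverse (real (Suc k))) \<subseteq> D}"

lemma closed_inner_part: "closed (inner_part D k)"
proof -
  have "inner_part D k = - (\<Union>z\<in>- D. ball z (inverse (real (Suc k))))"
    by (auto simp: inner_part_def dist_commute subset_eq)
  also have "closed \<dots>" by (intro closed_Compl open_UN ballI open_ball)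
  finally show ?thesis .
qed

lemma inner_part_subset: "inner_part D k \<subseteq> D"
  unfolding inner_part_def by (auto simp del: of_nat_Suc)

lemma inner_part_Suc: "inner_part D k \<subseteq> inner_part D (Suc k)"
proof -
  have "ball y (inverse (real (Suc (Suc k)))) \<subseteq> ball y (inverse (real (Suc k)))" for y :: 'a
    by (intro subset_ball le_imp_inverse_le) auto
  then show ?thesis by (fastforce simp: inner_part_def)
qed

lemma inner_part_interior:
  fixes D :: "'a::metric_space set"
  assumes "open D" "y \<in> D"
  shows "\<exists>k. \<exists>e>0. ball y e \<subseteq> inner_part D k"
proof -
  obtain e where e: "e > 0" "ball y e \<subseteq> D" using assms by (auto elim: openE)
  obtain k where k: "inverse (real (Suc k)) < e / 2" using reals_Archimedean[of "e/2"] e by auto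
  have "ball y (e/2) \<subseteq> inner_part D k"
  proof (clarsimp simp: inner_part_def simp del: of_nat_Suc)
    fix z u assume "dist y z * 2 < e" "dist z u < inverse (real (Suc k))"
    then have "dist y u < e" using k dist_triangle[of y u z] by linarith
    then show "u \<in> D" using e by auto
  qed
  then show ?thesis using e by (intro exI[of _ k] exI[of _ "e/2"]) auto
qed

context levy_process
begin

definition increment :: "real \<Rightarrow> real \<Rightarrow> nat \<Rightarrow> 'w \<Rightarrow> 'a" where
  "increment s h i \<omega> = X (s + real (Suc i) * h) \<omega> - X (s + real i * h) \<omega>"

lemma increment_measurable [measurable]: "0 \<le> s \<Longrightarrow> 0 \<le> h \<Longrightarrow> increment s h i \<in> borel_measurable M"
  unfolding increment_def[abs_def] by (intro borel_measurable_diff measurable_X) simp_all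

lemma sum_increment: "(\<Sum>i<n. increment s h i \<omega>) = X (s + real n * h) \<omega> - X s \<omega>"
  unfolding increment_def using sum_lessThan_telescope[of "\<lambda>i. X (s + real i * h) \<omega>" n] by simp

lemma indep_increment:
  assumes "0 \<le> s" "0 < h"
  shows "indep_vars (\<lambda>_. borel) (increment s h) {..<n}"
  using indep_increments[of "\<lambda>i. s + real i * h" n] assms
  unfolding increment_def[abs_def] by (simp add: algebra_simps)

lemma distr_increment:
  assumes "0 \<le> s" "0 < h"
  shows "distr M borel (increment s h i) = distr M borel (increment 0 h 0)"
proof -
  have "distr M borel (\<lambda>\<omega>. X ((s + real i * h) + h) \<omega> - X (s + real i * h) \<omega>) = distr M borel (\<lambda>\<omega>. X h \<omega> - X 0 \<omega>)"
    using assms by (intro stationary_increments) auto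
  then show ?thesis by (simp add: increment_def[abs_def] algebra_simps)
qed

definition oscillates :: "real \<Rightarrow> nat \<Rightarrow> real \<Rightarrow> real \<Rightarrow> 'w set" where
  "oscillates h n d s = {\<omega>\<in>space M. \<exists>l\<le>n. norm (X (s + real l * h) \<omega> - X s \<omega>) > d}"

lemma oscillates_sets [measurable]: "0 \<le> s \<Longrightarrow> 0 \<le> h \<Longrightarrow> oscillates h n d s \<in> sets M"
proof -
  assume "0 \<le> s" "0 \<le> h"
  then have [measurable]: "X (s + real l * h) \<in> borel_measurable M" "X s \<in> borel_measurable M" for l
    by (auto intro!: measurable_X)
  show ?thesis unfolding oscillates_def by measurable
qed

text \<open>Independent increments with equal distributions have the same joint law wherever the block starts.\<close>

lemma prob_oscillates:
  assumes s: "0 \<le> s" and h: "0 < h"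
  shows "prob (oscillates h n d s) = prob (oscillates h n d 0)"
proof (cases "n = 0")
  case True then show ?thesis by (simp add: oscillates_def)
next
  case False
  define Q :: "(nat \<Rightarrow> 'a) set" where "Q = {f\<in>space (PiM {..<n} (\<lambda>_. borel)). \<exists>l\<le>n. norm (\<Sum>i<l. f i) > d}"
  have Q [measurable]: "Q \<in> sets (PiM {..<n} (\<lambda>_. borel))"
  proof -
    have m: "(\<lambda>f. \<Sum>i<l. f i :: 'a) \<in> borel_measurable (PiM {..<n} (\<lambda>_. borel))" if "l \<le> n" for l
      using that by (intro borel_measurable_sum measurable_component_singleton) auto
    have "Q = (\<Union>l\<in>{..n}. (\<lambda>f. \<Sum>i<l. f i) -` {y. d < norm y} \<inter> space (PiM {..<n} (\<lambda>_. borel)))"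
      by (auto simp: Q_def)
    also have "\<dots> \<in> sets (PiM {..<n} (\<lambda>_. borel))"
      by (intro sets.finite_UN measurable_sets[OF m]) auto
    finally show ?thesis .
  qed
  have *: "prob (oscillates h n d s) = measure (PiM {..<n} (\<lambda>_. distr M borel (increment 0 h 0))) Q" if s: "0 \<le> s" for s
  proof -
    have [measurable]: "increment s h i \<in> borel_measurable M" for i using s h by simp
    have eq: "oscillates h n d s = (\<lambda>\<omega>. \<lambda>i\<in>{..<n}. increment s h i \<omega>) -` Q \<inter> space M"
    proof -
      have "(\<Sum>i<l. (\<lambda>i\<in>{..<n}. increment s h i \<omega>) i) = X (s + real l * h) \<omega> - X s \<omega>" if "l \<le> n" for l \<omega>
        unfolding sum_increment[symmetric] using that by (intro sum.cong) auto
      then show ?thesis unfolding oscillates_def Q_def by (auto simp: space_PiM)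
    qed
    have "prob (oscillates h n d s) = measure (distr M (PiM {..<n} (\<lambda>_. borel)) (\<lambda>\<omega>. \<lambda>i\<in>{..<n}. increment s h i \<omega>)) Q"
      unfolding eq by (subst measure_distr) auto
    also have "distr M (PiM {..<n} (\<lambda>_. borel)) (\<lambda>\<omega>. \<lambda>i\<in>{..<n}. increment s h i \<omega>) = PiM {..<n} (\<lambda>i. distr M borel (increment s h i))"
      using indep_increment[OF s h, of n] False
      by (subst (asm) indep_vars_iff_distr_eq_PiM') auto
    also have "\<dots> = PiM {..<n} (\<lambda>_. distr M borel (increment 0 h 0))"
      using distr_increment[OF s h] by simp
    finally show ?thesis .
  qed
  show ?thesis using *[OF s] *[of 0] by simp
qed

text \<open>The strong Markov property at the first exit from \<open>C\<close>, in discrete time: the event that grid point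
  \<open>i\<close> is the first exit depends on earlier increments only, and these events are disjoint. The exit is
  measured for \<open>X - X\<^sub>0\<close> because the starting point is not one of the increments.\<close>

lemma prob_exit_then_oscillate:
  assumes h: "0 < h" and C [measurable]: "C \<in> sets borel"
  defines "B \<equiv> \<lambda>i. {\<omega>\<in>space M. (\<forall>i'<i. X (real i' * h) \<omega> - X 0 \<omega> \<in> C) \<and> X (real i * h) \<omega> - X 0 \<omega> \<notin> C}"
  shows "prob (\<Union>i\<le>a. B i \<inter> oscillates h n d (real i * h)) \<le> prob (oscillates h n d 0)"
proof -
  have [measurable]: "X (real i * h) \<in> borel_measurable M" "X 0 \<in> borel_measurable M" for i
    using h by (auto intro!: measurable_X)
  have B [measurable]: "B i \<in> sets M" for i unfolding B_def by measurable
  have osc [measurable]: "oscillates h n d (real i * h) \<in> sets M" for i using h by simp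
  have ind: "prob (B i \<inter> oscillates h n d (real i * h)) = prob (B i) * prob (oscillates h n d (real i * h))" for i
  proof -
    let ?Z = "increment 0 h"
    define QB :: "(nat \<Rightarrow> 'a) set" where
      "QB = {f\<in>space (PiM {..<i} (\<lambda>_. borel)). (\<forall>i'<i. (\<Sum>k<i'. f k) \<in> C) \<and> (\<Sum>k<i. f k) \<notin> C}"
    define QO :: "(nat \<Rightarrow> 'a) set" where
      "QO = {f\<in>space (PiM {i..<i+n} (\<lambda>_. borel)). \<exists>l\<le>n. norm (\<Sum>k\<in>{i..<i+l}. f k) > d}"
    have sB: "(\<lambda>f. \<Sum>k<i'. f k :: 'a) \<in> borel_measurable (PiM {..<i} (\<lambda>_. borel))" if "i' \<le> i" for i'
      using that by (intro borel_measurable_sum measurable_component_singleton) auto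
    have sO: "(\<lambda>f. \<Sum>k\<in>{i..<i+l}. f k :: 'a) \<in> borel_measurable (PiM {i..<i+n} (\<lambda>_. borel))" if "l \<le> n" for l
      using that by (intro borel_measurable_sum measurable_component_singleton) auto
    have QB: "QB \<in> sets (PiM {..<i} (\<lambda>_. borel))"
    proof -
      have "QB = {f\<in>space (PiM {..<i} (\<lambda>_. borel)). \<forall>i'\<in>{..<i}. (\<Sum>k<i'. f k) \<in> C} - ((\<lambda>f. \<Sum>k<i. f k) -` C \<inter> space (PiM {..<i} (\<lambda>_. borel)))"
        by (auto simp: QB_def)
      also have "\<dots> \<in> sets (PiM {..<i} (\<lambda>_. borel))"
      proof (intro sets.Diff sets.sets_Collect_finite_All)
        fix i' assume "i' \<in> {..<i}"
        then show "{f\<in>space (PiM {..<i} (\<lambda>_. borel)). (\<Sum>k<i'. f k) \<in> C} \<in> sets (PiM {..<i} (\<lambda>_. borel))"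
          using measurable_sets[OF sB[of i'] C] by (simp add: vimage_def Int_def conj_commute)
      qed (use measurable_sets[OF sB C] in auto)
      finally show ?thesis .
    qed
    have QO: "QO \<in> sets (PiM {i..<i+n} (\<lambda>_. borel))"
    proof -
      have "QO = (\<Union>l\<in>{..n}. (\<lambda>f. \<Sum>k\<in>{i..<i+l}. f k) -` {y. d < norm y} \<inter> space (PiM {i..<i+n} (\<lambda>_. borel)))"
        by (auto simp: QO_def)
      also have "\<dots> \<in> sets (PiM {i..<i+n} (\<lambda>_. borel))"
        by (intro sets.finite_UN measurable_sets[OF sO]) auto
      finally show ?thesis .
    qed
    have iv: "indep_var (PiM {..<i} (\<lambda>_. borel)) (\<lambda>\<omega>. restrict (\<lambda>k. ?Z k \<omega>) {..<i})
        (PiM {i..<i+n} (\<lambda>_. borel)) (\<lambda>\<omega>. restrict (\<lambda>k. ?Z k \<omega>) {i..<i+n})"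
      by (rule indep_var_restrict[OF indep_increment[OF order_refl h, of "i+n"]]) auto
    have eB: "B i = (\<lambda>\<omega>. restrict (\<lambda>k. ?Z k \<omega>) {..<i}) -` QB \<inter> space M"
    proof -
      define g where "g \<omega> = restrict (\<lambda>k. ?Z k \<omega>) {..<i}" for \<omega>
      have key: "(\<Sum>k<i'. g \<omega> k) = X (real i' * h) \<omega> - X 0 \<omega>" if "i' \<le> i" for i' \<omega>
      proof -
        have "(\<Sum>k<i'. g \<omega> k) = (\<Sum>k<i'. ?Z k \<omega>)"
          using that unfolding g_def by (intro sum.cong) auto
        then show ?thesis unfolding sum_increment by simp
      qed
      have "g \<omega> \<in> space (PiM {..<i} (\<lambda>_. borel))" for \<omega>
        by (simp add: g_def space_PiM)
      then have "\<omega> \<in> B i \<longleftrightarrow> \<omega> \<in> g -` QB \<inter> space M" for \<omega>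
      proof -
        have 1: "(\<forall>i'<i. (\<Sum>k<i'. g \<omega> k) \<in> C) \<longleftrightarrow> (\<forall>i'<i. X (real i' * h) \<omega> - X 0 \<omega> \<in> C)"
          by (intro all_cong1 imp_cong refl) (simp only: key less_imp_le)
        have 2: "(\<Sum>k<i. g \<omega> k) = X (real i * h) \<omega> - X 0 \<omega>" by (rule key) simp
        have 3: "g \<omega> \<in> space (PiM {..<i} (\<lambda>_. borel))" by fact
        show ?thesis
          unfolding B_def QB_def vimage_eq Int_iff mem_Collect_eq 1 2 using 3 by blast
      qed
      then have "B i = g -` QB \<inter> space M" by (rule set_eqI)
      then show ?thesis unfolding g_def .
    qed
    have eO: "oscillates h n d (real i * h) = (\<lambda>\<omega>. restrict (\<lambda>k. ?Z k \<omega>) {i..<i+n}) -` QO \<inter> space M"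
    proof -
      have "(\<Sum>k\<in>{i..<i+l}. restrict (\<lambda>k. ?Z k \<omega>) {i..<i+n} k) = X (real i * h + real l * h) \<omega> - X (real i * h) \<omega>" if "l \<le> n" for l \<omega>
      proof -
        have "(\<Sum>k\<in>{i..<i+l}. restrict (\<lambda>k. ?Z k \<omega>) {i..<i+n} k) = (\<Sum>k\<in>{i..<i+l}. ?Z k \<omega>)"
          using that by (intro sum.cong) auto
        also have "\<dots> = X (real (i+l) * h) \<omega> - X (real i * h) \<omega>"
          unfolding increment_def using sum_Suc_diff'[of i "i+l" "\<lambda>k. X (real k * h) \<omega>"] by simp
        finally show ?thesis by (simp add: algebra_simps)
      qed
      then show ?thesis unfolding oscillates_def QO_def by (auto simp: space_PiM)
    qed
    have "B i \<inter> oscillates h n d (real i * h) = (\<lambda>\<omega>. (restrict (\<lambda>k. ?Z k \<omega>) {..<i}, restrict (\<lambda>k. ?Z k \<omega>) {i..<i+n})) -` (QB \<times> QO) \<inter> space M"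
      unfolding eB eO by auto
    then have "prob (B i \<inter> oscillates h n d (real i * h)) = prob ((\<lambda>\<omega>. (restrict (\<lambda>k. ?Z k \<omega>) {..<i}, restrict (\<lambda>k. ?Z k \<omega>) {i..<i+n})) -` (QB \<times> QO) \<inter> space M)"
      by (rule arg_cong)
    also have "\<dots> = prob ((\<lambda>\<omega>. restrict (\<lambda>k. ?Z k \<omega>) {..<i}) -` QB \<inter> space M) * prob ((\<lambda>\<omega>. restrict (\<lambda>k. ?Z k \<omega>) {i..<i+n}) -` QO \<inter> space M)"
      by (rule indep_varD[OF iv QB QO])
    also have "\<dots> = prob (B i) * prob (oscillates h n d (real i * h))"
      by (rule arg_cong2[OF arg_cong[OF eB[symmetric]] arg_cong[OF eO[symmetric]]])
    finally show ?thesis .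
  qed
  have dis: "disjoint_family_on B {..a}"
    unfolding disjoint_family_on_def B_def
  proof (intro ballI impI)
    fix i j :: nat assume "i \<noteq> j"
    then consider "i < j" | "j < i" by linarith
    then show "{\<omega> \<in> space M. (\<forall>i'<i. X (real i' * h) \<omega> - X 0 \<omega> \<in> C) \<and> X (real i * h) \<omega> - X 0 \<omega> \<notin> C} \<inter>
       {\<omega> \<in> space M. (\<forall>i'<j. X (real i' * h) \<omega> - X 0 \<omega> \<in> C) \<and> X (real j * h) \<omega> - X 0 \<omega> \<notin> C} = {}"
      by cases blast+
  qed
  have "prob (\<Union>i\<le>a. B i \<inter> oscillates h n d (real i * h)) \<le> (\<Sum>i\<le>a. prob (B i \<inter> oscillates h n d (real i * h)))"
    by (rule finite_measure_subadditive_finite) auto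
  also have "\<dots> = (\<Sum>i\<le>a. prob (B i)) * prob (oscillates h n d 0)"
  proof -
    have "prob (oscillates h n d (real i * h)) = prob (oscillates h n d 0)" for i
      by (rule prob_oscillates) (use h in auto)
    then show ?thesis by (simp only: ind sum_distrib_right)
  qed
  also have "(\<Sum>i\<le>a. prob (B i)) = prob (\<Union>i\<le>a. B i)"
    using dis by (intro finite_measure_finite_Union[symmetric]) auto
  also have "\<dots> * prob (oscillates h n d 0) \<le> 1 * prob (oscillates h n d 0)"
    by (intro mult_right_mono) auto
  finally show ?thesis by simp
qed

lemma oscillation_vanishes:
  assumes t: "0 < t" and d: "0 < d"
  defines "Q \<equiv> \<lambda>q. {\<omega>\<in>space M. \<exists>j\<ge>q. \<exists>l\<le>2^(j-q). norm (X (real (l::nat) * (t / 2^j)) \<omega> - X 0 \<omega>) > d}"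
  shows "\<And>q. Q q \<in> sets M" "(\<lambda>q. prob (Q q)) \<longlonglongrightarrow> 0"
proof -
  have [measurable]: "X (real l * (t / 2^j)) \<in> borel_measurable M" "X 0 \<in> borel_measurable M" for l j :: nat
    using t by (auto intro!: measurable_X)
  show Q: "Q q \<in> sets M" for q unfolding Q_def by measurable
  have dec: "decseq Q"
  proof (rule decseq_SucI, rule subsetI)
    fix q \<omega> assume "\<omega> \<in> Q (Suc q)"
    then obtain j l where jl: "\<omega> \<in> space M" "j \<ge> Suc q" "l \<le> 2^(j - Suc q)" "norm (X (real l * (t / 2^j)) \<omega> - X 0 \<omega>) > d"
      by (auto simp: Q_def)
    have "(2::nat)^(j - Suc q) \<le> 2^(j-q)" by (rule power_increasing) auto
    then have "j \<ge> q" "l \<le> 2^(j-q)" using jl by linarith+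
    then show "\<omega> \<in> Q q" unfolding Q_def using jl by blast
  qed
  have "(\<Inter>q. Q q) = {}"
  proof (rule ccontr)
    assume "(\<Inter>q. Q q) \<noteq> {}"
    then obtain \<omega> where w: "\<And>q. \<omega> \<in> Q q" by blast
    then have ws: "\<omega> \<in> space M" by (auto simp: Q_def)
    obtain r where r: "r > 0" "\<And>u. 0 \<le> u \<Longrightarrow> u < 0 + r \<Longrightarrow> dist (X u \<omega>) (X 0 \<omega>) < d"
      using at_right_ballD[OF right_continuous[OF ws order_refl] d] by blast
    obtain q where q: "\<And>j. j \<ge> q \<Longrightarrow> 1 / 2 ^ j < r / t" using dyadic_mesh_small[of "r / t"] r t by auto
    obtain j l where jl: "j \<ge> q" "l \<le> 2^(j-q)" "norm (X (real l * (t / 2^j)) \<omega> - X 0 \<omega>) > d"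
      using w[of q] by (auto simp: Q_def)
    have "real l \<le> 2 ^ (j - q)" using of_nat_mono[OF jl(2), where ?'a = real] by simp
    then have "real l / 2 ^ j \<le> 2 ^ (j - q) / 2 ^ j" by (simp add: divide_right_mono)
    also have "\<dots> = 1 / 2 ^ q" using jl(1) by (simp add: power_diff)
    also have "\<dots> < r / t" by (rule q) simp
    finally have "real l * (t / 2 ^ j) < r" using t by (simp add: field_simps)
    then have "dist (X (real l * (t / 2^j)) \<omega>) (X 0 \<omega>) < d" using t by (intro r(2)) auto
    then show False using jl(3) by (simp add: dist_norm)
  qed
  then show "(\<lambda>q. prob (Q q)) \<longlonglongrightarrow> 0"
    using finite_Lim_measure_decseq[of Q] Q dec by auto
qed

lemma prob_liminf_le:
  assumes [measurable]: "\<And>n::nat. F n \<in> sets M" and le: "\<And>n. prob (F n) \<le> c"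
  shows "prob (\<Union>n. \<Inter>m\<in>{n..}. F m) \<le> c"
proof (rule LIMSEQ_le_const2)
  show "(\<lambda>n. prob (\<Inter>m\<in>{n..}. F m)) \<longlonglongrightarrow> prob (\<Union>n. \<Inter>m\<in>{n..}. F m)"
    by (rule finite_Lim_measure_incseq) (auto simp: incseq_def)
  have "prob (\<Inter>m\<in>{n..}. F m) \<le> prob (F n)" for n
    by (rule finite_measure_mono) auto
  then show "\<exists>N. \<forall>n\<ge>N. prob (\<Inter>m\<in>{n..}. F m) \<le> c" using le order_trans by blast
qed

text \<open>By \<open>path_exit_oscillation\<close> an exceptional path oscillates by a fixed amount shortly after its exit from
  \<open>inner_part D k\<close>, for all large \<open>k\<close> and all fine grids. For each window \<open>2\<^bsup>-q\<^esup>\<close> the probability of that is at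
  most the probability of an oscillation right after time zero, which tends to zero with the window by right-continuity.\<close>

lemma AE_stays_in_inner_part:
  assumes D: "open D" and t: "0 < t"
  shows "AE \<omega> in M. (\<forall>s\<in>{0..t}. x + X s \<omega> \<in> D) \<longrightarrow>
    (\<exists>k. \<forall>j::nat. \<forall>i\<le>2^j. x + X (t * (real (i::nat) / 2^j)) \<omega> \<in> inner_part D k)"
proof -
  define C where "C k = {y. x + y \<in> inner_part D k}" for k
  have Ccl: "closed (C k)" for k
  proof -
    have "C k = (\<lambda>y. x + y) -` inner_part D k" by (auto simp: C_def)
    then show ?thesis by (auto intro!: closed_vimage closed_inner_part continuous_intros)
  qed
  have Cb [measurable]: "C k \<in> sets borel" for k using Ccl by auto
  define B where "B k j i = {\<omega>\<in>space M. (\<forall>i'<i. X (real i' * (t / 2^j)) \<omega> - X 0 \<omega> \<in> C k) \<and> X (real i * (t / 2^j)) \<omega> - X 0 \<omega> \<notin> C k}"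
    for k j i :: nat
  define d where "d P = inverse (real (Suc P))" for P
  define F where "F P q k j = (\<Union>i\<le>(2::nat)^(j+q). B k (j+q) i \<inter> oscillates (t / 2^(j+q)) (2^j) (d P) (real i * (t / 2^(j+q))))" for P q k j
  define Q where "Q P q = {\<omega>\<in>space M. \<exists>j\<ge>q. \<exists>l\<le>2^(j-q). norm (X (real (l::nat) * (t / 2^j)) \<omega> - X 0 \<omega>) > d P}" for P q
  have X [measurable]: "X (real i * (t / 2^j)) \<in> borel_measurable M" "X 0 \<in> borel_measurable M" for i j :: nat
    using t by (auto intro!: measurable_X)
  have B [measurable]: "B k j i \<in> sets M" for k j i unfolding B_def by measurable
  have osc [measurable]: "oscillates (t / 2^j) n e (real i * (t / 2^j)) \<in> sets M" for i j n e using t by simp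
  have F [measurable]: "F P q k j \<in> sets M" for P q k j unfolding F_def by measurable
  have dpos: "0 < d P" for P by (simp add: d_def)
  have Qs [measurable]: "Q P q \<in> sets M" for P q
    unfolding Q_def by (rule oscillation_vanishes(1)[OF t dpos])
  have Qlim: "(\<lambda>q. prob (Q P q)) \<longlonglongrightarrow> 0" for P
    unfolding Q_def by (rule oscillation_vanishes(2)[OF t dpos])
  have Fle: "prob (F P q k j) \<le> prob (Q P q)" for P q k j
  proof -
    have "prob (F P q k j) \<le> prob (oscillates (t / 2^(j+q)) (2^j) (d P) 0)"
      unfolding F_def B_def using t by (intro prob_exit_then_oscillate) auto
    also have "\<dots> \<le> prob (Q P q)"
    proof (rule finite_measure_mono[OF _ Qs], rule subsetI)
      fix \<omega> assume "\<omega> \<in> oscillates (t / 2^(j+q)) (2^j) (d P) 0"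
      then obtain l where "\<omega> \<in> space M" "l \<le> 2^((j+q)-q)" "norm (X (real l * (t / 2^(j+q))) \<omega> - X 0 \<omega>) > d P"
        by (auto simp: oscillates_def)
      moreover have "j + q \<ge> q" by simp
      ultimately show "\<omega> \<in> Q P q" unfolding Q_def by blast
    qed
    finally show ?thesis .
  qed
  define G where "G P q k = (\<Union>j0. \<Inter>j\<in>{j0..}. F P q k j)" for P q k
  define H where "H P q = (\<Union>k0. \<Inter>k\<in>{k0..}. G P q k)" for P q
  have G [measurable]: "G P q k \<in> sets M" for P q k unfolding G_def by measurable
  have H [measurable]: "H P q \<in> sets M" for P q unfolding H_def by measurable
  have Gle: "prob (G P q k) \<le> prob (Q P q)" for P q k
    unfolding G_def by (rule prob_liminf_le) (auto simp: Fle)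
  have Hle: "prob (H P q) \<le> prob (Q P q)" for P q
    unfolding H_def by (rule prob_liminf_le) (auto simp: Gle)
  have null: "(\<Inter>q. H P q) \<in> null_sets M" for P
  proof -
    have "prob (\<Inter>q. H P q) \<le> prob (Q P q)" for q
      by (rule order_trans[OF finite_measure_mono Hle]) auto
    then have "prob (\<Inter>q. H P q) \<le> 0" by (intro LIMSEQ_le_const[OF Qlim]) auto
    then have "prob (\<Inter>q. H P q) = 0" using measure_nonneg[of M "\<Inter>q. H P q"] by linarith
    then show ?thesis by (intro null_setsI) (auto simp: emeasure_eq_measure)
  qed
  have "(\<Union>P. \<Inter>q. H P q) \<in> null_sets M" by (rule null_sets_UN) (rule null)
  then have ae: "AE \<omega> in M. \<omega> \<notin> (\<Union>P. \<Inter>q. H P q)" by (rule AE_not_in)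
  have key: "\<omega> \<in> (\<Union>P. \<Inter>q. H P q)" if w: "\<omega> \<in> space M" and X0: "X 0 \<omega> = 0" and inD: "\<And>s. s \<in> {0..t} \<Longrightarrow> x + X s \<omega> \<in> D"
    and ex: "\<And>k. \<exists>j::nat. \<exists>i\<le>2^j. x + X (t * (real (i::nat) / 2^j)) \<omega> \<notin> inner_part D k" for \<omega>
  proof -
    let ?p = "\<lambda>u. X (t * u) \<omega> - X 0 \<omega>"
    have "\<exists>P. \<forall>q. \<exists>k0. \<forall>k\<ge>k0. \<exists>j0. \<forall>j\<ge>j0. \<exists>i\<le>2^j.
      (\<forall>i'<i. ?p (real i' / 2^j) \<in> C k) \<and> ?p (real i / 2^j) \<notin> C k \<and>
      (\<exists>l\<le>2^(j-q). norm (?p (real (i + l) / 2^j) - ?p (real i / 2^j)) > inverse (real (Suc P)))"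
    proof (rule path_exit_oscillation[where G = "{y. x + y \<in> D}"])
      fix s :: real assume s: "0 \<le> s"
      have "((\<lambda>u. X u \<omega>) \<longlongrightarrow> X (t * s) \<omega>) (filtermap ((*) t) (at_right s))"
        using right_continuous[OF w, of "t * s"] s t by (simp add: filtermap_times_pos_at_right continuous_within)
      then have "((\<lambda>u. X (t * u) \<omega>) \<longlongrightarrow> X (t * s) \<omega>) (at_right s)" by (simp add: filterlim_filtermap)
      then show "continuous (at_right s) ?p" unfolding continuous_within by (intro tendsto_intros)
    next
      fix s :: real assume s: "0 < s"
      have fl: "filterlim ((*) t) (at_left (t * s)) (at_left s)"
        unfolding filterlim_at
      proof
        show "eventually (\<lambda>u. t * u \<in> {..<t * s} \<and> t * u \<noteq> t * s) (at_left s)"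
          using t by (auto simp: eventually_at_filter)
        show "((*) t \<longlongrightarrow> t * s) (at_left s)" by (intro tendsto_intros)
      qed
      obtain l where l: "((\<lambda>u. X u \<omega>) \<longlongrightarrow> l) (at_left (t * s))" using left_limits[OF w, of "t * s"] s t by auto
      have "((\<lambda>u. X (t * u) \<omega>) \<longlongrightarrow> l) (at_left s)" by (rule filterlim_compose[OF l fl])
      then have "(?p \<longlongrightarrow> l - X 0 \<omega>) (at_left s)" by (intro tendsto_intros)
      then show "\<exists>l. (?p \<longlongrightarrow> l) (at_left s)" by blast
    next
      show "closed (C k)" for k by (rule Ccl)
      show "C k \<subseteq> C (Suc k)" for k using inner_part_Suc[of D k] by (auto simp: C_def)
      show "\<exists>k. \<exists>e>0. ball y e \<subseteq> C k" if "y \<in> {y. x + y \<in> D}" for y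
      proof -
        obtain k e where "e > 0" "ball (x + y) e \<subseteq> inner_part D k" using inner_part_interior[OF D, of "x + y"] \<open>y \<in> {y. x + y \<in> D}\<close> by auto
        then show ?thesis by (intro exI[of _ k] exI[of _ e]) (auto simp: C_def subset_eq dist_norm)
      qed
      show "?p s \<in> {y. x + y \<in> D}" if "0 \<le> s" "s \<le> 1" for s
        using inD[of "t * s"] that t X0 by (simp add: mult_left_le)
      show "\<exists>s\<in>{0..1}. ?p s \<notin> C k" for k
      proof -
        obtain j i :: nat where ji: "i \<le> 2 ^ j" "x + X (t * (real i / 2^j)) \<omega> \<notin> inner_part D k" using ex[of k] by blast
        have "real i \<le> 2 ^ j" using of_nat_mono[OF ji(1), where ?'a = real] by simp
        then show ?thesis using ji X0 by (intro bexI[of _ "real i / 2^j"]) (auto simp: C_def)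
      qed
    qed
    then obtain P where P: "\<And>q. \<exists>k0. \<forall>k\<ge>k0. \<exists>j0. \<forall>j\<ge>j0. \<exists>i\<le>2^j.
      (\<forall>i'<i. ?p (real i' / 2^j) \<in> C k) \<and> ?p (real i / 2^j) \<notin> C k \<and>
      (\<exists>l\<le>2^(j-q). norm (?p (real (i + l) / 2^j) - ?p (real i / 2^j)) > inverse (real (Suc P)))" by blast
    have "\<omega> \<in> H P q" for q
    proof -
      obtain k0 where k0: "\<And>k. k \<ge> k0 \<Longrightarrow> \<exists>j0. \<forall>j\<ge>j0. \<exists>i\<le>2^j.
        (\<forall>i'<i. ?p (real i' / 2^j) \<in> C k) \<and> ?p (real i / 2^j) \<notin> C k \<and>
        (\<exists>l\<le>2^(j-q). norm (?p (real (i + l) / 2^j) - ?p (real i / 2^j)) > inverse (real (Suc P)))" using P[of q] by blast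
      have "\<omega> \<in> G P q k" if k: "k \<ge> k0" for k
      proof -
        obtain j0 where j0: "\<And>j. j \<ge> j0 \<Longrightarrow> \<exists>i\<le>2^j.
          (\<forall>i'<i. ?p (real i' / 2^j) \<in> C k) \<and> ?p (real i / 2^j) \<notin> C k \<and>
          (\<exists>l\<le>2^(j-q). norm (?p (real (i + l) / 2^j) - ?p (real i / 2^j)) > inverse (real (Suc P)))" using k0[OF k] by blast
        have "\<omega> \<in> F P q k j" if j: "j \<ge> j0" for j
        proof -
          have "j + q \<ge> j0" using j by simp
          from j0[OF this] obtain i l where il: "i \<le> 2^(j+q)"
            "\<And>i'. i' < i \<Longrightarrow> ?p (real i' / 2^(j+q)) \<in> C k" "?p (real i / 2^(j+q)) \<notin> C k"
            "l \<le> 2^(j+q-q)" "norm (?p (real (i + l) / 2^(j+q)) - ?p (real i / 2^(j+q))) > inverse (real (Suc P))"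
            by blast
          have time: "t * (real i / 2^(j+q)) = real i * (t / 2^(j+q))" for i :: nat by simp
          have "\<omega> \<in> B k (j+q) i" using il(2,3) w unfolding B_def time by blast
          moreover have "\<omega> \<in> oscillates (t / 2^(j+q)) (2^j) (d P) (real i * (t / 2^(j+q)))"
          proof -
            have "real (i + l) * (t / 2^(j+q)) = real i * (t / 2^(j+q)) + real l * (t / 2^(j+q))" by (simp add: add_divide_distrib distrib_right)
            then have "norm (X (real i * (t / 2^(j+q)) + real l * (t / 2^(j+q))) \<omega> - X (real i * (t / 2^(j+q))) \<omega>) > d P"
              using il(5) unfolding time d_def by simp
            then show ?thesis using il(4) w unfolding oscillates_def by auto
          qed
          ultimately show ?thesis unfolding F_def using il(1) by blast
        qed
        then show ?thesis unfolding G_def by blast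
      qed
      then show ?thesis unfolding H_def by blast
    qed
    then show ?thesis by blast
  qed
  show ?thesis
    using ae start_zero AE_space
  proof eventually_elim
    case (elim \<omega>)
    then show ?case using key[of \<omega>] by blast
  qed
qed

end

section \<open>The quadratic form of the killed semigroup\<close>

text \<open>The map \<open>g \<mapsto> \<integral> u g(Z)\<close> is a bounded functional on \<open>L\<^sup>2\<close> when composition with \<open>Z\<close> is a contraction,
  so it may be applied term by term to a basis expansion. It is used for the identity map, which gives
  Parseval, and for \<open>Z = x + X\<^sub>t\<close>, which gives the quadratic form of the killed semigroup.\<close>

lemma functional_expansion:
  fixes f :: "'a::euclidean_space \<Rightarrow> real" and u :: "'p \<Rightarrow> real" and Z :: "'p \<Rightarrow> 'a"
  assumes basis: "L2_orthonormal_basis D \<phi>" and D [measurable]: "D \<in> sets borel"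
    and u [measurable]: "u \<in> borel_measurable N" and u2: "integrable N (\<lambda>p. (u p)\<^sup>2)"
    and Z [measurable]: "Z \<in> borel_measurable N"
    and Zi: "\<And>g :: 'a \<Rightarrow> real. g \<in> borel_measurable borel \<Longrightarrow> integrable lborel (\<lambda>x. (g x)\<^sup>2) \<Longrightarrow> integrable N (\<lambda>p. (g (Z p))\<^sup>2)"
    and Zle: "\<And>g :: 'a \<Rightarrow> real. g \<in> borel_measurable borel \<Longrightarrow> integrable lborel (\<lambda>x. (g x)\<^sup>2) \<Longrightarrow> (\<integral>p. (g (Z p))\<^sup>2 \<partial>N) \<le> (\<integral>x. (g x)\<^sup>2 \<partial>lborel)"
    and f [measurable]: "f \<in> borel_measurable borel" and f2: "integrable lborel (\<lambda>x. (f x)\<^sup>2)"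
    and f0: "\<And>x. x \<notin> D \<Longrightarrow> f x = 0"
  shows "(\<lambda>n. \<Sum>k=1..n. L2_inner D f (\<phi> k) * (\<integral>p. u p * (indicator D (Z p) * \<phi> k (Z p)) \<partial>N)) \<longlonglongrightarrow> (\<integral>p. u p * f (Z p) \<partial>N)"
proof -
  define \<phi>' where "\<phi>' k x = indicator D x * \<phi> k x" for k x
  define c where "c k = L2_inner D f (\<phi> k)" for k
  have sq: "square_integrable_on (\<phi> k) D" if "k \<ge> 1" for k
    using basis that unfolding L2_orthonormal_basis_def by blast
  have \<phi>m: "\<phi>' k \<in> borel_measurable borel" if "k \<ge> 1" for k
    using sq[OF that] by (simp add: square_integrable_on_def set_borel_measurable_def \<phi>'_def[abs_def])
  have indsq: "indicator D x * a\<^sup>2 = (indicator D x * a)\<^sup>2" for x and a :: real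
    by (simp add: indicator_def)
  have \<phi>2: "integrable lborel (\<lambda>x. (\<phi>' k x)\<^sup>2)" if "k \<ge> 1" for k
    using sq[OF that] by (simp add: square_integrable_on_def set_integrable_def \<phi>'_def indsq)
  define h where "h n x = f x - (\<Sum>k=1..n. c k * \<phi>' k x)" for n x
  have hm [measurable]: "h n \<in> borel_measurable borel" for n
    unfolding h_def[abs_def] by (intro borel_measurable_diff f borel_measurable_sum borel_measurable_times borel_measurable_const \<phi>m) auto
  have add2: "integrable L (\<lambda>x. (a x + b x)\<^sup>2)"
    if "a \<in> borel_measurable L" "b \<in> borel_measurable L" "integrable L (\<lambda>x. (a x)\<^sup>2)" "integrable L (\<lambda>x. (b x)\<^sup>2)" for a b :: "'x \<Rightarrow> real" and L
  proof -
    have "integrable L (\<lambda>x. (a x)\<^sup>2 + (b x)\<^sup>2 + 2 * (a x * b x))"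
      using that integrable_mult_of_squares[of a L b] by simp
    then show ?thesis by (simp add: power2_eq_square algebra_simps)
  qed
  have h2: "integrable lborel (\<lambda>x. (h n x)\<^sup>2)" for n
  proof (induction n)
    case (Suc n)
    have "h (Suc n) x = h n x + (- c (Suc n)) * \<phi>' (Suc n) x" for x by (simp add: h_def)
    moreover have "integrable lborel (\<lambda>x. (h n x + (- c (Suc n)) * \<phi>' (Suc n) x)\<^sup>2)"
      by (rule add2) (use Suc \<phi>m[of "Suc n"] \<phi>2[of "Suc n"] in \<open>auto simp: power_mult_distrib\<close>)
    ultimately show ?case by simp
  qed (use f2 in \<open>simp add: h_def\<close>)
  have hlim: "(\<lambda>n. \<integral>x. (h n x)\<^sup>2 \<partial>lborel) \<longlonglongrightarrow> 0"
  proof -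
    have "square_integrable_on f D"
      using f2 f0 unfolding square_integrable_on_def set_borel_measurable_def set_integrable_def
      by (auto intro!: Bochner_Integration.integrable_bound[OF f2] simp: indicator_def)
    then have "(\<lambda>n. L2_norm D (\<lambda>x. f x - (\<Sum>k=1..n. c k * \<phi> k x))) \<longlonglongrightarrow> 0"
      using basis unfolding L2_orthonormal_basis_def c_def by blast
    moreover have "L2_norm D (\<lambda>x. f x - (\<Sum>k=1..n. c k * \<phi> k x)) = sqrt (\<integral>x. (h n x)\<^sup>2 \<partial>lborel)" for n
    proof -
      have "indicator D x * ((f x - (\<Sum>k=1..n. c k * \<phi> k x)) * (f x - (\<Sum>k=1..n. c k * \<phi> k x))) = (h n x)\<^sup>2" for x
        using f0[of x] by (cases "x \<in> D") (simp_all add: h_def \<phi>'_def power2_eq_square)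
      then show ?thesis unfolding L2_norm_def L2_inner_def set_lebesgue_integral_def by simp
    qed
    ultimately have "(\<lambda>n. (sqrt (\<integral>x. (h n x)\<^sup>2 \<partial>lborel))\<^sup>2) \<longlonglongrightarrow> 0\<^sup>2"
      by (intro tendsto_power) simp
    then show ?thesis by simp
  qed
  define T where "T g = (\<integral>p. u p * g (Z p) \<partial>N)" for g
  have Tint: "integrable N (\<lambda>p. u p * g (Z p))" if "g \<in> borel_measurable borel" "integrable lborel (\<lambda>x. (g x)\<^sup>2)" for g
    by (rule integrable_mult_of_squares[OF u measurable_compose[OF Z that(1)] u2 Zi[OF that]])
  have Th: "T (h n) = T f - (\<Sum>k=1..n. c k * T (\<phi>' k))" for n
  proof -
    have "T (h n) = (\<integral>p. u p * f (Z p) - (\<Sum>k=1..n. c k * (u p * \<phi>' k (Z p))) \<partial>N)"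
      unfolding T_def h_def by (intro Bochner_Integration.integral_cong) (auto simp: right_diff_distrib sum_distrib_left mult_ac)
    also have "\<dots> = T f - (\<Sum>k=1..n. c k * T (\<phi>' k))"
      using Tint[OF f f2] Tint[OF \<phi>m \<phi>2] unfolding T_def
      by (subst Bochner_Integration.integral_diff) (auto intro!: Bochner_Integration.integrable_sum)
    finally show ?thesis .
  qed
  have Tb: "\<bar>T g\<bar> \<le> (s * (\<integral>p. (u p)\<^sup>2 \<partial>N) + (\<integral>x. (g x)\<^sup>2 \<partial>lborel) / s) / 2"
    if g: "g \<in> borel_measurable borel" "integrable lborel (\<lambda>x. (g x)\<^sup>2)" and s: "s > 0" for g s
  proof -
    have "\<bar>a * b\<bar> \<le> (s * a\<^sup>2 + b\<^sup>2 / s) / 2" for a b :: real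
    proof -
      have "0 \<le> (s * \<bar>a\<bar> - \<bar>b\<bar>)\<^sup>2 / s" using s by simp
      also have "\<dots> = s * a\<^sup>2 + b\<^sup>2 / s - 2 * \<bar>a * b\<bar>" using s by (simp add: power2_eq_square field_simps abs_mult)
      finally show ?thesis by simp
    qed
    then have "\<bar>T g\<bar> \<le> (\<integral>p. (s * (u p)\<^sup>2 + (g (Z p))\<^sup>2 / s) / 2 \<partial>N)"
      unfolding T_def using u2 Zi[OF g] Tint[OF g]
      by (intro order_trans[OF integral_abs_bound] integral_mono) auto
    also have "\<dots> = (s * (\<integral>p. (u p)\<^sup>2 \<partial>N) + (\<integral>p. (g (Z p))\<^sup>2 \<partial>N) / s) / 2"
      using u2 Zi[OF g] by simp
    also have "\<dots> \<le> (s * (\<integral>p. (u p)\<^sup>2 \<partial>N) + (\<integral>x. (g x)\<^sup>2 \<partial>lborel) / s) / 2"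
      using Zle[OF g] s by (simp add: divide_right_mono)
    finally show ?thesis .
  qed
  have "(\<lambda>n. T (h n)) \<longlonglongrightarrow> 0"
  proof (rule LIMSEQ_I)
    fix e :: real assume e: "e > 0"
    define U where "U = (\<integral>p. (u p)\<^sup>2 \<partial>N)"
    have U: "U \<ge> 0" by (simp add: U_def)
    define s where "s = e / (U + 1)"
    have s: "s > 0" using e U by (simp add: s_def)
    have sU: "s * U \<le> e" using e U by (simp add: s_def field_simps)
    obtain n0 where n0: "\<And>n. n \<ge> n0 \<Longrightarrow> (\<integral>x. (h n x)\<^sup>2 \<partial>lborel) < e * s"
      using LIMSEQ_D[OF hlim, of "e * s"] e s by (auto simp: abs_less_iff)
    have "norm (T (h n) - 0) < e" if "n \<ge> n0" for n
    proof -
      have "(\<integral>x. (h n x)\<^sup>2 \<partial>lborel) / s < e" using n0[OF that] s by (simp add: pos_divide_less_eq)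
      then show ?thesis using Tb[OF hm h2 s, of n] sU unfolding U_def by (simp add: mult.commute)
    qed
    then show "\<exists>n0. \<forall>n\<ge>n0. norm (T (h n) - 0) < e" by blast
  qed
  then have "(\<lambda>n. T f - T (h n)) \<longlonglongrightarrow> T f - 0" by (intro tendsto_intros)
  then show ?thesis unfolding Th by (simp add: T_def c_def \<phi>'_def)
qed

context levy_process
begin

text \<open>Staying in a single \<open>inner_part D k\<close> at all dyadic multiples of \<open>t\<close> up to and including \<open>t\<close> itself. As
  these sets are closed, right-continuity extends this to all times in between.\<close>

definition stays :: "'a set \<Rightarrow> real \<Rightarrow> 'a \<Rightarrow> 'w \<Rightarrow> bool" where
  "stays D t x \<omega> \<longleftrightarrow> (\<exists>k. \<forall>j::nat. \<forall>i\<le>2^j. x + X (t * (real (i::nat) / 2^j)) \<omega> \<in> inner_part D k)"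

lemma staysD:
  assumes w: "\<omega> \<in> space M" and t: "0 < t" and st: "stays D t x \<omega>" and s: "s \<in> {0..t}"
  shows "x + X s \<omega> \<in> D"
proof -
  obtain k where k: "\<And>j i. i \<le> 2^j \<Longrightarrow> x + X (t * (real (i::nat) / 2^j)) \<omega> \<in> inner_part D k"
    using st unfolding stays_def by blast
  have "x + X s \<omega> \<in> inner_part D k"
  proof (cases "s = t")
    case True then show ?thesis using k[of 1 0] by simp
  next
    case False
    show ?thesis
    proof (rule ccontr)
      assume n: "x + X s \<omega> \<notin> inner_part D k"
      have "continuous (at_right s) (\<lambda>u. x + X u \<omega>)"
        using right_continuous[OF w, of s] s by (intro continuous_intros) auto
      then obtain r where r: "r > 0" "\<And>u. s \<le> u \<Longrightarrow> u < s + r \<Longrightarrow> x + X u \<omega> \<in> - inner_part D k"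
        using at_right_openD[of s "\<lambda>u. x + X u \<omega>" "- inner_part D k"] n closed_inner_part[of D k] by (auto simp: open_Compl)
      obtain j where j: "1 / 2 ^ j < min (r / t) ((t - s) / t)"
        using dyadic_mesh_small[of "min (r / t) ((t - s) / t)"] r(1) t s False by auto
      obtain i :: nat where i: "s / t \<le> real i / 2 ^ j" "real i / 2 ^ j < s / t + 1 / 2 ^ j"
        using dyadic_ceiling[of "s / t" j] s t by auto
      have u: "s \<le> t * (real i / 2 ^ j)" using i(1) t by (simp add: pos_divide_le_eq mult.commute)
      have "real i / 2 ^ j < s / t + r / t" using i(2) j by linarith
      then have "t * (real i / 2 ^ j) < t * (s / t + r / t)" by (rule mult_strict_left_mono[OF _ t])
      then have u2: "t * (real i / 2 ^ j) < s + r" using t by (simp add: distrib_left)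
      have "real i / 2 ^ j < s / t + (t - s) / t" using i(2) j by linarith
      also have "\<dots> = 1" using t by (simp add: field_simps)
      finally have "real i < 2 ^ j" by simp
      then have "i \<le> 2 ^ j" using of_nat_less_iff[of i "2^j", where ?'a = real] by simp
      from k[OF this] r(2)[OF u u2] show False by simp
    qed
  qed
  then show ?thesis using inner_part_subset by blast
qed

lemma less_exit_time_iff:
  assumes w: "\<omega> \<in> space M" and t: "0 < t" and D: "open D"
  shows "ereal t < exit_time D (\<lambda>s. x + X s \<omega>) \<longleftrightarrow> (\<forall>s\<in>{0..t}. x + X s \<omega> \<in> D)"
proof
  assume L: "ereal t < exit_time D (\<lambda>s. x + X s \<omega>)"
  show "\<forall>s\<in>{0..t}. x + X s \<omega> \<in> D"
  proof (rule ccontr)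
    assume "\<not> (\<forall>s\<in>{0..t}. x + X s \<omega> \<in> D)"
    then obtain s where s: "s \<in> {0..t}" "x + X s \<omega> \<notin> D" by blast
    then have "exit_time D (\<lambda>s. x + X s \<omega>) \<le> ereal s"
      unfolding exit_time_def by (intro Inf_lower) auto
    also have "\<dots> \<le> ereal t" using s by simp
    finally show False using L by simp
  qed
next
  assume R: "\<forall>s\<in>{0..t}. x + X s \<omega> \<in> D"
  have "continuous (at_right t) (\<lambda>u. x + X u \<omega>)"
    using right_continuous[OF w, of t] t by (intro continuous_intros) auto
  then obtain r where r: "r > 0" "\<And>u. t \<le> u \<Longrightarrow> u < t + r \<Longrightarrow> x + X u \<omega> \<in> D"
    using at_right_openD[of t "\<lambda>u. x + X u \<omega>" D] R t D by auto
  have "ereal (t + r) \<le> exit_time D (\<lambda>s. x + X s \<omega>)"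
    unfolding exit_time_def
  proof (rule Inf_greatest)
    fix z assume "z \<in> {ereal s |s. 0 \<le> s \<and> x + X s \<omega> \<notin> D}"
    then obtain s where s: "z = ereal s" "0 \<le> s" "x + X s \<omega> \<notin> D" by blast
    have "\<not> s < t + r" using R r(2)[of s] s by (cases "s \<le> t") auto
    then show "ereal (t + r) \<le> z" using s by simp
  qed
  moreover have "ereal t < ereal (t + r)" using r by simp
  ultimately show "ereal t < exit_time D (\<lambda>s. x + X s \<omega>)" by (rule less_le_trans[rotated])
qed

lemma stays_measurable:
  assumes "0 \<le> t"
  shows "Measurable.pred (M \<Otimes>\<^sub>M borel) (\<lambda>p. stays D t (snd p) (fst p))"
proof -
  have [measurable]: "X (t * (real i / 2^j)) \<in> borel_measurable M" for i j :: nat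
    using assms by (auto intro!: measurable_X)
  have [measurable]: "inner_part D k \<in> sets borel" for k by (simp add: closed_inner_part)
  show ?thesis unfolding stays_def by measurable
qed

lemma stays_measurable_M: "0 \<le> t \<Longrightarrow> Measurable.pred M (stays D t x)"
  using measurable_compose[OF _ stays_measurable, of "\<lambda>\<omega>. (\<omega>, x)" M t D] by simp

text \<open>Replaces the possibly non-measurable event \<open>t < \<tau>\<^sub>D\<close> by \<open>stays\<close>, and the completed measure by the
  original one.\<close>

lemma killed_semigroup_eq:
  assumes D: "open D" and t: "0 < t" and f: "set_borel_measurable lborel D f"
  shows "killed_semigroup M X D t f x =
    (\<integral>\<omega>. indicator {\<omega>. stays D t x \<omega>} \<omega> * (indicator D (x + X t \<omega>) * f (x + X t \<omega>)) \<partial>M)"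
proof -
  have fm [measurable]: "(\<lambda>x. indicator D x * f x) \<in> borel_measurable borel"
    using f by (simp add: set_borel_measurable_def)
  have [measurable]: "X t \<in> borel_measurable M" using t by (intro measurable_X) simp
  have [measurable]: "Measurable.pred M (stays D t x)" using t by (intro stays_measurable_M) simp
  define A where "A = {\<omega> \<in> space M. ereal t < exit_time D (\<lambda>s. x + X s \<omega>)}"
  define g where "g \<omega> = indicator {\<omega>. stays D t x \<omega>} \<omega> * (indicator D (x + X t \<omega>) * f (x + X t \<omega>))" for \<omega>
  define g' where "g' \<omega> = indicator A \<omega> *\<^sub>R f (x + X t \<omega>)" for \<omega>
  have gm [measurable]: "g \<in> borel_measurable M"
  proof -
    have "(\<lambda>\<omega>. indicator D (x + X t \<omega>) * f (x + X t \<omega>)) \<in> borel_measurable M"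
      by (rule measurable_compose[OF _ fm]) measurable
    then show ?thesis unfolding g_def[abs_def] by measurable
  qed
  have "AE \<omega> in M. g' \<omega> = g \<omega>"
    using AE_stays_in_inner_part[OF D t, of x] AE_space
  proof eventually_elim
    case (elim \<omega>)
    show ?case
    proof (cases "stays D t x \<omega>")
      case True
      then have "\<forall>s\<in>{0..t}. x + X s \<omega> \<in> D" using staysD[OF _ t True] elim by blast
      then show ?thesis using True elim t less_exit_time_iff[OF _ t D, of \<omega> x] by (simp add: g_def g'_def A_def)
    next
      case False
      then have "\<omega> \<notin> A" using elim less_exit_time_iff[OF _ t D, of \<omega> x] unfolding A_def stays_def by blast
      then show ?thesis using False by (simp add: g_def g'_def)
    qed
  qed
  then have ae: "AE \<omega> in completion M. g' \<omega> = g \<omega>" by (rule AE_completion)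
  have gm': "g \<in> borel_measurable (completion M)" by (rule measurable_completion[OF gm])
  have g'm: "g' \<in> borel_measurable (completion M)"
  proof (rule measurableI)
    fix S :: "real set" assume S: "S \<in> sets borel"
    show "g' -` S \<inter> space (completion M) \<in> sets (completion M)"
    proof (rule completion.in_sets_AE)
      show "g -` S \<inter> space (completion M) \<in> sets (completion M)" using gm' S by (rule measurable_sets)
      show "AE \<omega> in completion M. (\<omega> \<in> g -` S \<inter> space (completion M)) = (\<omega> \<in> g' -` S \<inter> space (completion M))"
        using ae by eventually_elim simp
    qed simp
  qed simp
  have "killed_semigroup M X D t f x = integral\<^sup>L (completion M) g'"
    unfolding killed_semigroup_def set_lebesgue_integral_def g'_def A_def ..
  also have "\<dots> = integral\<^sup>L (completion M) g"
    by (rule integral_cong_AE[OF g'm gm' ae])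
  also have "\<dots> = integral\<^sup>L M g"
    by (rule integral_completion[OF gm])
  finally show ?thesis by (simp add: g_def[abs_def])
qed

lemma product_square_integrable:
  fixes g :: "'a \<Rightarrow> real"
  assumes t: "0 \<le> t" and g [measurable]: "g \<in> borel_measurable borel" and g2: "integrable lborel (\<lambda>x. (g x)\<^sup>2)"
  shows "integrable (M \<Otimes>\<^sub>M lborel) (\<lambda>p. (g (snd p + X t (fst p)))\<^sup>2)"
    and "(\<integral>p. (g (snd p + X t (fst p)))\<^sup>2 \<partial>(M \<Otimes>\<^sub>M lborel)) = (\<integral>x. (g x)\<^sup>2 \<partial>lborel)"
    and "integrable (M \<Otimes>\<^sub>M lborel) (\<lambda>p. (g (snd p))\<^sup>2)"
proof -
  interpret P: pair_sigma_finite M "lborel :: 'a measure" ..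
  have [measurable]: "X t \<in> borel_measurable M" using t by (rule measurable_X)
  have tr: "integrable lborel (\<lambda>x. (g (x + y))\<^sup>2)" "(\<integral>x. (g (x + y))\<^sup>2 \<partial>lborel) = (\<integral>x. (g x)\<^sup>2 \<partial>lborel)" for y
    using lborel_integral_translate[of "\<lambda>x. (g x)\<^sup>2" y] g2 by (simp_all add: add.commute)
  show i: "integrable (M \<Otimes>\<^sub>M lborel) (\<lambda>p. (g (snd p + X t (fst p)))\<^sup>2)"
    by (rule P.Fubini_integrable) (auto simp: tr)
  show "integrable (M \<Otimes>\<^sub>M lborel) (\<lambda>p. (g (snd p))\<^sup>2)"
    by (rule P.Fubini_integrable) (auto simp: g2)
  show "(\<integral>p. (g (snd p + X t (fst p)))\<^sup>2 \<partial>(M \<Otimes>\<^sub>M lborel)) = (\<integral>x. (g x)\<^sup>2 \<partial>lborel)"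
    using P.integral_fst'[OF i] by (simp add: tr prob_space)
qed

text \<open>The indicator of survival up to time \<open>t\<close>, jointly measurable in the path and the starting point. The
  condition on the starting point is not implied by \<open>stays\<close>, since \<open>X\<^sub>0 = 0\<close> holds only almost surely.\<close>

definition survival :: "'a set \<Rightarrow> real \<Rightarrow> 'w \<times> 'a \<Rightarrow> real" where
  "survival D t p = indicator {p. snd p \<in> D \<and> stays D t (snd p) (fst p)} p"

lemma survival_measurable [measurable]:
  assumes [measurable]: "D \<in> sets borel" and t: "0 \<le> t"
  shows "survival D t \<in> borel_measurable (M \<Otimes>\<^sub>M borel)"
proof -
  note [measurable] = stays_measurable[OF t, of D]
  show ?thesis unfolding survival_def[abs_def] by measurable
qed

lemma survival_bounds: "0 \<le> survival D t p" "survival D t p \<le> indicator D (snd p)"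
  by (auto simp: survival_def indicator_def)

text \<open>The quadratic form \<open>\<langle>f, P\<^sub>t f\<rangle>\<close> of the killed semigroup in the eigenbasis. Writing it as one integral
  over paths and starting points makes its continuity in the second argument an instance of
  \<open>functional_expansion\<close>.\<close>

lemma killed_form_expansion:
  fixes f :: "'a \<Rightarrow> real"
  assumes D: "open D" and t: "0 < t" and basis: "L2_orthonormal_basis D \<phi>"
    and eig: "\<And>k. 1 \<le> k \<Longrightarrow> AE x\<in>D in lborel. killed_semigroup M X D t (\<phi> k) x = exp (- lam k * t) * \<phi> k x"
    and f [measurable]: "f \<in> borel_measurable borel" and f2: "integrable lborel (\<lambda>x. (f x)\<^sup>2)"
    and f0: "\<And>x. x \<notin> D \<Longrightarrow> f x = 0"
  shows "(\<lambda>n. \<Sum>k=1..n. exp (- lam k * t) * (L2_inner D f (\<phi> k))\<^sup>2) \<longlonglongrightarrow>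
    (\<integral>p. survival D t p * f (snd p) * f (snd p + X t (fst p)) \<partial>(M \<Otimes>\<^sub>M lborel))"
proof -
  interpret P: pair_sigma_finite M "lborel :: 'a measure" ..
  have t0: "0 \<le> t" using t by simp
  have Db [measurable]: "D \<in> sets borel" using D by simp
  have [measurable]: "X t \<in> borel_measurable M" using t0 by (rule measurable_X)
  note [measurable] = survival_measurable[OF Db t0]
  let ?u = "\<lambda>p. survival D t p * f (snd p)"
  have u: "?u \<in> borel_measurable (M \<Otimes>\<^sub>M lborel)" by measurable
  have u2: "integrable (M \<Otimes>\<^sub>M lborel) (\<lambda>p. (?u p)\<^sup>2)"
  proof (rule Bochner_Integration.integrable_bound[OF product_square_integrable(3)[OF t0 f f2]])
    show "(\<lambda>p. (?u p)\<^sup>2) \<in> borel_measurable (M \<Otimes>\<^sub>M lborel)" using u by measurable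
    show "AE p in M \<Otimes>\<^sub>M lborel. norm ((?u p)\<^sup>2) \<le> norm ((f (snd p))\<^sup>2)"
      by (intro AE_I2) (simp add: survival_def indicator_def)
  qed
  have Z: "(\<lambda>p. snd p + X t (fst p)) \<in> borel_measurable (M \<Otimes>\<^sub>M lborel)" by measurable
  have lim: "(\<lambda>n. \<Sum>k=1..n. L2_inner D f (\<phi> k) * (\<integral>p. ?u p * (indicator D (snd p + X t (fst p)) * \<phi> k (snd p + X t (fst p))) \<partial>(M \<Otimes>\<^sub>M lborel)))
    \<longlonglongrightarrow> (\<integral>p. ?u p * f (snd p + X t (fst p)) \<partial>(M \<Otimes>\<^sub>M lborel))"
    by (rule functional_expansion[OF basis Db u u2 Z _ _ f f2 f0])
       (simp_all add: product_square_integrable[OF t0])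
  have "(\<integral>p. ?u p * (indicator D (snd p + X t (fst p)) * \<phi> k (snd p + X t (fst p))) \<partial>(M \<Otimes>\<^sub>M lborel)) = exp (- lam k * t) * L2_inner D f (\<phi> k)"
    if k: "1 \<le> k" for k
  proof -
    have sq: "square_integrable_on (\<phi> k) D" using basis k unfolding L2_orthonormal_basis_def by blast
    define \<phi>' where "\<phi>' x = indicator D x * \<phi> k x" for x
    have \<phi>m [measurable]: "\<phi>' \<in> borel_measurable borel"
      using sq by (simp add: square_integrable_on_def set_borel_measurable_def \<phi>'_def[abs_def])
    have "indicator D x * (\<phi> k x)\<^sup>2 = (\<phi>' x)\<^sup>2" for x by (simp add: \<phi>'_def indicator_def)
    then have \<phi>2: "integrable lborel (\<lambda>x. (\<phi>' x)\<^sup>2)"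
      using sq by (simp add: square_integrable_on_def set_integrable_def)
    have \<phi>Z: "(\<lambda>p. \<phi>' (snd p + X t (fst p))) \<in> borel_measurable (M \<Otimes>\<^sub>M lborel)" by measurable
    have int: "integrable (M \<Otimes>\<^sub>M lborel) (\<lambda>(\<omega>, x). survival D t (\<omega>, x) * f x * \<phi>' (x + X t \<omega>))"
      using integrable_mult_of_squares[OF u \<phi>Z u2 product_square_integrable(1)[OF t0 \<phi>m \<phi>2]]
      by (simp add: case_prod_beta')
    have "(\<integral>p. ?u p * \<phi>' (snd p + X t (fst p)) \<partial>(M \<Otimes>\<^sub>M lborel))
      = (\<integral>x. (\<integral>\<omega>. survival D t (\<omega>, x) * f x * \<phi>' (x + X t \<omega>) \<partial>M) \<partial>lborel)"
      using P.integral_snd[OF int] by (simp add: case_prod_beta')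
    also have "\<dots> = (\<integral>x. exp (- lam k * t) * (f x * \<phi>' x) \<partial>lborel)"
    proof (rule integral_cong_AE)
      show "AE x in lborel. (\<integral>\<omega>. survival D t (\<omega>, x) * f x * \<phi>' (x + X t \<omega>) \<partial>M) = exp (- lam k * t) * (f x * \<phi>' x)"
        using eig[OF k]
      proof eventually_elim
        case (elim x)
        show ?case
        proof (cases "x \<in> D")
          case True
          have "(\<integral>\<omega>. survival D t (\<omega>, x) * f x * \<phi>' (x + X t \<omega>) \<partial>M)
            = (\<integral>\<omega>. f x * (indicator {\<omega>. stays D t x \<omega>} \<omega> * (indicator D (x + X t \<omega>) * \<phi> k (x + X t \<omega>))) \<partial>M)"
            using True by (intro Bochner_Integration.integral_cong) (auto simp: survival_def \<phi>'_def indicator_def)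
          also have "\<dots> = f x * killed_semigroup M X D t (\<phi> k) x"
            using sq by (simp add: killed_semigroup_eq[OF D t] square_integrable_on_def)
          finally show ?thesis using elim True by (simp add: \<phi>'_def)
        qed (simp add: f0)
      qed
    qed measurable
    also have "\<dots> = exp (- lam k * t) * (\<integral>x. f x * \<phi>' x \<partial>lborel)" by simp
    also have "(\<integral>x. f x * \<phi>' x \<partial>lborel) = L2_inner D f (\<phi> k)"
      by (simp add: L2_inner_def set_lebesgue_integral_def \<phi>'_def mult_ac)
    finally show ?thesis by (simp add: \<phi>'_def)
  qed
  then have "(\<Sum>k=1..n. L2_inner D f (\<phi> k) * (\<integral>p. ?u p * (indicator D (snd p + X t (fst p)) * \<phi> k (snd p + X t (fst p))) \<partial>(M \<Otimes>\<^sub>M lborel)))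
    = (\<Sum>k=1..n. exp (- lam k * t) * (L2_inner D f (\<phi> k))\<^sup>2)" for n
    by (intro sum.cong) (auto simp: power2_eq_square)
  then show ?thesis using lim by simp
qed

end

lemma parseval:
  fixes f :: "'a::euclidean_space \<Rightarrow> real"
  assumes basis: "L2_orthonormal_basis D \<phi>" and D [measurable]: "D \<in> sets borel"
    and f [measurable]: "f \<in> borel_measurable borel" and f2: "integrable lborel (\<lambda>x. (f x)\<^sup>2)"
    and f0: "\<And>x. x \<notin> D \<Longrightarrow> f x = 0"
  shows "(\<lambda>n. \<Sum>k=1..n. (L2_inner D f (\<phi> k))\<^sup>2) \<longlonglongrightarrow> (\<integral>x. (f x)\<^sup>2 \<partial>lborel)"
proof -
  have "(\<integral>x. f x * (indicator D x * \<phi> k x) \<partial>lborel) = L2_inner D f (\<phi> k)" for k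
    by (simp add: L2_inner_def set_lebesgue_integral_def mult_ac)
  then show ?thesis
    using functional_expansion[OF basis D _ f2 _ _ _ f f2 f0, of "\<lambda>x. x"] by (simp add: power2_eq_square)
qed

section \<open>Fourier weights of the eigenfunctions\<close>

lemma integrable_cutoff_square:
  fixes c :: "'a::euclidean_space \<Rightarrow> real"
  assumes [measurable]: "D \<in> sets borel" and fin: "emeasure lborel D < \<infinity>"
    and [measurable]: "c \<in> borel_measurable borel" and c: "\<And>x. \<bar>c x\<bar> \<le> 1"
  shows "integrable lborel (\<lambda>x. (indicator D x * c x)\<^sup>2)"
proof (rule Bochner_Integration.integrable_bound)
  show "integrable lborel (indicator D :: 'a \<Rightarrow> real)" using fin by simp
  have "(c x)\<^sup>2 \<le> 1" for x using c[of x] by (simp add: abs_square_le_1)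
  then show "AE x in lborel. norm ((indicator D x * c x)\<^sup>2) \<le> norm (indicator D x :: real)"
    by (auto simp: indicator_def)
qed measurable

lemma fourier_square_inner:
  fixes \<phi> :: "'a::euclidean_space \<Rightarrow> real"
  shows "fourier_square (\<lambda>x. indicator D x * \<phi> x) \<xi>
    = (L2_inner D (\<lambda>x. indicator D x * cos (\<xi> \<bullet> x)) \<phi>)\<^sup>2 + (L2_inner D (\<lambda>x. indicator D x * sin (\<xi> \<bullet> x)) \<phi>)\<^sup>2"
proof -
  have *: "indicator D x * (indicator D x * c * \<phi> x) = indicator D x * \<phi> x * c" for x and c :: real
    by (simp add: indicator_def)
  show ?thesis
    unfolding fourier_square_def L2_inner_def set_lebesgue_integral_def real_scaleR_def * ..
qed

lemma fourier_square_mass: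
  fixes D :: "'a::euclidean_space set"
  assumes basis: "L2_orthonormal_basis D \<phi>" and D: "D \<in> sets borel" and fin: "emeasure lborel D < \<infinity>"
  shows "(\<lambda>n. \<Sum>k=1..n. fourier_square (\<lambda>x. indicator D x * \<phi> k x) \<xi>) \<longlonglongrightarrow> measure lborel D"
proof -
  note [measurable] = D
  have i: "integrable lborel (\<lambda>x. (indicator D x * cos (\<xi> \<bullet> x))\<^sup>2 :: real)" "integrable lborel (\<lambda>x. (indicator D x * sin (\<xi> \<bullet> x))\<^sup>2 :: real)"
    by (intro integrable_cutoff_square[OF D fin]; simp)+
  have "(\<lambda>n. (\<Sum>k=1..n. (L2_inner D (\<lambda>x. indicator D x * cos (\<xi> \<bullet> x)) (\<phi> k))\<^sup>2) + (\<Sum>k=1..n. (L2_inner D (\<lambda>x. indicator D x * sin (\<xi> \<bullet> x)) (\<phi> k))\<^sup>2))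
    \<longlonglongrightarrow> (\<integral>x. (indicator D x * cos (\<xi> \<bullet> x))\<^sup>2 \<partial>lborel) + (\<integral>x. (indicator D x * sin (\<xi> \<bullet> x))\<^sup>2 \<partial>lborel)"
    by (intro tendsto_add parseval[OF basis D] i) auto
  also have "(\<integral>x. (indicator D x * cos (\<xi> \<bullet> x))\<^sup>2 \<partial>lborel) + (\<integral>x. (indicator D x * sin (\<xi> \<bullet> x))\<^sup>2 \<partial>lborel)
    = (\<integral>x. (indicator D x * cos (\<xi> \<bullet> x))\<^sup>2 + (indicator D x * sin (\<xi> \<bullet> x))\<^sup>2 \<partial>lborel)"
    by (rule Bochner_Integration.integral_add[OF i, symmetric])
  also have "\<dots> = (\<integral>x. indicator D x \<partial>lborel)"
    by (intro Bochner_Integration.integral_cong) (auto simp: indicator_def)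
  also have "\<dots> = measure lborel D" by simp
  finally show ?thesis by (simp add: fourier_square_inner sum.distrib)
qed

context levy_process
begin

text \<open>The sum of the quadratic forms of \<open>P\<^sub>t\<close> at \<open>cos(\<xi>x)\<close> and \<open>sin(\<xi>x)\<close>, restricted to \<open>D\<close>. The starting point drops
  out of the integrand by the addition theorem.\<close>

definition killed_symbol :: "'a set \<Rightarrow> real \<Rightarrow> 'a \<Rightarrow> real" where
  "killed_symbol D t \<xi> = (\<integral>p. survival D t p * cos (\<xi> \<bullet> X t (fst p)) \<partial>(M \<Otimes>\<^sub>M lborel))"

lemma fourier_square_trace:
  assumes D: "open D" and fin: "emeasure lborel D < \<infinity>" and t: "0 < t" and basis: "L2_orthonormal_basis D \<phi>"
    and eig: "\<And>k. 1 \<le> k \<Longrightarrow> AE x\<in>D in lborel. killed_semigroup M X D t (\<phi> k) x = exp (- lam k * t) * \<phi> k x"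
  shows "(\<lambda>n. \<Sum>k=1..n. exp (- lam k * t) * fourier_square (\<lambda>x. indicator D x * \<phi> k x) \<xi>) \<longlonglongrightarrow> killed_symbol D t \<xi>"
proof -
  have t0: "0 \<le> t" using t by simp
  have Db [measurable]: "D \<in> sets borel" using D by simp
  have [measurable]: "X t \<in> borel_measurable M" using t0 by (rule measurable_X)
  note [measurable] = survival_measurable[OF Db t0]
  let ?N = "M \<Otimes>\<^sub>M (lborel :: 'a measure)"
  let ?c = "\<lambda>x. indicator D x * cos (\<xi> \<bullet> x) :: real" and ?s = "\<lambda>x. indicator D x * sin (\<xi> \<bullet> x) :: real"
  have i: "integrable lborel (\<lambda>x. (?c x)\<^sup>2)" "integrable lborel (\<lambda>x. (?s x)\<^sup>2)"
    by (intro integrable_cutoff_square[OF Db fin]; simp)+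
  have ii: "integrable ?N (\<lambda>p. survival D t p * f (snd p) * f (snd p + X t (fst p)))"
    if f: "f \<in> borel_measurable borel" "integrable lborel (\<lambda>x. (f x)\<^sup>2)" for f
  proof -
    note [measurable] = f(1)
    have "integrable ?N (\<lambda>p. f (snd p) * f (snd p + X t (fst p)))"
      using product_square_integrable[OF t0 f] by (intro integrable_mult_of_squares) measurable
    then show ?thesis
      by (rule Bochner_Integration.integrable_bound) (measurable, auto simp: survival_def indicator_def)
  qed
  have "(\<lambda>n. (\<Sum>k=1..n. exp (- lam k * t) * (L2_inner D ?c (\<phi> k))\<^sup>2) + (\<Sum>k=1..n. exp (- lam k * t) * (L2_inner D ?s (\<phi> k))\<^sup>2))
    \<longlonglongrightarrow> (\<integral>p. survival D t p * ?c (snd p) * ?c (snd p + X t (fst p)) \<partial>?N) + (\<integral>p. survival D t p * ?s (snd p) * ?s (snd p + X t (fst p)) \<partial>?N)"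
    by (intro tendsto_add killed_form_expansion[OF D t basis eig] i) auto
  also have "(\<integral>p. survival D t p * ?c (snd p) * ?c (snd p + X t (fst p)) \<partial>?N) + (\<integral>p. survival D t p * ?s (snd p) * ?s (snd p + X t (fst p)) \<partial>?N)
    = (\<integral>p. survival D t p * ?c (snd p) * ?c (snd p + X t (fst p)) + survival D t p * ?s (snd p) * ?s (snd p + X t (fst p)) \<partial>?N)"
    by (rule Bochner_Integration.integral_add[symmetric]) (rule ii; simp add: i)+
  also have "\<dots> = killed_symbol D t \<xi>"
    unfolding killed_symbol_def
  proof (rule Bochner_Integration.integral_cong[OF refl])
    fix p assume p: "p \<in> space ?N"
    show "survival D t p * ?c (snd p) * ?c (snd p + X t (fst p)) + survival D t p * ?s (snd p) * ?s (snd p + X t (fst p))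
      = survival D t p * cos (\<xi> \<bullet> X t (fst p))"
    proof (cases "snd p \<in> D \<and> stays D t (snd p) (fst p)")
      case True
      have "fst p \<in> space M" using p by (auto simp: space_pair_measure)
      then have "snd p + X t (fst p) \<in> D" using True t staysD[of "fst p" t D "snd p" t] by auto
      moreover have "cos (\<xi> \<bullet> X t (fst p)) = cos (\<xi> \<bullet> (snd p + X t (fst p)) - \<xi> \<bullet> snd p)" by (simp add: inner_add_right)
      ultimately show ?thesis using True by (simp only: cos_diff) (simp add: survival_def algebra_simps)
    qed (auto simp: survival_def)
  qed
  finally show ?thesis by (simp add: fourier_square_inner sum.distrib distrib_left)
qed

lemma integrable_snd_indicator:
  fixes D :: "'a set"
  assumes [measurable]: "D \<in> sets borel" and fin: "emeasure lborel D < \<infinity>"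
  shows "integrable (M \<Otimes>\<^sub>M lborel) (\<lambda>p. indicator D (snd p) :: real)"
proof -
  interpret P: pair_sigma_finite M "lborel :: 'a measure" ..
  show ?thesis by (rule P.Fubini_integrable) (use fin in auto)
qed

lemma integrable_survival:
  fixes D :: "'a set"
  assumes [measurable]: "D \<in> sets borel" and fin: "emeasure lborel D < \<infinity>" and t: "0 \<le> t"
  shows "integrable (M \<Otimes>\<^sub>M lborel) (survival D t)"
proof -
  note [measurable] = survival_measurable[OF assms(1) t]
  show ?thesis
    by (rule Bochner_Integration.integrable_bound[OF integrable_snd_indicator[OF assms(1,2)]])
       (measurable, use survival_bounds in auto)
qed

lemma integral_snd_indicator_cos:
  fixes D :: "'a set"
  assumes D [measurable]: "D \<in> sets borel" and fin: "emeasure lborel D < \<infinity>" and t: "0 \<le> t"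
  shows "integrable (M \<Otimes>\<^sub>M lborel) (\<lambda>p. indicator D (snd p) * cos (\<xi> \<bullet> X t (fst p)))"
    and "(\<integral>p. indicator D (snd p) * cos (\<xi> \<bullet> X t (fst p)) \<partial>(M \<Otimes>\<^sub>M lborel)) = measure lborel D * expectation (\<lambda>\<omega>. cos (\<xi> \<bullet> X t \<omega>))"
proof -
  interpret P: pair_sigma_finite M "lborel :: 'a measure" ..
  have [measurable]: "X t \<in> borel_measurable M" using t by (rule measurable_X)
  show i: "integrable (M \<Otimes>\<^sub>M lborel) (\<lambda>p. indicator D (snd p) * cos (\<xi> \<bullet> X t (fst p)))"
    by (rule Bochner_Integration.integrable_bound[OF integrable_snd_indicator[OF D fin]])
       (auto simp: abs_mult indicator_def)
  show "(\<integral>p. indicator D (snd p) * cos (\<xi> \<bullet> X t (fst p)) \<partial>(M \<Otimes>\<^sub>M lborel)) = measure lborel D * expectation (\<lambda>\<omega>. cos (\<xi> \<bullet> X t \<omega>))"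
    using P.integral_fst'[OF i] fin by simp
qed

definition exit_mass :: "'a set \<Rightarrow> real \<Rightarrow> real" where
  "exit_mass D t = (\<integral>p. indicator D (snd p) - survival D t p \<partial>(M \<Otimes>\<^sub>M lborel))"

lemma killed_symbol_approx:
  assumes D: "D \<in> sets borel" and fin: "emeasure lborel D < \<infinity>" and t: "0 \<le> t"
  shows "\<bar>killed_symbol D t \<xi> - measure lborel D * expectation (\<lambda>\<omega>. cos (\<xi> \<bullet> X t \<omega>))\<bar> \<le> exit_mass D t"
proof -
  let ?N = "M \<Otimes>\<^sub>M (lborel :: 'a measure)"
  have [measurable]: "X t \<in> borel_measurable M" using t by (rule measurable_X)
  note [measurable] = survival_measurable[OF D t]
  note i1 = integrable_snd_indicator[OF D fin] integrable_survival[OF D fin t] integral_snd_indicator_cos(1)[OF D fin t, of \<xi>]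
  have i2: "integrable ?N (\<lambda>p. survival D t p * cos (\<xi> \<bullet> X t (fst p)))"
  proof (rule Bochner_Integration.integrable_bound[OF i1(2)])
    show "AE p in ?N. norm (survival D t p * cos (\<xi> \<bullet> X t (fst p))) \<le> norm (survival D t p)"
      by (intro AE_I2) (simp add: survival_def indicator_def)
  qed measurable
  have "killed_symbol D t \<xi> - measure lborel D * expectation (\<lambda>\<omega>. cos (\<xi> \<bullet> X t \<omega>))
    = (\<integral>p. survival D t p * cos (\<xi> \<bullet> X t (fst p)) - indicator D (snd p) * cos (\<xi> \<bullet> X t (fst p)) \<partial>?N)"
    unfolding killed_symbol_def integral_snd_indicator_cos(2)[OF D fin t, symmetric]
    by (rule Bochner_Integration.integral_diff[symmetric]) (rule i2 i1)+
  also have "\<bar>\<dots>\<bar> \<le> (\<integral>p. \<bar>survival D t p * cos (\<xi> \<bullet> X t (fst p)) - indicator D (snd p) * cos (\<xi> \<bullet> X t (fst p))\<bar> \<partial>?N)"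
    by (rule integral_abs_bound)
  also have "\<dots> \<le> exit_mass D t"
    unfolding exit_mass_def
  proof (rule integral_mono)
    show "integrable ?N (\<lambda>p. \<bar>survival D t p * cos (\<xi> \<bullet> X t (fst p)) - indicator D (snd p) * cos (\<xi> \<bullet> X t (fst p))\<bar>)"
      using i1(3) i2 by simp
    show "integrable ?N (\<lambda>p. indicator D (snd p) - survival D t p)" using i1 by simp
    show "\<bar>survival D t p * cos (\<xi> \<bullet> X t (fst p)) - indicator D (snd p) * cos (\<xi> \<bullet> X t (fst p))\<bar> \<le> indicator D (snd p) - survival D t p" for p
      by (auto simp: survival_def indicator_def)
  qed
  finally show ?thesis .
qed

text \<open>Around a starting point in the open set \<open>D\<close> there is a ball inside some \<open>inner_part D k\<close>, and
  right-continuity at zero keeps the path in that ball for a short time.\<close>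

lemma exit_mass_tendsto:
  assumes D: "open D" and fin: "emeasure lborel D < \<infinity>" and t: "\<And>n. 0 < \<tau> n" "\<tau> \<longlonglongrightarrow> 0"
  shows "(\<lambda>n. exit_mass D (\<tau> n)) \<longlonglongrightarrow> 0"
proof -
  interpret P: pair_sigma_finite M "lborel :: 'a measure" ..
  let ?N = "M \<Otimes>\<^sub>M (lborel :: 'a measure)"
  have Db [measurable]: "D \<in> sets borel" using D by simp
  have t0: "0 \<le> \<tau> n" for n using t(1)[of n] by simp
  have X0 [measurable]: "X 0 \<in> borel_measurable M" by (rule measurable_X) simp
  note [measurable] = survival_measurable[OF Db t0]
  have "(\<lambda>n. exit_mass D (\<tau> n)) \<longlonglongrightarrow> (\<integral>p. 0 \<partial>?N)"
    unfolding exit_mass_def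
  proof (rule integral_dominated_convergence[OF _ _ integrable_snd_indicator[OF Db fin]])
    show "AE p in ?N. norm (indicator D (snd p) - survival D (\<tau> n) p) \<le> indicator D (snd p)" for n
      by (auto simp: survival_def indicator_def)
    have "AE p in ?N. X 0 (fst p) = 0"
    proof (rule P.AE_pair_measure)
      show "{p \<in> space ?N. X 0 (fst p) = 0} \<in> sets ?N" by measurable
      show "AE \<omega> in M. AE x in (lborel :: 'a measure). X 0 (fst (\<omega>, x)) = 0"
        using start_zero by eventually_elim simp
    qed
    then show "AE p in ?N. (\<lambda>n. indicator D (snd p) - survival D (\<tau> n) p) \<longlonglongrightarrow> 0"
      using AE_space
    proof eventually_elim
      case (elim p)
      then have w: "fst p \<in> space M" by (auto simp: space_pair_measure)
      show ?case
      proof (cases "snd p \<in> D")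
        case True
        obtain k e where e: "e > 0" "ball (snd p) e \<subseteq> inner_part D k" using inner_part_interior[OF D True] by blast
        obtain r where r: "r > 0" "\<And>u. 0 \<le> u \<Longrightarrow> u < 0 + r \<Longrightarrow> dist (X u (fst p)) (X 0 (fst p)) < e"
          using at_right_ballD[OF right_continuous[OF w order_refl] e(1)] by blast
        have "eventually (\<lambda>n. \<tau> n < r) sequentially" using order_tendstoD(2)[OF t(2) r(1)] .
        then have "eventually (\<lambda>n. indicator D (snd p) - survival D (\<tau> n) p = 0) sequentially"
        proof eventually_elim
          case (elim n)
          have "snd p + X (\<tau> n * (real i / 2^j)) (fst p) \<in> inner_part D k" if "i \<le> 2^j" for i j :: nat
          proof -
            have "real i \<le> 2 ^ j" using of_nat_mono[OF that, where ?'a = real] by simp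
            then have "real i / 2 ^ j \<le> 1" by simp
            then have "\<tau> n * (real i / 2^j) \<le> \<tau> n" using t0[of n] by (rule mult_left_le)
            then have "dist (X (\<tau> n * (real i / 2^j)) (fst p)) 0 < e"
              using r(2)[of "\<tau> n * (real i / 2^j)"] elim t0[of n] \<open>X 0 (fst p) = 0\<close> by simp
            then have "snd p + X (\<tau> n * (real i / 2^j)) (fst p) \<in> ball (snd p) e" by (simp add: dist_norm)
            then show ?thesis using e by blast
          qed
          then have "stays D (\<tau> n) (snd p) (fst p)" unfolding stays_def by blast
          then show ?case using True by (simp add: survival_def)
        qed
        then show ?thesis by (rule tendsto_eventually)
      qed (simp add: survival_def)
    qed
  qed measurable
  then show ?thesis by simp
qed

lemma killed_symbol_integral_le:
  assumes D: "D \<in> sets borel" and fin: "emeasure lborel D < \<infinity>" and t: "0 \<le> t"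
    and pos: "\<And>\<xi>. 0 \<le> killed_symbol D t \<xi>"
    and ch: "\<And>\<xi>. 0 \<le> expectation (\<lambda>\<omega>. cos (\<xi> \<bullet> X t \<omega>))" "integrable lborel (\<lambda>\<xi>. expectation (\<lambda>\<omega>. cos (\<xi> \<bullet> X t \<omega>)))"
  shows "integrable lborel (killed_symbol D t)"
    and "integral\<^sup>L lborel (killed_symbol D t) \<le> measure lborel D * (\<integral>\<xi>. expectation (\<lambda>\<omega>. cos (\<xi> \<bullet> X t \<omega>)) \<partial>lborel)"
proof -
  interpret P: pair_sigma_finite M "lborel :: 'a measure" ..
  have [measurable]: "X t \<in> borel_measurable M" using t by (rule measurable_X)
  have N: "sigma_finite_measure (M \<Otimes>\<^sub>M (lborel :: 'a measure))" ..
  note W = integral_snd_indicator_cos(2)[OF D fin t]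
  have Z: "(\<lambda>p. X t (fst p)) \<in> borel_measurable (M \<Otimes>\<^sub>M (lborel :: 'a measure))" by measurable
  have posW: "0 \<le> (\<integral>p. indicator D (snd p) * cos (\<xi> \<bullet> X t (fst p)) \<partial>(M \<Otimes>\<^sub>M lborel))" for \<xi>
    unfolding W using ch(1) by simp
  have iW: "integrable lborel (\<lambda>\<xi>. \<integral>p. indicator D (snd p) * cos (\<xi> \<bullet> X t (fst p)) \<partial>(M \<Otimes>\<^sub>M lborel))"
    unfolding W using ch(2) by simp
  have eq: "killed_symbol D t = (\<lambda>\<xi>. \<integral>p. survival D t p * cos (\<xi> \<bullet> X t (fst p)) \<partial>(M \<Otimes>\<^sub>M lborel))"
    by (simp add: fun_eq_iff killed_symbol_def)
  note fp = fourier_positivity[OF N integrable_survival[OF D fin t] integrable_snd_indicator[OF D fin] survival_bounds(2) Z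
      pos[unfolded killed_symbol_def] posW iW]
  show "integrable lborel (killed_symbol D t)" unfolding eq by (rule fp(1))
  show "integral\<^sup>L lborel (killed_symbol D t) \<le> measure lborel D * (\<integral>\<xi>. expectation (\<lambda>\<omega>. cos (\<xi> \<bullet> X t \<omega>)) \<partial>lborel)"
    using fp(2) unfolding eq W by simp
qed

end

section \<open>Convergence of masses and concentration\<close>

lemma integrable_exp_abs_powr:
  fixes c a :: real
  assumes c: "c > 0" and a: "a > 0"
  shows "integrable lborel (\<lambda>x::real. exp (- c * \<bar>x\<bar> powr a))"
proof -
  have "((\<lambda>x::real. (1 + x\<^sup>2) * exp (- c * x powr a)) \<longlongrightarrow> 0) at_top"
    using c a by real_asymp
  then have "eventually (\<lambda>x::real. (1 + x\<^sup>2) * exp (- c * x powr a) < 1) at_top"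
    by (rule order_tendstoD) simp
  then obtain R where R: "\<And>x::real. x \<ge> R \<Longrightarrow> (1 + x\<^sup>2) * exp (- c * x powr a) < 1"
    by (auto simp: eventually_at_top_linorder)
  have inv: "integrable lborel (\<lambda>x::real. inverse (1 + x\<^sup>2))"
    using integrable_inverse_1_plus_square by (simp add: set_integrable_def)
  have pos: "0 < 1 + x\<^sup>2" for x :: real by (simp add: add_pos_nonneg)
  show ?thesis
  proof (rule Bochner_Integration.integrable_bound)
    show "integrable lborel (\<lambda>x::real. indicator {- \<bar>R\<bar>..\<bar>R\<bar>} x + inverse (1 + x\<^sup>2))"
      by (intro Bochner_Integration.integrable_add inv) simp
    show "AE x in lborel. norm (exp (- c * \<bar>x\<bar> powr a)) \<le> norm (indicator {- \<bar>R\<bar>..\<bar>R\<bar>} x + inverse (1 + x\<^sup>2) :: real)"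
    proof (rule AE_I2)
      fix x :: real
      have i0: "0 \<le> inverse (1 + x\<^sup>2)" using pos[of x] by simp
      show "norm (exp (- c * \<bar>x\<bar> powr a)) \<le> norm (indicator {- \<bar>R\<bar>..\<bar>R\<bar>} x + inverse (1 + x\<^sup>2) :: real)"
      proof (cases "\<bar>x\<bar> \<le> \<bar>R\<bar>")
        case True
        then have "x \<in> {- \<bar>R\<bar>..\<bar>R\<bar>}" by auto
        moreover have "exp (- c * \<bar>x\<bar> powr a) \<le> 1" using c by simp
        then have "exp (- c * \<bar>x\<bar> powr a) \<le> 1 + inverse (1 + x\<^sup>2)" using i0 by linarith
        ultimately show ?thesis using i0 by simp
      next
        case False
        then have "(1 + x\<^sup>2) * exp (- c * \<bar>x\<bar> powr a) < 1" using R[of "\<bar>x\<bar>"] by simp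
        then have "exp (- c * \<bar>x\<bar> powr a) \<le> inverse (1 + x\<^sup>2)"
          using pos[of x] by (simp add: field_simps)
        then show ?thesis using i0 by (simp add: indicator_def)
      qed
    qed
  qed simp
qed

text \<open>In polar coordinates this is elementary; here it follows from dimension one, since
  \<open>|x|\<^sup>a\<close> dominates the mean of the \<open>|x\<^sub>b|\<^sup>a\<close> over the coordinates \<open>b\<close>.\<close>

lemma integrable_exp_norm_powr:
  fixes c a :: real
  assumes c: "c > 0" and a: "a > 0"
  shows "integrable lborel (\<lambda>x::'a::euclidean_space. exp (- c * norm x powr a))"
proof -
  define c' where "c' = c / DIM('a)"
  have c': "c' > 0" using c by (simp add: c'_def)
  have int: "integrable lborel (\<lambda>x::'a. \<Prod>b\<in>Basis. exp (- c' * \<bar>x \<bullet> b\<bar> powr a))"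
    by (rule lborel_integral_prod_Basis(1)) (rule integrable_exp_abs_powr[OF c' a])
  show ?thesis
  proof (rule Bochner_Integration.integrable_bound[OF int])
    show "AE x::'a in lborel. norm (exp (- c * norm x powr a)) \<le> norm (\<Prod>b\<in>Basis. exp (- c' * \<bar>x \<bullet> b\<bar> powr a))"
    proof (rule AE_I2)
      fix x :: 'a
      have "(\<Sum>b\<in>Basis. \<bar>x \<bullet> b\<bar> powr a) \<le> (\<Sum>b\<in>(Basis::'a set). norm x powr a)"
        using a by (intro sum_mono powr_mono2) (auto simp: Basis_le_norm)
      then have "c' * (\<Sum>b\<in>Basis. \<bar>x \<bullet> b\<bar> powr a) \<le> c' * (DIM('a) * norm x powr a)"
        using c' by (intro mult_left_mono) auto
      also have "\<dots> = c * norm x powr a" by (simp add: c'_def)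
      finally have "exp (- c * norm x powr a) \<le> exp (- c' * (\<Sum>b\<in>Basis. \<bar>x \<bullet> b\<bar> powr a))" by simp
      also have "\<dots> = (\<Prod>b\<in>Basis. exp (- c' * \<bar>x \<bullet> b\<bar> powr a))"
        by (simp add: exp_sum[symmetric] sum_distrib_left sum_negf)
      finally show "norm (exp (- c * norm x powr a)) \<le> norm (\<Prod>b\<in>Basis. exp (- c' * \<bar>x \<bullet> b\<bar> powr a))"
        by (simp add: prod_nonneg)
    qed
  qed simp
qed

text \<open>Dominated convergence with a moving bound. The upper bound on the masses of \<open>b\<^sub>n\<close> forces convergence in
  \<open>L\<^sup>1\<close>, as in Scheffe's lemma, because the part of \<open>b\<^sub>n\<close> below the limit is controlled by ordinary dominated convergence.\<close>

lemma dominated_by_convergent_masses: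
  fixes a b :: "nat \<Rightarrow> 'x \<Rightarrow> real"
  assumes ia: "\<And>n. integrable N (a n)" and ib: "\<And>n. integrable N (b n)" and ib': "integrable N b'"
    and am [measurable]: "a' \<in> borel_measurable N"
    and a0: "\<And>n x. 0 \<le> a n x" and b0: "\<And>n x. 0 \<le> b n x" and C: "0 \<le> C" and ab: "\<And>n x. a n x \<le> C * b n x"
    and alim: "AE x in N. (\<lambda>n. a n x) \<longlonglongrightarrow> a' x" and blim: "AE x in N. (\<lambda>n. b n x) \<longlonglongrightarrow> b' x"
    and bc: "\<And>n. integral\<^sup>L N (b n) \<le> c n" and clim: "c \<longlonglongrightarrow> integral\<^sup>L N b'"
  shows "(\<lambda>n. integral\<^sup>L N (a n)) \<longlonglongrightarrow> integral\<^sup>L N a'"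
proof -
  have [measurable]: "a n \<in> borel_measurable N" "b n \<in> borel_measurable N" "b' \<in> borel_measurable N" for n
    using ia ib ib' by auto
  have b'0: "AE x in N. 0 \<le> b' x"
    using blim by eventually_elim (rule LIMSEQ_le_const, auto simp: b0)
  have "(\<lambda>n. \<integral>x. max 0 (b' x - b n x) \<partial>N) \<longlonglongrightarrow> (\<integral>x. 0 \<partial>N)"
  proof (rule integral_dominated_convergence[OF _ _ ib'])
    show "AE x in N. (\<lambda>n. max 0 (b' x - b n x)) \<longlonglongrightarrow> 0"
      using blim
    proof eventually_elim
      case (elim x)
      have "(\<lambda>n. max 0 (b' x - b n x)) \<longlonglongrightarrow> max 0 (b' x - b' x)"
        by (intro tendsto_max tendsto_intros elim)
      then show ?case by simp
    qed
    show "AE x in N. norm (max 0 (b' x - b n x)) \<le> b' x" for n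
      using b'0 by eventually_elim (use b0 in \<open>auto simp: max_def\<close>)
  qed auto
  then have low: "(\<lambda>n. \<integral>x. max 0 (b' x - b n x) \<partial>N) \<longlonglongrightarrow> 0" by simp
  have imax: "integrable N (\<lambda>x. max 0 (b' x - b n x))" "integrable N (\<lambda>x. max 0 (b n x - b' x))" for n
    using ib ib' by (auto intro!: integrable_max)
  have upeq: "(\<integral>x. max 0 (b n x - b' x) \<partial>N) = integral\<^sup>L N (b n) - integral\<^sup>L N b' + (\<integral>x. max 0 (b' x - b n x) \<partial>N)" for n
  proof -
    have "(\<integral>x. max 0 (b n x - b' x) \<partial>N) = (\<integral>x. (b n x - b' x) + max 0 (b' x - b n x) \<partial>N)"
      by (intro Bochner_Integration.integral_cong) auto
    then show ?thesis using ib ib' imax by simp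
  qed
  have up: "(\<lambda>n. \<integral>x. max 0 (b n x - b' x) \<partial>N) \<longlonglongrightarrow> 0"
  proof (rule real_tendsto_sandwich[OF _ _ tendsto_const])
    show "(\<lambda>n. c n - integral\<^sup>L N b' + (\<integral>x. max 0 (b' x - b n x) \<partial>N)) \<longlonglongrightarrow> 0"
      using tendsto_add[OF tendsto_diff[OF clim tendsto_const[of "integral\<^sup>L N b'"]] low] by simp
    show "\<forall>\<^sub>F n in sequentially. (\<integral>x. max 0 (b n x - b' x) \<partial>N) \<le> c n - integral\<^sup>L N b' + (\<integral>x. max 0 (b' x - b n x) \<partial>N)"
      unfolding upeq using bc by simp
  qed simp
  have min_lim: "(\<lambda>n. \<integral>x. min (a n x) (C * b' x) \<partial>N) \<longlonglongrightarrow> integral\<^sup>L N a'"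
  proof (rule integral_dominated_convergence[OF _ _ integrable_mult_right[OF ib', of C]])
    show "AE x in N. (\<lambda>n. min (a n x) (C * b' x)) \<longlonglongrightarrow> a' x"
      using alim blim
    proof eventually_elim
      case (elim x)
      have "a' x \<le> C * b' x"
        by (rule LIMSEQ_le[OF elim(1) tendsto_mult[OF tendsto_const elim(2)]]) (use ab in auto)
      moreover have "(\<lambda>n. min (a n x) (C * b' x)) \<longlonglongrightarrow> min (a' x) (C * b' x)"
        by (intro tendsto_min tendsto_intros elim)
      ultimately show ?case by (simp add: min_def)
    qed
    show "AE x in N. norm (min (a n x) (C * b' x)) \<le> C * b' x" for n
      using b'0
    proof eventually_elim
      case (elim x)
      then have "0 \<le> C * b' x" using C by simp
      then show ?case using a0[of n x] by (simp add: min_def)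
    qed
  qed auto
  have diff: "(\<lambda>n. integral\<^sup>L N (a n) - (\<integral>x. min (a n x) (C * b' x) \<partial>N)) \<longlonglongrightarrow> 0"
  proof (rule real_tendsto_sandwich[OF _ _ tendsto_const])
    show "(\<lambda>n. C * (\<integral>x. max 0 (b n x - b' x) \<partial>N)) \<longlonglongrightarrow> 0"
      using tendsto_mult[OF tendsto_const up, of C] by simp
    have imin: "integrable N (\<lambda>x. min (a n x) (C * b' x))" for n
      using ia ib' by (auto intro!: integrable_min)
    have eq: "integral\<^sup>L N (a n) - (\<integral>x. min (a n x) (C * b' x) \<partial>N) = (\<integral>x. a n x - min (a n x) (C * b' x) \<partial>N)" for n
      using ia imin by simp
    have "integral\<^sup>L N (a n) - (\<integral>x. min (a n x) (C * b' x) \<partial>N) \<le> C * (\<integral>x. max 0 (b n x - b' x) \<partial>N)" for n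
    proof -
      have "(\<integral>x. a n x - min (a n x) (C * b' x) \<partial>N) \<le> (\<integral>x. C * max 0 (b n x - b' x) \<partial>N)"
      proof (rule integral_mono)
        fix x
        have "C * (b n x - b' x) \<le> C * max 0 (b n x - b' x)" "0 \<le> C * max 0 (b n x - b' x)" using C by (auto intro!: mult_left_mono)
        then show "a n x - min (a n x) (C * b' x) \<le> C * max 0 (b n x - b' x)"
          using ab[of n x] by (simp add: min_def right_diff_distrib)
      qed (use ia imin imax in auto)
      then show ?thesis unfolding eq by simp
    qed
    then show "\<forall>\<^sub>F n in sequentially. integral\<^sup>L N (a n) - (\<integral>x. min (a n x) (C * b' x) \<partial>N) \<le> C * (\<integral>x. max 0 (b n x - b' x) \<partial>N)" by simp
    have "0 \<le> integral\<^sup>L N (a n) - (\<integral>x. min (a n x) (C * b' x) \<partial>N)" for n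
      unfolding eq by (intro integral_nonneg_AE AE_I2) simp
    then show "\<forall>\<^sub>F n in sequentially. 0 \<le> integral\<^sup>L N (a n) - (\<integral>x. min (a n x) (C * b' x) \<partial>N)" by simp
  qed
  show ?thesis using tendsto_add[OF diff min_lim] by simp
qed

text \<open>Chebyshev's inequality: the first two moments of \<open>y\<close> under the weights \<open>w\<close> are asymptotically those of
  a point mass at \<open>q\<close>, so \<open>y\<close> lies on the same side of \<open>\<theta>\<close> as \<open>q\<close> up to vanishing mass.\<close>

lemma spectral_concentration:
  fixes w y :: "nat \<Rightarrow> nat \<Rightarrow> real"
  assumes w0: "\<And>n k. 1 \<le> k \<Longrightarrow> 0 \<le> w n k"
    and S0: "\<And>n. (\<lambda>m. \<Sum>k=1..m. w n k) \<longlonglongrightarrow> A"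
    and S1: "\<And>n. (\<lambda>m. \<Sum>k=1..m. y n k * w n k) \<longlonglongrightarrow> S1 n" and l1: "S1 \<longlonglongrightarrow> A * q"
    and S2: "\<And>n. (\<lambda>m. \<Sum>k=1..m. (y n k)\<^sup>2 * w n k) \<longlonglongrightarrow> S2 n" and l2: "S2 \<longlonglongrightarrow> A * q\<^sup>2"
    and F: "\<And>n. F n = {k. 1 \<le> k \<and> \<theta> \<le> y n k}" and fin: "\<And>n. finite (F n)"
    and q: "q \<noteq> \<theta>"
  shows "(\<lambda>n. \<Sum>k\<in>F n. w n k) \<longlonglongrightarrow> (if \<theta> < q then A else 0)"
proof -
  \<comment> \<open>the second moment of \<open>y\<close> about \<open>q\<close>\<close>
  define V where "V n = S2 n - 2 * q * S1 n + q\<^sup>2 * A" for n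
  have Vs: "(\<lambda>m. \<Sum>k=1..m. (y n k - q)\<^sup>2 * w n k) \<longlonglongrightarrow> V n" for n
  proof -
    have "(\<lambda>m. (\<Sum>k=1..m. (y n k)\<^sup>2 * w n k) - 2 * q * (\<Sum>k=1..m. y n k * w n k) + q\<^sup>2 * (\<Sum>k=1..m. w n k)) \<longlonglongrightarrow> V n"
      unfolding V_def by (intro tendsto_intros S0 S1 S2)
    moreover have "(\<Sum>k=1..m. (y n k)\<^sup>2 * w n k) - 2 * q * (\<Sum>k=1..m. y n k * w n k) + q\<^sup>2 * (\<Sum>k=1..m. w n k) = (\<Sum>k=1..m. (y n k - q)\<^sup>2 * w n k)" for m
      unfolding sum_distrib_left sum_subtractf[symmetric] sum.distrib[symmetric]
      by (intro sum.cong refl) (simp add: power2_diff algebra_simps)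
    ultimately show ?thesis by simp
  qed
  have Vlim: "V \<longlonglongrightarrow> 0"
  proof -
    have "V \<longlonglongrightarrow> A * q\<^sup>2 - 2 * q * (A * q) + q\<^sup>2 * A"
      unfolding V_def by (intro tendsto_intros l1 l2)
    then show ?thesis by (simp add: power2_eq_square)
  qed
  define e where "e = (q - \<theta>)\<^sup>2"
  have e: "e > 0" using q by (simp add: e_def)
  have Fmem: "k \<in> F n \<longleftrightarrow> 1 \<le> k \<and> \<theta> \<le> y n k" for n k by (simp only: F mem_Collect_eq)
  \<comment> \<open>inserting \<open>0\<close> keeps the maximum meaningful when no index qualifies\<close>
  define K where "K n = Max (insert 0 (F n))" for n
  have K: "F n \<subseteq> {1..K n}" for n
  proof
    fix k assume k: "k \<in> F n"
    then have "k \<le> K n" unfolding K_def using fin[of n] by (intro Max_ge) simp_all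
    then show "k \<in> {1..K n}" using k[unfolded Fmem] by simp
  qed
  have Vpart: "(\<Sum>k\<in>G. (y n k - q)\<^sup>2 * w n k) \<le> V n" if G: "G \<subseteq> {1..m}" for G n m
  proof (rule LIMSEQ_le_const[OF Vs[of n]])
    have "(\<Sum>k\<in>G. (y n k - q)\<^sup>2 * w n k) \<le> (\<Sum>k=1..m'. (y n k - q)\<^sup>2 * w n k)" if "m' \<ge> m" for m'
      using G that by (intro sum_mono2) (auto simp: w0)
    then show "\<exists>N. \<forall>m'\<ge>N. (\<Sum>k\<in>G. (y n k - q)\<^sup>2 * w n k) \<le> (\<Sum>k=1..m'. (y n k - q)\<^sup>2 * w n k)" by blast
  qed
  show ?thesis
  proof (cases "\<theta> < q")
    case True
    have le: "(\<Sum>k\<in>F n. w n k) \<le> A" for n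
    proof (rule LIMSEQ_le_const[OF S0[of n]])
      have "(\<Sum>k\<in>F n. w n k) \<le> (\<Sum>k=1..m. w n k)" if "m \<ge> K n" for m
        using K[of n] that by (intro sum_mono2) (auto simp: w0)
      then show "\<exists>N. \<forall>m\<ge>N. (\<Sum>k\<in>F n. w n k) \<le> (\<Sum>k=1..m. w n k)" by blast
    qed
    have ge: "A - V n / e \<le> (\<Sum>k\<in>F n. w n k)" for n
    proof -
      have "(\<Sum>k=1..m. w n k) \<le> (\<Sum>k\<in>F n. w n k) + V n / e" if m: "m \<ge> K n" for m
      proof -
        have sub: "F n \<subseteq> {1..m}" using K[of n] m by auto
        have "e * (\<Sum>k\<in>{1..m} - F n. w n k) \<le> (\<Sum>k\<in>{1..m} - F n. (y n k - q)\<^sup>2 * w n k)"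
          unfolding sum_distrib_left
        proof (intro sum_mono mult_right_mono)
          fix k assume k: "k \<in> {1..m} - F n"
          then have yk: "y n k < \<theta>" and k1: "1 \<le> k" unfolding Diff_iff Fmem atLeastAtMost_iff by linarith+
          have "(q - \<theta>)\<^sup>2 \<le> (q - y n k)\<^sup>2" by (rule power_mono) (use True yk in linarith)+
          then show "e \<le> (y n k - q)\<^sup>2" by (simp add: e_def power2_commute)
          show "0 \<le> w n k" using k1 by (rule w0)
        qed
        also have "\<dots> \<le> V n" by (rule Vpart[of _ m]) auto
        finally have "(\<Sum>k\<in>{1..m} - F n. w n k) \<le> V n / e" using e by (simp add: pos_le_divide_eq mult.commute)
        moreover have "(\<Sum>k=1..m. w n k) = (\<Sum>k\<in>{1..m} - F n. w n k) + (\<Sum>k\<in>F n. w n k)"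
          by (rule sum.subset_diff[OF sub]) simp
        ultimately show ?thesis by simp
      qed
      then have "A \<le> (\<Sum>k\<in>F n. w n k) + V n / e" by (intro LIMSEQ_le_const2[OF S0[of n]]) blast
      then show ?thesis by simp
    qed
    have "(\<lambda>n. A - V n / e) \<longlonglongrightarrow> A - 0 / e" using e by (intro tendsto_intros Vlim) simp
    then have "(\<lambda>n. A - V n / e) \<longlonglongrightarrow> A" by simp
    then have "(\<lambda>n. \<Sum>k\<in>F n. w n k) \<longlonglongrightarrow> A"
      by (rule real_tendsto_sandwich[OF always_eventually[OF allI[OF ge]] always_eventually[OF allI[OF le]] _ tendsto_const])
    then show ?thesis unfolding if_P[OF True] .
  next
    case False
    have le: "(\<Sum>k\<in>F n. w n k) \<le> V n / e" for n
    proof -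
      have "e * (\<Sum>k\<in>F n. w n k) \<le> (\<Sum>k\<in>F n. (y n k - q)\<^sup>2 * w n k)"
        unfolding sum_distrib_left
      proof (intro sum_mono mult_right_mono)
        fix k assume k: "k \<in> F n"
        then have yk: "\<theta> \<le> y n k" and k1: "1 \<le> k" unfolding Fmem by linarith+
        have "(\<theta> - q)\<^sup>2 \<le> (y n k - q)\<^sup>2" by (rule power_mono) (use False yk in linarith)+
        then show "e \<le> (y n k - q)\<^sup>2" by (simp add: e_def power2_commute)
        show "0 \<le> w n k" using k1 by (rule w0)
      qed
      also have "\<dots> \<le> V n" by (rule Vpart[OF K])
      finally show ?thesis using e by (simp add: pos_le_divide_eq mult.commute)
    qed
    have ge: "0 \<le> (\<Sum>k\<in>F n. w n k)" for n by (intro sum_nonneg) (simp add: Fmem w0)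
    have "(\<lambda>n. V n / e) \<longlonglongrightarrow> 0 / e" using e by (intro tendsto_intros Vlim) simp
    then have "(\<lambda>n. V n / e) \<longlonglongrightarrow> 0" by simp
    then have "(\<lambda>n. \<Sum>k\<in>F n. w n k) \<longlonglongrightarrow> 0"
      by (rule real_tendsto_sandwich[OF always_eventually[OF allI[OF ge]] always_eventually[OF allI[OF le]] tendsto_const])
    then show ?thesis unfolding if_not_P[OF False] .
  qed
qed

text \<open>The characteristic exponent of the relativistic stable process.\<close>

definition rel_symbol :: "real \<Rightarrow> real \<Rightarrow> 'a::real_normed_vector \<Rightarrow> real" where
  "rel_symbol \<alpha> m \<xi> = (m powr (2 / \<alpha>) + (norm \<xi>)\<^sup>2) powr (\<alpha> / 2) - m"

lemma norm_sq_powr: "0 < \<alpha> \<Longrightarrow> ((norm x)\<^sup>2) powr (\<alpha> / 2) = norm x powr \<alpha>"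
  by (cases "x = 0") (simp_all add: powr_powr flip: powr_numeral)

lemma rel_symbol_lower: "0 < \<alpha> \<Longrightarrow> norm \<xi> powr \<alpha> - m \<le> rel_symbol \<alpha> m \<xi>"
  unfolding rel_symbol_def norm_sq_powr[symmetric] by (simp add: powr_mono2)

lemma rel_symbol_measurable [measurable]: "rel_symbol \<alpha> m \<in> borel_measurable (borel :: 'a::euclidean_space measure)"
  unfolding rel_symbol_def[abs_def] by measurable

lemma rel_symbol_scaled:
  assumes a: "0 < \<alpha>" and m: "0 < m" and r: "0 < r"
  shows "rel_symbol \<alpha> m ((r powr (1 / \<alpha>)) *\<^sub>R \<eta>) / r = ((m / r) powr (2 / \<alpha>) + (norm \<eta>)\<^sup>2) powr (\<alpha> / 2) - m / r"
proof -
  have n: "(norm ((r powr (1 / \<alpha>)) *\<^sub>R \<eta>))\<^sup>2 = r powr (2 / \<alpha>) * (norm \<eta>)\<^sup>2"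
    by (simp add: power_mult_distrib powr_powr flip: powr_numeral)
  have "m powr (2 / \<alpha>) + r powr (2 / \<alpha>) * (norm \<eta>)\<^sup>2 = r powr (2 / \<alpha>) * ((m / r) powr (2 / \<alpha>) + (norm \<eta>)\<^sup>2)"
    using m r by (simp add: powr_divide field_simps)
  also have "\<dots> powr (\<alpha> / 2) = r * ((m / r) powr (2 / \<alpha>) + (norm \<eta>)\<^sup>2) powr (\<alpha> / 2)"
    using a r by (simp add: powr_mult powr_powr)
  finally show ?thesis using r unfolding rel_symbol_def n by (simp add: diff_divide_distrib)
qed

lemma rel_symbol_scaling_limit:
  fixes \<eta> :: "'a::real_normed_vector"
  assumes a: "0 < \<alpha>" and m: "0 < m" and r: "\<And>n. 0 < r n" and rlim: "filterlim r at_top sequentially" and \<eta>: "\<eta> \<noteq> 0"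
  shows "(\<lambda>n. rel_symbol \<alpha> m ((r n powr (1 / \<alpha>)) *\<^sub>R \<eta>) / r n) \<longlonglongrightarrow> norm \<eta> powr \<alpha>"
proof -
  have mr: "(\<lambda>n. m / r n) \<longlonglongrightarrow> 0"
    by (rule tendsto_divide_0[OF tendsto_const filterlim_at_top_imp_at_infinity[OF rlim]])
  have "(\<lambda>n. (m / r n) powr (2 / \<alpha>)) \<longlonglongrightarrow> 0"
    by (rule tendsto_zero_powrI[OF mr tendsto_const]) (use a m r in \<open>auto simp: less_imp_le\<close>)
  then have "(\<lambda>n. ((m / r n) powr (2 / \<alpha>) + (norm \<eta>)\<^sup>2) powr (\<alpha> / 2) - m / r n) \<longlonglongrightarrow> (0 + (norm \<eta>)\<^sup>2) powr (\<alpha> / 2) - 0"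
    by (intro tendsto_intros mr) (use \<eta> in auto)
  then show ?thesis using a m r by (simp add: rel_symbol_scaled norm_sq_powr)
qed

lemma integrable_exp_rel_symbol:
  assumes a: "0 < \<alpha>" and t: "0 < t"
  shows "integrable lborel (\<lambda>\<xi>::'a::euclidean_space. exp (- t * rel_symbol \<alpha> m \<xi>))"
proof (rule Bochner_Integration.integrable_bound)
  show "integrable lborel (\<lambda>\<xi>::'a. exp (t * m) * exp (- t * norm \<xi> powr \<alpha>))"
    by (intro integrable_mult_right integrable_exp_norm_powr t a)
  have "- t * rel_symbol \<alpha> m \<xi> \<le> t * m + - t * norm \<xi> powr \<alpha>" for \<xi> :: 'a
    using mult_left_mono[OF rel_symbol_lower[OF a, of \<xi> m], of t] t by (simp add: right_diff_distrib)
  then show "AE \<xi>::'a in lborel. norm (exp (- t * rel_symbol \<alpha> m \<xi>)) \<le> norm (exp (t * m) * exp (- t * norm \<xi> powr \<alpha>))"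
    by (intro AE_I2) (simp flip: exp_add)
qed measurable

section \<open>Weyl asymptotics\<close>

text \<open>The analytic part of the argument, stated for arbitrary weights. After scaling, the integrals of \<open>a_n\<close> are the
  normalised counting function, and the \<open>b_n\<close> dominate them because
  \<open>1 \<le> e exp(-\<lambda>\<^sub>k/r)\<close> whenever \<open>\<lambda>\<^sub>k \<le> r\<close>.\<close>

lemma weyl_asymptotics_of_densities:
  fixes w :: "nat \<Rightarrow> 'a::euclidean_space \<Rightarrow> real" and L :: "real \<Rightarrow> 'a \<Rightarrow> real" and \<epsilon> :: "real \<Rightarrow> real"
  assumes a: "0 < \<alpha>" and m: "0 < m"
    and w0: "\<And>k \<xi>. 1 \<le> k \<Longrightarrow> 0 \<le> w k \<xi>"
    and wint: "\<And>k. 1 \<le> k \<Longrightarrow> integrable lborel (w k)" "\<And>k. 1 \<le> k \<Longrightarrow> integral\<^sup>L lborel (w k) = (2 * pi) ^ DIM('a)"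
    and mass: "\<And>\<xi>. (\<lambda>n. \<Sum>k=1..n. w k \<xi>) \<longlonglongrightarrow> A"
    and trace: "\<And>t \<xi>. 0 < t \<Longrightarrow> (\<lambda>n. \<Sum>k=1..n. exp (- lam k * t) * w k \<xi>) \<longlonglongrightarrow> L t \<xi>"
    and approx: "\<And>t \<xi>. 0 < t \<Longrightarrow> \<bar>L t \<xi> - A * exp (- t * rel_symbol \<alpha> m \<xi>)\<bar> \<le> \<epsilon> t"
    and small: "\<And>\<tau>. (\<And>n::nat. 0 < \<tau> n) \<Longrightarrow> \<tau> \<longlonglongrightarrow> 0 \<Longrightarrow> (\<lambda>n. \<epsilon> (\<tau> n)) \<longlonglongrightarrow> 0"
    and Lint: "\<And>t. 0 < t \<Longrightarrow> integrable lborel (L t)"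
    and Lle: "\<And>t. 0 < t \<Longrightarrow> integral\<^sup>L lborel (L t) \<le> A * (\<integral>\<xi>. exp (- t * rel_symbol \<alpha> m \<xi>) \<partial>(lborel :: 'a measure))"
    and lam: "filterlim lam at_top sequentially"
  shows "((\<lambda>r. r powr (- (real DIM('a) / \<alpha>)) * real (eigenvalue_count lam r))
    \<longlongrightarrow> A * unit_ball_vol (real DIM('a)) / (2 * pi) ^ DIM('a)) at_top"
proof (rule tendsto_at_topI_sequentially)
  fix r' :: "nat \<Rightarrow> real" assume r': "filterlim r' at_top sequentially"
  \<comment> \<open>the scale has to be positive at every index, not only eventually\<close>
  define r where "r n = max 1 (r' n)" for n
  have rr': "eventually (\<lambda>n. r n = r' n) sequentially"
  proof -
    have "eventually (\<lambda>n. 1 \<le> r' n) sequentially" using r' unfolding filterlim_at_top by blast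
    then show ?thesis by eventually_elim (simp add: r_def)
  qed
  have rlim: "filterlim r at_top sequentially"
    by (rule filterlim_at_top_mono[OF r']) (simp add: r_def)
  have r1: "1 \<le> r n" for n by (simp add: r_def)
  then have rpos: "0 < r n" for n using less_le_trans[OF zero_less_one] by blast
  define c where "c n = r n powr (1 / \<alpha>)" for n
  have c: "0 < c n" for n using rpos[of n] by (simp add: c_def)
  have cd: "c n ^ DIM('a) = r n powr (real DIM('a) / \<alpha>)" for n
    using c[of n] rpos[of n] by (simp add: c_def powr_powr flip: powr_realpow)
  define F where "F n = {k. 1 \<le> k \<and> lam k \<le> r n}" for n
  have fin: "finite (F n)" for n
  proof -
    have "eventually (\<lambda>k. r n + 1 \<le> lam k) sequentially" using lam unfolding filterlim_at_top by blast
    then obtain K where K: "\<And>k. k \<ge> K \<Longrightarrow> r n + 1 \<le> lam k" by (auto simp: eventually_sequentially)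
    have "F n \<subseteq> {..K}"
    proof
      fix k assume "k \<in> F n"
      then have "lam k \<le> r n" by (simp add: F_def)
      then have "\<not> k \<ge> K" using K[of k] by linarith
      then show "k \<in> {..K}" by simp
    qed
    then show ?thesis by (rule finite_subset) simp
  qed
  define a_n where "a_n n \<eta> = (\<Sum>k\<in>F n. w k (c n *\<^sub>R \<eta>))" for n \<eta>
  define b_n where "b_n n \<eta> = L (1 / r n) (c n *\<^sub>R \<eta>)" for n \<eta>
  define b' where "b' \<eta> = A * exp (- 1 * norm \<eta> powr \<alpha>)" for \<eta> :: 'a
  define a' where "a' \<eta> = A * indicator (ball 0 1) \<eta>" for \<eta> :: 'a
  have wm [measurable]: "w k \<in> borel_measurable borel" if "1 \<le> k" for k using wint(1)[OF that] by auto
  have Lm [measurable]: "L t \<in> borel_measurable borel" if "0 < t" for t using Lint[OF that] by auto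
  have A0: "0 \<le> A" by (rule LIMSEQ_le_const[OF mass[of 0]]) (auto intro!: sum_nonneg w0)
  have ti: "0 < 1 / r n" for n using rpos by simp
  have iwc: "integrable lborel (\<lambda>\<eta>. w k (c n *\<^sub>R \<eta>))" if "1 \<le> k" for k n
    using lborel_integral_scale(2)[OF c wm[OF that]] wint(1)[OF that] by blast
  have ewc: "(\<integral>\<eta>. w k (c n *\<^sub>R \<eta>) \<partial>lborel) = (2 * pi) ^ DIM('a) / c n ^ DIM('a)" if "1 \<le> k" for k n
    using lborel_integral_scale(1)[OF c[of n] wm[OF that]] wint(2)[OF that] c[of n] by (simp add: field_simps)
  have F1: "1 \<le> k" if "k \<in> F n" for k n using that by (simp add: F_def)
  have ia: "integrable lborel (a_n n)" for n
    unfolding a_n_def by (intro Bochner_Integration.integrable_sum iwc F1)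
  have ea: "integral\<^sup>L lborel (a_n n) = (2 * pi) ^ DIM('a) * (r n powr (- (real DIM('a) / \<alpha>)) * real (card (F n)))" for n
  proof -
    have "integral\<^sup>L lborel (a_n n) = (\<Sum>k\<in>F n. (2 * pi) ^ DIM('a) / c n ^ DIM('a))"
    proof -
      have "integral\<^sup>L lborel (a_n n) = (\<Sum>k\<in>F n. \<integral>\<eta>. w k (c n *\<^sub>R \<eta>) \<partial>lborel)"
        unfolding a_n_def by (rule Bochner_Integration.integral_sum) (rule iwc[OF F1])
      also have "\<dots> = (\<Sum>k\<in>F n. (2 * pi) ^ DIM('a) / c n ^ DIM('a))"
        by (intro sum.cong refl ewc F1)
      finally show ?thesis .
    qed
    then show ?thesis unfolding cd by (simp add: powr_minus divide_simps)
  qed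
  have ib: "integrable lborel (b_n n)" for n
    unfolding b_n_def using lborel_integral_scale(2)[OF c Lm[OF ti]] Lint[OF ti] by blast
  have ib': "integrable lborel b'"
    unfolding b'_def by (intro integrable_mult_right integrable_exp_norm_powr a) simp
  have [measurable]: "ball (0::'a) 1 \<in> sets borel" by simp
  have am: "a' \<in> borel_measurable lborel" unfolding a'_def[abs_def] by measurable
  have a0: "0 \<le> a_n n \<eta>" for n \<eta> unfolding a_n_def by (intro sum_nonneg w0 F1)
  have L0: "0 \<le> L t \<xi>" if "0 < t" for t \<xi>
    by (rule LIMSEQ_le_const[OF trace[OF that]]) (auto intro!: exI[of _ 0] sum_nonneg mult_nonneg_nonneg w0)
  have b0: "0 \<le> b_n n \<eta>" for n \<eta> unfolding b_n_def by (rule L0[OF ti])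
  have ab: "a_n n \<eta> \<le> exp 1 * b_n n \<eta>" for n \<eta>
  proof -
    obtain K where K: "F n \<subseteq> {1..K}"
    proof -
      have "F n \<subseteq> {1..Max (insert 0 (F n))}"
      proof
        fix k assume k: "k \<in> F n"
        then have "k \<le> Max (insert 0 (F n))" using fin[of n] by (intro Max_ge) simp_all
        then show "k \<in> {1..Max (insert 0 (F n))}" using F1[OF k] by simp
      qed
      then show thesis by (rule that)
    qed
    have "(\<Sum>k\<in>F n. exp (- lam k * (1 / r n)) * w k (c n *\<^sub>R \<eta>)) \<le> b_n n \<eta>"
      unfolding b_n_def
    proof (rule LIMSEQ_le_const[OF trace[OF ti]])
      have "(\<Sum>k\<in>F n. exp (- lam k * (1 / r n)) * w k (c n *\<^sub>R \<eta>)) \<le> (\<Sum>k=1..j. exp (- lam k * (1 / r n)) * w k (c n *\<^sub>R \<eta>))" if "j \<ge> K" for j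
        using K that by (intro sum_mono2) (auto intro!: mult_nonneg_nonneg w0)
      then show "\<exists>K. \<forall>j\<ge>K. (\<Sum>k\<in>F n. exp (- lam k * (1 / r n)) * w k (c n *\<^sub>R \<eta>)) \<le> (\<Sum>k=1..j. exp (- lam k * (1 / r n)) * w k (c n *\<^sub>R \<eta>))" by blast
    qed
    then have "exp 1 * (\<Sum>k\<in>F n. exp (- lam k * (1 / r n)) * w k (c n *\<^sub>R \<eta>)) \<le> exp 1 * b_n n \<eta>"
      by (rule mult_left_mono) simp
    moreover have "a_n n \<eta> \<le> exp 1 * (\<Sum>k\<in>F n. exp (- lam k * (1 / r n)) * w k (c n *\<^sub>R \<eta>))"
      unfolding a_n_def sum_distrib_left
    proof (rule sum_mono)
      fix k assume k: "k \<in> F n"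
      have "lam k / r n \<le> 1" using k rpos[of n] by (simp add: F_def)
      then have "exp 0 \<le> exp (1 + - lam k * (1 / r n))" by (subst exp_le_cancel_iff) simp
      then have "1 \<le> exp 1 * exp (- lam k * (1 / r n))" by (simp only: exp_add exp_zero)
      then have "1 * w k (c n *\<^sub>R \<eta>) \<le> exp 1 * exp (- lam k * (1 / r n)) * w k (c n *\<^sub>R \<eta>)"
        by (rule mult_right_mono) (rule w0[OF F1[OF k]])
      then show "w k (c n *\<^sub>R \<eta>) \<le> exp 1 * (exp (- lam k * (1 / r n)) * w k (c n *\<^sub>R \<eta>))" by (simp add: mult.assoc)
    qed
    ultimately show ?thesis by linarith
  qed
  have tlim: "(\<lambda>n. s / r n) \<longlonglongrightarrow> 0" for s :: real
    by (rule tendsto_divide_0[OF tendsto_const filterlim_at_top_imp_at_infinity[OF rlim]])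
  have Llim: "(\<lambda>n. L (s / r n) (c n *\<^sub>R \<eta>)) \<longlonglongrightarrow> A * exp (- s * norm \<eta> powr \<alpha>)" if s: "0 < s" and \<eta>: "\<eta> \<noteq> 0" for s \<eta>
  proof -
    have sp: "0 < s / r n" for n using s rpos by simp
    have 1: "(\<lambda>n. L (s / r n) (c n *\<^sub>R \<eta>) - A * exp (- (s / r n) * rel_symbol \<alpha> m (c n *\<^sub>R \<eta>))) \<longlonglongrightarrow> 0"
      by (rule Lim_null_comparison[OF _ small[OF sp tlim]]) (use approx[OF sp] in auto)
    have "(\<lambda>n. A * exp (- s * (rel_symbol \<alpha> m (c n *\<^sub>R \<eta>) / r n))) \<longlonglongrightarrow> A * exp (- s * norm \<eta> powr \<alpha>)"
      unfolding c_def by (intro tendsto_intros rel_symbol_scaling_limit a m rpos rlim \<eta>)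
    then have 2: "(\<lambda>n. A * exp (- (s / r n) * rel_symbol \<alpha> m (c n *\<^sub>R \<eta>))) \<longlonglongrightarrow> A * exp (- s * norm \<eta> powr \<alpha>)" by simp
    show ?thesis using tendsto_add[OF 1 2] by simp
  qed
  have blim: "AE \<eta> in lborel. (\<lambda>n. b_n n \<eta>) \<longlonglongrightarrow> b' \<eta>"
    using AE_lborel_singleton[of "0::'a"]
    by eventually_elim (use Llim[of 1] in \<open>simp add: b_n_def b'_def\<close>)
  have sphere: "sphere (0::'a) 1 \<in> null_sets lborel"
    using negligible_sphere[of "0::'a" 1] by (auto simp: null_sets_completion_iff negligible_iff_null_sets)
  have alim: "AE \<eta> in lborel. (\<lambda>n. a_n n \<eta>) \<longlonglongrightarrow> a' \<eta>"
    using AE_lborel_singleton[of "0::'a"] AE_not_in[OF sphere]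
  proof eventually_elim
    case (elim \<eta>)
    define q where "q = exp (- (norm \<eta> powr \<alpha>))"
    have "norm \<eta> \<noteq> 1" using elim by simp
    have q1: "exp (-1) < q \<longleftrightarrow> norm \<eta> < 1"
    proof -
      have "norm \<eta> powr \<alpha> < 1 \<longleftrightarrow> norm \<eta> < 1"
        using a powr_less_mono2[of \<alpha> "norm \<eta>" 1] powr_mono2[of \<alpha> 1 "norm \<eta>"] by (cases "norm \<eta> < 1") auto
      then show ?thesis by (simp add: q_def)
    qed
    have q2: "q \<noteq> exp (-1)"
    proof
      assume "q = exp (-1)"
      then have "norm \<eta> powr \<alpha> = 1" by (simp add: q_def)
      then have "(norm \<eta> powr \<alpha>) powr (1 / \<alpha>) = 1" by simp
      then have "norm \<eta> = 1" using a by (simp add: powr_powr)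
      then show False using \<open>norm \<eta> \<noteq> 1\<close> by simp
    qed
    have "(\<lambda>n. \<Sum>k\<in>F n. w k (c n *\<^sub>R \<eta>)) \<longlonglongrightarrow> (if exp (-1) < q then A else 0)"
    proof (rule spectral_concentration[where y = "\<lambda>n k. exp (- lam k * (1 / r n))"])
      show "0 \<le> w k (c n *\<^sub>R \<eta>)" if "1 \<le> k" for n k by (rule w0[OF that])
      show "(\<lambda>j. \<Sum>k=1..j. w k (c n *\<^sub>R \<eta>)) \<longlonglongrightarrow> A" for n by (rule mass)
      show "(\<lambda>j. \<Sum>k=1..j. exp (- lam k * (1 / r n)) * w k (c n *\<^sub>R \<eta>)) \<longlonglongrightarrow> L (1 / r n) (c n *\<^sub>R \<eta>)" for n by (rule trace[OF ti])
      show "(\<lambda>n. L (1 / r n) (c n *\<^sub>R \<eta>)) \<longlonglongrightarrow> A * q" using Llim[of 1 \<eta>] elim by (simp add: q_def)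
      show "(\<lambda>j. \<Sum>k=1..j. (exp (- lam k * (1 / r n)))\<^sup>2 * w k (c n *\<^sub>R \<eta>)) \<longlonglongrightarrow> L (2 / r n) (c n *\<^sub>R \<eta>)" for n
      proof -
        have "(exp (- lam k * (1 / r n)))\<^sup>2 = exp (- lam k * (2 / r n))" for k by (simp flip: exp_double)
        then show ?thesis using trace[of "2 / r n" "c n *\<^sub>R \<eta>"] rpos[of n] by simp
      qed
      show "(\<lambda>n. L (2 / r n) (c n *\<^sub>R \<eta>)) \<longlonglongrightarrow> A * q\<^sup>2"
      proof -
        have "q\<^sup>2 = exp (- 2 * norm \<eta> powr \<alpha>)" unfolding q_def by (simp flip: exp_double)
        then show ?thesis using Llim[of 2 \<eta>] elim by simp
      qed
      show "F n = {k. 1 \<le> k \<and> exp (- 1) \<le> exp (- lam k * (1 / r n))}" for n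
        using rpos[of n] by (simp add: F_def)
    qed (rule fin q2)+
    moreover have "(if exp (-1) < q then A else 0) = a' \<eta>"
      unfolding q1 by (simp add: a'_def indicator_def)
    ultimately show ?case by (simp add: a_n_def)
  qed
  have bc: "integral\<^sup>L lborel (b_n n) \<le> exp (m / r n) * integral\<^sup>L lborel b'" for n
  proof -
    have em: "(\<lambda>\<xi>::'a. exp (- (1 / r n) * rel_symbol \<alpha> m \<xi>)) \<in> borel_measurable borel" by measurable
    have ies: "integrable lborel (\<lambda>\<eta>::'a. exp (- (1 / r n) * rel_symbol \<alpha> m (c n *\<^sub>R \<eta>)))"
      using integrable_exp_rel_symbol[OF a ti, of n m, where ?'a = 'a] lborel_integral_scale(2)[OF c em, of n] by blast
    have "c n ^ DIM('a) * integral\<^sup>L lborel (b_n n) = integral\<^sup>L lborel (L (1 / r n))"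
      unfolding b_n_def using lborel_integral_scale(1)[OF c Lm[OF ti], of n n] by simp
    also have "\<dots> \<le> A * (\<integral>\<xi>. exp (- (1 / r n) * rel_symbol \<alpha> m \<xi>) \<partial>(lborel :: 'a measure))" by (rule Lle[OF ti])
    also have "\<dots> = c n ^ DIM('a) * (A * (\<integral>\<eta>. exp (- (1 / r n) * rel_symbol \<alpha> m (c n *\<^sub>R \<eta>)) \<partial>(lborel :: 'a measure)))"
      by (subst lborel_integral_scale(1)[OF c em, of n]) simp
    finally have "integral\<^sup>L lborel (b_n n) \<le> A * (\<integral>\<eta>. exp (- (1 / r n) * rel_symbol \<alpha> m (c n *\<^sub>R \<eta>)) \<partial>(lborel :: 'a measure))"
      using c[of n] by (simp only: mult_le_cancel_left_pos zero_less_power)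
    also have "\<dots> \<le> A * (\<integral>\<eta>. exp (m / r n) * exp (- 1 * norm \<eta> powr \<alpha>) \<partial>(lborel :: 'a measure))"
    proof (intro mult_left_mono[OF _ A0] integral_mono ies integrable_mult_right integrable_exp_norm_powr a)
      fix \<eta> :: 'a
      have "norm (c n *\<^sub>R \<eta>) powr \<alpha> = r n * norm \<eta> powr \<alpha>"
        using a rpos[of n] by (simp add: c_def powr_mult powr_powr)
      then have "r n * norm \<eta> powr \<alpha> - m \<le> rel_symbol \<alpha> m (c n *\<^sub>R \<eta>)"
        using rel_symbol_lower[OF a, of "c n *\<^sub>R \<eta>" m] by simp
      then have "(r n * norm \<eta> powr \<alpha> - m) / r n \<le> rel_symbol \<alpha> m (c n *\<^sub>R \<eta>) / r n"
        using rpos[of n] by (intro divide_right_mono) auto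
      then have "norm \<eta> powr \<alpha> - m / r n \<le> rel_symbol \<alpha> m (c n *\<^sub>R \<eta>) / r n"
        using rpos[of n] by (simp add: diff_divide_distrib)
      then show "exp (- (1 / r n) * rel_symbol \<alpha> m (c n *\<^sub>R \<eta>)) \<le> exp (m / r n) * exp (- 1 * norm \<eta> powr \<alpha>)"
        by (simp flip: exp_add)
    qed simp
    also have "\<dots> = exp (m / r n) * integral\<^sup>L lborel b'"
      unfolding b'_def by (simp only: integral_mult_right_zero mult.left_commute)
    finally show ?thesis .
  qed
  have clim: "(\<lambda>n. exp (m / r n) * integral\<^sup>L lborel b') \<longlonglongrightarrow> integral\<^sup>L lborel b'"
  proof -
    have "(\<lambda>n. exp (m / r n) * integral\<^sup>L lborel b') \<longlonglongrightarrow> exp 0 * integral\<^sup>L lborel b'"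
      by (intro tendsto_intros tlim)
    then show ?thesis by simp
  qed
  have "(\<lambda>n. integral\<^sup>L lborel (a_n n)) \<longlonglongrightarrow> integral\<^sup>L lborel a'"
    by (rule dominated_by_convergent_masses[OF ia ib ib' am a0 b0 _ ab alim blim bc clim]) simp
  also have "integral\<^sup>L lborel a' = A * unit_ball_vol (real DIM('a))"
    using content_ball[of 1 "0::'a"] by (simp add: a'_def[abs_def])
  finally have "(\<lambda>n. integral\<^sup>L lborel (a_n n) / (2 * pi) ^ DIM('a)) \<longlonglongrightarrow> A * unit_ball_vol (real DIM('a)) / (2 * pi) ^ DIM('a)"
    by (intro tendsto_divide tendsto_const) simp_all
  then have "(\<lambda>n. r n powr (- (real DIM('a) / \<alpha>)) * real (eigenvalue_count lam (r n))) \<longlonglongrightarrow> A * unit_ball_vol (real DIM('a)) / (2 * pi) ^ DIM('a)"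
    unfolding ea by (simp add: eigenvalue_count_def F_def)
  then show "(\<lambda>n. r' n powr (- (real DIM('a) / \<alpha>)) * real (eigenvalue_count lam (r' n))) \<longlonglongrightarrow> A * unit_ball_vol (real DIM('a)) / (2 * pi) ^ DIM('a)"
    by (rule Lim_transform_eventually) (use rr' in eventually_elim, simp)
qed

text \<open>The functional equation of \<open>\<Gamma>\<close>, applied at \<open>d/\<alpha>\<close> and at \<open>d/2\<close>, cancels the dependence on \<open>\<alpha>\<close>.\<close>

lemma C1_const_eq:
  assumes "0 < d" "0 < \<alpha>"
  shows "C1_const d \<alpha> * V / Gamma (1 + real d / \<alpha>) = V * unit_ball_vol (real d) / (2 * pi) ^ d"
proof -
  have ni: "x \<notin> \<int>\<^sub>\<le>\<^sub>0" if "0 < x" for x :: real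
    using that nonpos_Ints_nonpos[of x] by linarith
  have 1: "Gamma (1 + real d / \<alpha>) = real d / \<alpha> * Gamma (real d / \<alpha>)"
    using assms by (subst add.commute, subst Gamma_plus1) (auto intro!: ni)
  have 2: "Gamma (real d / 2 + 1) = real d / 2 * Gamma (real d / 2)"
    using assms by (subst Gamma_plus1) (auto intro!: ni)
  have g: "Gamma (real d / \<alpha>) > 0" "Gamma (real d / 2) > 0" using assms by (auto intro!: Gamma_real_pos)
  show ?thesis
    unfolding C1_const_def omega_const_def unit_ball_vol_def 1 2
    using assms by (simp add: field_simps less_imp_neq[OF g(1), symmetric] less_imp_neq[OF g(2), symmetric])
qed

theorem mainTheorem2:
  fixes M :: "'w measure"
    and X :: "real \<Rightarrow> 'w \<Rightarrow> 'a::euclidean_space"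
    and \<alpha> m :: real
    and D :: "'a set"
    and \<phi> :: "nat \<Rightarrow> 'a \<Rightarrow> real"
    and lam :: "nat \<Rightarrow> real"
  assumes "DIM('a) \<ge> 2" and "0 < \<alpha>" and "\<alpha> < 2" and "0 < m"
    and "relativistic_stable_process M X \<alpha> m"
    and "open D" and "connected D" and "D \<noteq> {}" and "emeasure lborel D < \<infinity>"
    and "L2_orthonormal_basis D \<phi>"
    and "lam 1 < lam 2" and "\<And>n. 2 \<le> n \<Longrightarrow> lam n \<le> lam (Suc n)"
    and "filterlim lam at_top sequentially"
    and "\<And>n t. 1 \<le> n \<Longrightarrow> 0 < t \<Longrightarrow>
      (AE x\<in>D in lborel. killed_semigroup M X D t (\<phi> n) x = exp (- lam n * t) * \<phi> n x)"
  shows "((\<lambda>r. r powr (- (real DIM('a) / \<alpha>)) * exp (- (m / r)) * real (eigenvalue_count lam r))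
      \<longlongrightarrow> C1_const DIM('a) \<alpha> * measure lborel D / Gamma (1 + real DIM('a) / \<alpha>)) at_top"
proof -
  interpret relativistic_stable_process M X \<alpha> m by fact
  note a = \<open>0 < \<alpha>\<close> and m = \<open>0 < m\<close> and D = \<open>open D\<close> and fin = \<open>emeasure lborel D < \<infinity>\<close>
    and basis = \<open>L2_orthonormal_basis D \<phi>\<close>
  note eig = assms(14)
  have Db [measurable]: "D \<in> sets borel" using D by simp
  define w where "w k = fourier_square (\<lambda>x. indicator D x * \<phi> k x)" for k
  have w0: "0 \<le> w k \<xi>" for k \<xi> by (simp add: w_def fourier_square_def)
  have ch: "expectation (\<lambda>\<omega>. cos (\<xi> \<bullet> X t \<omega>)) = exp (- t * rel_symbol \<alpha> m \<xi>)" if t: "0 \<le> t" for t \<xi>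
  proof -
    have [measurable]: "X t \<in> borel_measurable M" using t by (rule measurable_X)
    have i: "integrable M (\<lambda>\<omega>. iexp (\<xi> \<bullet> X t \<omega>))"
      by (rule integrable_const_bound[where B = 1]) auto
    have "expectation (\<lambda>\<omega>. cos (\<xi> \<bullet> X t \<omega>)) = expectation (\<lambda>\<omega>. Re (iexp (\<xi> \<bullet> X t \<omega>)))" by (simp add: Re_exp)
    also have "\<dots> = Re (CLINT \<omega>|M. iexp (\<xi> \<bullet> X t \<omega>))" by (rule integral_Re[OF i])
    also have "\<dots> = exp (- t * rel_symbol \<alpha> m \<xi>)" unfolding char_X[OF t] rel_symbol_def by simp
    finally show ?thesis .
  qed
  have trace: "(\<lambda>n. \<Sum>k=1..n. exp (- lam k * t) * w k \<xi>) \<longlonglongrightarrow> killed_symbol D t \<xi>" if t: "0 < t" for t \<xi>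
    unfolding w_def by (rule fourier_square_trace[OF D fin t basis eig[OF _ t]])
  have pos: "0 \<le> killed_symbol D t \<xi>" if t: "0 < t" for t \<xi>
    by (rule LIMSEQ_le_const[OF trace[OF t]]) (auto intro!: exI[of _ 0] sum_nonneg mult_nonneg_nonneg w0)
  have sq: "square_integrable_on (\<phi> k) D" "L2_inner D (\<phi> k) (\<phi> k) = 1" if "1 \<le> k" for k
    using basis that unfolding L2_orthonormal_basis_def by auto
  have planch: "integrable lborel (w k)" "integral\<^sup>L lborel (w k) = (2 * pi) ^ DIM('a)" if k: "1 \<le> k" for k
  proof -
    let ?f = "\<lambda>x. indicator D x * \<phi> k x"
    have fm [measurable]: "?f \<in> borel_measurable borel"
      using sq(1)[OF k] by (simp add: square_integrable_on_def set_borel_measurable_def)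
    have f2eq: "indicator D x * (\<phi> k x)\<^sup>2 = (?f x)\<^sup>2" for x by (simp add: indicator_def)
    have f2: "integrable lborel (\<lambda>x. (?f x)\<^sup>2)"
      using sq(1)[OF k] unfolding square_integrable_on_def set_integrable_def by (simp add: f2eq)
    have "(\<integral>x. (?f x)\<^sup>2 \<partial>lborel) = L2_inner D (\<phi> k) (\<phi> k)"
      unfolding L2_inner_def set_lebesgue_integral_def
      by (intro Bochner_Integration.integral_cong) (auto simp: indicator_def power2_eq_square)
    then have e2: "(\<integral>x. (?f x)\<^sup>2 \<partial>lborel) = 1" using sq(2)[OF k] by simp
    have iD: "integrable lborel (\<lambda>x. (indicator D x)\<^sup>2 :: real)"
      using integrable_cutoff_square[OF Db fin, of "\<lambda>_. 1"] by simp
    have "integrable lborel (\<lambda>x. indicator D x * ?f x)"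
      by (rule integrable_mult_of_squares[OF _ _ iD f2]) simp_all
    moreover have "indicator D x * ?f x = ?f x" for x by (simp add: indicator_def)
    ultimately have f1: "integrable lborel ?f" by (simp only:)
    show "integrable lborel (w k)" "integral\<^sup>L lborel (w k) = (2 * pi) ^ DIM('a)"
      unfolding w_def using plancherel[OF f1 f2] e2 by simp_all
  qed
  have ies: "integrable lborel (\<lambda>\<xi>::'a. exp (- t * rel_symbol \<alpha> m \<xi>))" if "0 < t" for t
    by (rule integrable_exp_rel_symbol[OF a that])
  have le: "integrable lborel (killed_symbol D t)"
    "integral\<^sup>L lborel (killed_symbol D t) \<le> measure lborel D * (\<integral>\<xi>. exp (- t * rel_symbol \<alpha> m \<xi>) \<partial>(lborel :: 'a measure))"
    if t: "0 < t" for t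
    using killed_symbol_integral_le[OF Db fin less_imp_le[OF t] pos[OF t]] ies[OF t] by (simp_all add: ch less_imp_le[OF t])
  have "((\<lambda>r. r powr (- (real DIM('a) / \<alpha>)) * real (eigenvalue_count lam r))
    \<longlongrightarrow> measure lborel D * unit_ball_vol (real DIM('a)) / (2 * pi) ^ DIM('a)) at_top"
  proof (rule weyl_asymptotics_of_densities[OF a m w0 planch _ trace _ _ le assms(13)])
    show "(\<lambda>n. \<Sum>k=1..n. w k \<xi>) \<longlonglongrightarrow> measure lborel D" for \<xi>
      unfolding w_def by (rule fourier_square_mass[OF basis Db fin])
    show "\<bar>killed_symbol D t \<xi> - measure lborel D * exp (- t * rel_symbol \<alpha> m \<xi>)\<bar> \<le> exit_mass D t" if "0 < t" for t \<xi>
      using killed_symbol_approx[OF Db fin less_imp_le[OF that], of \<xi>] by (simp add: ch less_imp_le[OF that])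
    show "(\<lambda>n. exit_mass D (\<tau> n)) \<longlonglongrightarrow> 0" if "\<And>n. 0 < \<tau> n" "\<tau> \<longlonglongrightarrow> 0" for \<tau> :: "nat \<Rightarrow> real"
      by (rule exit_mass_tendsto[OF D fin that])
  qed
  moreover have "((\<lambda>r. exp (- (m / r))) \<longlongrightarrow> exp (- 0)) at_top"
    by (intro tendsto_intros tendsto_divide_0[OF tendsto_const] filterlim_at_top_imp_at_infinity filterlim_ident)
  ultimately have "((\<lambda>r. r powr (- (real DIM('a) / \<alpha>)) * real (eigenvalue_count lam r) * exp (- (m / r)))
    \<longlongrightarrow> measure lborel D * unit_ball_vol (real DIM('a)) / (2 * pi) ^ DIM('a) * exp (- 0)) at_top"
    by (rule tendsto_mult)
  then show ?thesis
    unfolding C1_const_eq[OF DIM_positive a] by (simp add: mult_ac)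
qed

end
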